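(* Let $d\ge1$, let $\{r_n\}_{n\ge 1}$ be a sequence of positive integers with $\sum_{n=1}^\infty \frac1{r_n}<\infty$, let $G$ be the associated $2$-dimensional solenoid with Haar probability measure $\rho$ and canonical dense subgroup $H\cong\mathbb{C}$. Equip $G^d$ with its Haar measure $\rho^d$ (the product measure) and let $H^d\subset G^d$ be the dense subgroup, isomorphic to $\mathbb{C}^d$. Then there is a measurable function $F:G^d\to\mathbb{C}$ whose restriction to $\rho^d$-almost every coset of $H^d$ is an entire function on $\mathbb{C}^d$ with a dense orbit under the translation action of $\mathbb{C}^d$ on $\mathcal{E}(d)$; that is, for $\rho^d$-a.e. $g\in G^d$ the function $\hat F(g):\mathbb{C}^d\to\mathbb{C}$, $\hat F(g)(\vec z)=F(g+\vec z)$, belongs to $\mathcal{U}(d)$. Moreover, the push-forward of $\rho^d$ under the ($\rho^d$-a.e. defined) map $\hat F:G^d\to\mathcal{E}(d)$ is an ergodic measure on $\mathcal{E}(d)$ for the translation action of $\mathbb{C}^d$, and it is concentrated on $\mathcal{U}(d)$, i.e. almost every function belongs to $\mathcal{U}(d)$.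
   Context: $\mathcal{E}(d)$ is the space of entire functions $f:\mathbb{C}^d\to\mathbb{C}$ with the topology of uniform convergence on compact sets (a Polish space). The translation action of $\mathbb{C}^d$ on $\mathcal{E}(d)$ is $T_{\vec z}f(\vec w)=f(\vec w+\vec z)$. $\mathcal{U}(d)\subset\mathcal{E}(d)$ is the set of functions $f$ whose orbit $\{T_{\vec z}f:\vec z\in\mathbb{C}^d\}$ is dense in $\mathcal{E}(d)$. An ergodic measure is an invariant ergodic Borel probability measure. Solenoid: given a sequence of positive integers $\{r_n\}$, put $R_n=\prod_{i=1}^n r_i$. The $2$-dimensional solenoid $G$ is the inverse limit of the compact abelian groups $\mathbb{R}^2/R_n\mathbb{Z}^2$ along the natural homomorphisms $\mathbb{R}^2/R_{n+1}\mathbb{Z}^2\to\mathbb{R}^2/R_n\mathbb{Z}^2$. It is a compact abelian group. The diagonal homomorphism $\mathbb{R}^2\to G$, $t\mapsto (t \bmod R_n\mathbb{Z}^2)_{n\ge1}$, is injective with dense image $H$; identifying $\mathbb{R}^2$ with $\mathbb{C}$, one identifies $H$ with $\mathbb{C}$ and $H^d$ with $\mathbb{C}^d$. For $g\in G^d$, $\vec z\in\mathbb{C}^d$, $g+\vec z$ denotes the sum in $G^d$ of $g$ and the element of $H^d$ corresponding to $\vec z$. *)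

theory Defs
  imports "HOL-Algebra.Product_Groups" "HOL-Probability.Probability"
begin

section \<open>Borel measures, Haar measure, ergodicity\<close>

definition borel_of :: "'a topology \<Rightarrow> 'a measure" where
  "borel_of X = sigma (topspace X) {U. openin X U}"

definition quotient_topology :: "'a topology \<Rightarrow> ('a \<Rightarrow> 'b) \<Rightarrow> 'b topology" where
  "quotient_topology X q =
     topology (\<lambda>U. U \<subseteq> q ` topspace X \<and> openin X {x \<in> topspace X. q x \<in> U})"

lemma openin_quotient_topology:
  "openin (quotient_topology X q) U \<longleftrightarrow>
     U \<subseteq> q ` topspace X \<and> openin X {x \<in> topspace X. q x \<in> U}"
proof -
  have "istopology (\<lambda>U. U \<subseteq> q ` topspace X \<and> openin X {x \<in> topspace X. q x \<in> U})"
    unfolding istopology_def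
  proof (intro conjI allI impI)
    fix S T
    assume "S \<subseteq> q ` topspace X \<and> openin X {x \<in> topspace X. q x \<in> S}"
      and "T \<subseteq> q ` topspace X \<and> openin X {x \<in> topspace X. q x \<in> T}"
    moreover have "{x \<in> topspace X. q x \<in> S \<inter> T} =
        {x \<in> topspace X. q x \<in> S} \<inter> {x \<in> topspace X. q x \<in> T}" by auto
    ultimately show "S \<inter> T \<subseteq> q ` topspace X"
      and "openin X {x \<in> topspace X. q x \<in> S \<inter> T}" by auto
  next
    fix \<K>
    assume K: "\<forall>S\<in>\<K>. S \<subseteq> q ` topspace X \<and> openin X {x \<in> topspace X. q x \<in> S}"
    then show "\<Union>\<K> \<subseteq> q ` topspace X" by blast
    have "{x \<in> topspace X. q x \<in> \<Union>\<K>} = (\<Union>S\<in>\<K>. {x \<in> topspace X. q x \<in> S})" by auto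
    with K show "openin X {x \<in> topspace X. q x \<in> \<Union>\<K>}" by auto
  qed
  then show ?thesis
    unfolding quotient_topology_def by (subst topology_inverse') auto
qed

text \<open>Regularity is not required: on a compact metrizable group every finite Borel measure
  is regular.\<close>

definition haar_prob_measure ::
    "('a, 'b) monoid_scheme \<Rightarrow> 'a topology \<Rightarrow> 'a measure \<Rightarrow> bool" where
  "haar_prob_measure G X \<mu> \<longleftrightarrow>
     sets \<mu> = sets (borel_of X) \<and> prob_space \<mu> \<and>
     (\<forall>g\<in>carrier G. \<forall>A\<in>sets \<mu>. emeasure \<mu> ((\<lambda>x. g \<otimes>\<^bsub>G\<^esub> x) ` A) = emeasure \<mu> A)"

text \<open>The action is given as a family of maps \<open>T z\<close>. For an action of an uncountable group,
  ergodicity is understood for sets that each \<open>T z\<close> preserves up to a null set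
  (the null set may depend on \<open>z\<close>).\<close>

definition ergodic_measure :: "'a topology \<Rightarrow> ('z \<Rightarrow> 'a \<Rightarrow> 'a) \<Rightarrow> 'a measure \<Rightarrow> bool" where
  "ergodic_measure X T \<mu> \<longleftrightarrow>
     sets \<mu> = sets (borel_of X) \<and> prob_space \<mu> \<and>
     (\<forall>z. T z \<in> measurable \<mu> \<mu>) \<and>
     (\<forall>z. \<forall>A\<in>sets \<mu>. emeasure \<mu> (T z -` A \<inter> space \<mu>) = emeasure \<mu> A) \<and>
     (\<forall>A\<in>sets \<mu>. (\<forall>z. emeasure \<mu> (sym_diff (T z -` A \<inter> space \<mu>) A) = 0) \<longrightarrow>
        emeasure \<mu> A = 0 \<or> emeasure \<mu> A = 1)"


section \<open>Entire functions\<close>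

definition entire_functions :: "(complex ^ 'd \<Rightarrow> complex) set" where
  "entire_functions =
     {f. \<forall>z. \<exists>f'. (f has_derivative f') (at z) \<and> (\<forall>c v. f' (c *s v) = c * f' v)}"

text \<open>The topology of uniform convergence on compact sets.\<close>

definition entire_topology :: "(complex ^ 'd \<Rightarrow> complex) topology" where
  "entire_topology =
     topology (\<lambda>U. U \<subseteq> entire_functions \<and>
       (\<forall>f\<in>U. \<exists>K e. compact K \<and> e > 0 \<and>
          {g \<in> entire_functions. \<forall>w\<in>K. dist (g w) (f w) < e} \<subseteq> U))"

lemma openin_entire_topology:
  fixes U :: "(complex ^ 'd \<Rightarrow> complex) set"
  shows "openin entire_topology U \<longleftrightarrow> U \<subseteq> entire_functions \<and>
       (\<forall>f\<in>U. \<exists>K e. compact K \<and> e > 0 \<and>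
          {g \<in> entire_functions. \<forall>w\<in>K. dist (g w) (f w) < e} \<subseteq> U)"
proof -
  define B :: "(complex ^ 'd \<Rightarrow> complex) \<Rightarrow> (complex ^ 'd) set \<Rightarrow> real \<Rightarrow> _"
    where "B f K e = {g \<in> entire_functions. \<forall>w\<in>K. dist (g w) (f w) < e}" for f K e
  have "istopology (\<lambda>U. U \<subseteq> entire_functions \<and>
      (\<forall>f\<in>U. \<exists>K e. compact K \<and> e > 0 \<and> B f K e \<subseteq> U))"
    unfolding istopology_def
  proof (intro conjI allI impI ballI)
    fix S T f
    assume S: "S \<subseteq> entire_functions \<and> (\<forall>f\<in>S. \<exists>K e. compact K \<and> e > 0 \<and> B f K e \<subseteq> S)"
      and T: "T \<subseteq> entire_functions \<and> (\<forall>f\<in>T. \<exists>K e. compact K \<and> e > 0 \<and> B f K e \<subseteq> T)"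
    from S show "S \<inter> T \<subseteq> entire_functions" by blast
    assume "f \<in> S \<inter> T"
    with S T obtain K1 e1 K2 e2 where
      1: "compact K1" "e1 > 0" "B f K1 e1 \<subseteq> S" and
      2: "compact K2" "e2 > 0" "B f K2 e2 \<subseteq> T" by (meson IntD1 IntD2)
    have "B f (K1 \<union> K2) (min e1 e2) \<subseteq> B f K1 e1 \<inter> B f K2 e2"
      by (auto simp: B_def)
    with 1 2 have "compact (K1 \<union> K2) \<and> min e1 e2 > 0 \<and> B f (K1 \<union> K2) (min e1 e2) \<subseteq> S \<inter> T"
      by auto
    then show "\<exists>K e. compact K \<and> e > 0 \<and> B f K e \<subseteq> S \<inter> T" by blast
  next
    fix \<K>
    assume K: "\<forall>S\<in>\<K>. S \<subseteq> entire_functions \<and>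
      (\<forall>f\<in>S. \<exists>K e. compact K \<and> e > 0 \<and> B f K e \<subseteq> S)"
    then show "\<Union>\<K> \<subseteq> entire_functions" by blast
    fix f assume "f \<in> \<Union>\<K>"
    then obtain S where "S \<in> \<K>" "f \<in> S" by blast
    with K obtain K e where "compact K" "e > 0" "B f K e \<subseteq> S" by meson
    with \<open>S \<in> \<K>\<close> show "\<exists>K e. compact K \<and> e > 0 \<and> B f K e \<subseteq> \<Union>\<K>" by blast
  qed
  then show ?thesis
    unfolding entire_topology_def B_def by (subst topology_inverse') auto
qed

lemma topspace_entire_topology: "topspace entire_topology = entire_functions"
proof -
  have "openin entire_topology (entire_functions :: (complex ^ 'd \<Rightarrow> complex) set)"
    unfolding openin_entire_topology
    by (intro conjI ballI exI[of _ "{}"] exI[of _ "1::real"]) auto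
  then have "entire_functions \<subseteq> topspace (entire_topology :: (complex ^ 'd \<Rightarrow> complex) topology)"
    by (rule openin_subset)
  moreover have "topspace entire_topology \<subseteq> (entire_functions :: (complex ^ 'd \<Rightarrow> complex) set)"
    using openin_topspace[of entire_topology] unfolding openin_entire_topology by (rule conjunct1)
  ultimately show ?thesis by (rule subset_antisym[rotated])
qed

definition translate :: "complex ^ 'd \<Rightarrow> (complex ^ 'd \<Rightarrow> complex) \<Rightarrow> complex ^ 'd \<Rightarrow> complex" where
  "translate z f = (\<lambda>w. f (w + z))"

definition universal_functions :: "(complex ^ 'd \<Rightarrow> complex) set" where
  "universal_functions =
     {f \<in> entire_functions.
        entire_topology closure_of (range (\<lambda>z. translate z f)) = topspace entire_topology}"


section \<open>The solenoid\<close>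

text \<open>\<open>\<real>\<^sup>2\<close> is identified with \<open>\<complex>\<close> throughout, so that \<open>R\<^sub>n \<int>\<^sup>2\<close> becomes a lattice in \<open>\<complex>\<close>.
  Sequences are indexed by \<open>n \<ge> 1\<close>; the values at \<open>0\<close> play no role.\<close>

definition cadd :: "complex monoid" where
  "cadd = \<lparr>carrier = UNIV, monoid.mult = (+), one = 0\<rparr>"

definition Rprod :: "(nat \<Rightarrow> nat) \<Rightarrow> nat \<Rightarrow> nat" where
  "Rprod r n = (\<Prod>i=1..n. r i)"

definition lattice_subgroup :: "(nat \<Rightarrow> nat) \<Rightarrow> nat \<Rightarrow> complex set" where
  "lattice_subgroup r n =
     {Complex (real (Rprod r n) * of_int a) (real (Rprod r n) * of_int b) | a b :: int. True}"

definition torus :: "(nat \<Rightarrow> nat) \<Rightarrow> nat \<Rightarrow> complex set monoid" where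
  "torus r n = cadd Mod lattice_subgroup r n"

definition torus_coset :: "(nat \<Rightarrow> nat) \<Rightarrow> nat \<Rightarrow> complex \<Rightarrow> complex set" where
  "torus_coset r n z = lattice_subgroup r n #>\<^bsub>cadd\<^esub> z"

definition torus_topology :: "(nat \<Rightarrow> nat) \<Rightarrow> nat \<Rightarrow> complex set topology" where
  "torus_topology r n = quotient_topology euclidean (torus_coset r n)"

text \<open>The natural homomorphism from level \<open>n + 1\<close> to level \<open>n\<close>:
  it sends the coset \<open>z + R\<^bsub>n+1\<^esub> \<int>\<^sup>2\<close> to \<open>z + R\<^sub>n \<int>\<^sup>2\<close>.\<close>

definition torus_proj :: "(nat \<Rightarrow> nat) \<Rightarrow> nat \<Rightarrow> complex set \<Rightarrow> complex set" where
  "torus_proj r n C = lattice_subgroup r n <#>\<^bsub>cadd\<^esub> C"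

definition solenoid_carrier :: "(nat \<Rightarrow> nat) \<Rightarrow> (nat \<Rightarrow> complex set) set" where
  "solenoid_carrier r =
     {x \<in> carrier (product_group {1..} (torus r)). \<forall>n\<ge>1. torus_proj r n (x (Suc n)) = x n}"

definition solenoid :: "(nat \<Rightarrow> nat) \<Rightarrow> (nat \<Rightarrow> complex set) monoid" where
  "solenoid r = (product_group {1..} (torus r))\<lparr>carrier := solenoid_carrier r\<rparr>"

definition solenoid_topology :: "(nat \<Rightarrow> nat) \<Rightarrow> (nat \<Rightarrow> complex set) topology" where
  "solenoid_topology r =
     subtopology (product_topology (torus_topology r) {1..}) (solenoid_carrier r)"

definition solenoid_diag :: "(nat \<Rightarrow> nat) \<Rightarrow> complex \<Rightarrow> nat \<Rightarrow> complex set" where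
  "solenoid_diag r z = (\<lambda>n\<in>{1..}. torus_coset r n z)"

definition solenoid_power :: "(nat \<Rightarrow> nat) \<Rightarrow> ('d \<Rightarrow> nat \<Rightarrow> complex set) monoid" where
  "solenoid_power r = product_group UNIV (\<lambda>_. solenoid r)"

definition solenoid_power_diag ::
    "(nat \<Rightarrow> nat) \<Rightarrow> complex ^ 'd \<Rightarrow> 'd \<Rightarrow> nat \<Rightarrow> complex set" where
  "solenoid_power_diag r z = (\<lambda>i. solenoid_diag r (z $ i))"

text \<open>\<open>coset_function r F g\<close> is the function \<open>z \<mapsto> F (g + z)\<close> on \<open>\<complex>\<^sup>d\<close>.\<close>

definition coset_function ::
    "(nat \<Rightarrow> nat) \<Rightarrow> (('d \<Rightarrow> nat \<Rightarrow> complex set) \<Rightarrow> complex) \<Rightarrow>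
       ('d \<Rightarrow> nat \<Rightarrow> complex set) \<Rightarrow> complex ^ 'd \<Rightarrow> complex" where
  "coset_function r F g = (\<lambda>z. F (g \<otimes>\<^bsub>solenoid_power r\<^esub> solenoid_power_diag r z))"

text \<open>\<open>\<nu>\<close> is the push-forward of \<open>\<mu>\<close> under the almost everywhere defined map \<open>h\<close> into the
  space \<open>X\<close>: \<open>h\<close> agrees almost everywhere with a Borel map \<open>\<Phi>\<close> into \<open>X\<close>, and
  \<open>\<nu>\<close> is the image of \<open>\<mu>\<close> under \<open>\<Phi>\<close>. It does not depend on the choice of \<open>\<Phi>\<close>.\<close>

definition ae_push_forward ::
    "'a measure \<Rightarrow> 'b topology \<Rightarrow> ('a \<Rightarrow> 'b) \<Rightarrow> 'b measure \<Rightarrow> bool" where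
  "ae_push_forward \<mu> X h \<nu> \<longleftrightarrow>
     (\<exists>\<Phi>. \<Phi> \<in> measurable \<mu> (borel_of X) \<and> (AE x in \<mu>. h x = \<Phi> x) \<and>
          \<nu> = distr \<mu> (borel_of X) \<Phi>)"

end

theory Submission
  imports Defs "HOL-Complex_Analysis.Cauchy_Integral_Formula"
begin

text \<open>At level \<open>n\<close> a point \<open>g\<close> of the power of the solenoid is seen through its representative
  \<open>Z n g\<close> in the cube with side \<open>R (Suc n)\<close>. The action of \<open>\<complex>\<^sup>d\<close> moves this representative by
  ordinary translation as long as the boundary of the cube is not crossed, and the cube of
  the next level is tiled by lattice translates of the present one. Entire functions \<open>P n\<close> are
  built recursively: \<open>P (Suc n)\<close> copies \<open>P n\<close>, up to \<open>2\<^sup>-\<^sup>n\<close>, on the tiles that do not touch the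
  boundary of the new cube, at distance at least \<open>R n\<close> from the boundary of the tile, and in the room that is left around one lattice corner it copies the
  \<open>n\<close>-th member of a sequence in which every member of a dense sequence of entire functions
  recurs (\<open>coherent_exists\<close>). Such a step is possible by a Runge theorem
  for finitely many boxes (\<open>entire_approximation_on_boxes\<close>); since the boxes are
  products of intervals taken from one finite disjoint family, it reduces to approximating the
  indicator function of a half-plane (\<open>approximable_half_plane\<close>).

  The function is \<open>F g = lim P n (Z n g)\<close>. Slices of thickness \<open>R n\<close> of the cube of side
  \<open>R (Suc n)\<close> are translates of each other, so the slices next to the boundary have measure of order
  \<open>R n / R (Suc n) = 1 / r (Suc n)\<close>. This is summable, and Borel-Cantelli shows that almost every
  point eventually stays at distance \<open>2 * R n\<close> from the boundary (\<open>AE_eventually_deep\<close>).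
  Along the orbit of such a point the limit is locally uniform, hence entire
  (\<open>limit_function_entire\<close>), and the translation that takes \<open>Z (Suc n) g\<close> to the corner
  mentioned above shows the \<open>n\<close>-th function of the sequence (\<open>limit_function_visits\<close>), so the
  orbit of the entire function is dense.

  The image measure is ergodic because the action on the power of the solenoid is. An
  invariant set is almost a union of cells of a fine grid at some level, and the average of
  such a union over the translations of the grid is constant; the invariant set is therefore
  nearly independent of itself (\<open>translations_ergodic\<close>). The Haar measure enters only through
  its invariance under translations, together with the fact that the cells generate the
  Borel sets of the solenoid (\<open>sets_solenoid_cells\<close>).\<close>


section \<open>The algebra of entire functions\<close>

lemma entire_const: "(\<lambda>z. c) \<in> (entire_functions :: (complex ^ 'd \<Rightarrow> complex) set)"
  unfolding entire_functions_def
  by (auto intro!: exI[of _ "\<lambda>_. 0"])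

lemma entire_coord: "(\<lambda>z. z $ i) \<in> (entire_functions :: (complex ^ 'd::finite \<Rightarrow> complex) set)"
  unfolding entire_functions_def
  by (auto intro!: exI[of _ "\<lambda>v. v $ i"] bounded_linear_imp_has_derivative bounded_linear_vec_nth)

lemma entire_add:
  fixes f g :: "complex ^ 'd::finite \<Rightarrow> complex"
  assumes "f \<in> entire_functions" "g \<in> entire_functions"
  shows "(\<lambda>z. f z + g z) \<in> entire_functions"
  unfolding entire_functions_def
proof (intro CollectI allI)
  fix z
  obtain f' g' where "(f has_derivative f') (at z)" "\<forall>c v. f' (c *s v) = c * f' v"
    "(g has_derivative g') (at z)" "\<forall>c v. g' (c *s v) = c * g' v"
    using assms unfolding entire_functions_def by blast
  then show "\<exists>h. ((\<lambda>z. f z + g z) has_derivative h) (at z) \<and> (\<forall>c v. h (c *s v) = c * h v)"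
    by (intro exI[of _ "\<lambda>v. f' v + g' v"]) (auto intro!: has_derivative_add simp: algebra_simps)
qed

lemma entire_mult:
  fixes f g :: "complex ^ 'd::finite \<Rightarrow> complex"
  assumes "f \<in> entire_functions" "g \<in> entire_functions"
  shows "(\<lambda>z. f z * g z) \<in> entire_functions"
  unfolding entire_functions_def
proof (intro CollectI allI)
  fix z
  obtain f' g' where "(f has_derivative f') (at z)" "\<forall>c v. f' (c *s v) = c * f' v"
    "(g has_derivative g') (at z)" "\<forall>c v. g' (c *s v) = c * g' v"
    using assms unfolding entire_functions_def by blast
  then show "\<exists>h. ((\<lambda>z. f z * g z) has_derivative h) (at z) \<and> (\<forall>c v. h (c *s v) = c * h v)"
    by (intro exI[of _ "\<lambda>v. f z * g' v + f' v * g z"])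
      (auto intro!: has_derivative_mult simp: algebra_simps)
qed

lemma entire_translate:
  fixes f :: "complex ^ 'd::finite \<Rightarrow> complex"
  assumes "f \<in> entire_functions"
  shows "(\<lambda>w. f (w + z)) \<in> entire_functions"
  unfolding entire_functions_def
proof (intro CollectI allI)
  fix w
  obtain f' where f': "(f has_derivative f') (at (w + z))" "\<forall>c v. f' (c *s v) = c * f' v"
    using assms unfolding entire_functions_def by blast
  have "((\<lambda>w. f (w + z)) has_derivative (\<lambda>v. f' v)) (at w)"
    by (rule has_derivative_compose[of "\<lambda>w. w + z" "\<lambda>v. v", OF _ f'(1)])
       (auto intro!: derivative_eq_intros)
  then show "\<exists>h. ((\<lambda>w. f (w + z)) has_derivative h) (at w) \<and> (\<forall>c v. h (c *s v) = c * h v)"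
    using f'(2) by blast
qed

lemma entire_continuous_on:
  fixes f :: "complex ^ 'd::finite \<Rightarrow> complex"
  assumes "f \<in> entire_functions"
  shows "continuous_on S f"
  using assms unfolding entire_functions_def
  by (intro continuous_at_imp_continuous_on ballI) (blast intro: has_derivative_continuous)

lemma entire_bounded_on:
  fixes f :: "complex ^ 'd::finite \<Rightarrow> complex"
  assumes "f \<in> entire_functions" "bounded K"
  shows "\<exists>B. \<forall>z\<in>K. norm (f z) \<le> B"
proof -
  have "compact (f ` closure K)"
    using assms by (intro compact_continuous_image entire_continuous_on) (auto simp: compact_closure)
  then obtain B where "\<forall>w\<in>f ` closure K. norm w \<le> B"
    using compact_imp_bounded bounded_iff by metis
  then show ?thesis using closure_subset[of K] by blast
qed

lemma norm_vector_smult: "norm (c *s (v :: complex ^ 'd::finite)) = norm c * norm v"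
  by (simp add: norm_vec_def norm_mult L2_set_right_distrib)

text \<open>The Cauchy estimate, applied to the restriction of \<open>f\<close> to the complex line through \<open>x\<close>
  in the direction of \<open>h\<close>.\<close>

lemma entire_derivative_bound:
  fixes f :: "complex ^ 'd::finite \<Rightarrow> complex"
  assumes f: "f \<in> entire_functions"
    and f': "(f has_derivative f') (at x)" "\<And>c v. f' (c *s v) = c * f' v"
    and bound: "\<And>y. dist x y \<le> 1 \<Longrightarrow> norm (f y) \<le> e"
  shows "norm (f' h) \<le> e * norm h"
proof (cases "h = 0")
  case True
  then show ?thesis using f'(2)[of 0 h] by simp
next
  case False
  define k where "k = of_real (1 / norm h) *s h"
  have nk: "norm k = 1" using False by (simp add: k_def norm_vector_smult norm_divide)
  define \<phi> where "\<phi> t = f (x + t *s k)" for t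
  have line: "((\<lambda>t. x + t *s k) has_derivative (\<lambda>s. s *s k)) (at t)" for t
  proof -
    have "bounded_linear (\<lambda>s. s *s k)"
      by (intro bounded_linear_intro[of _ "norm k"])
         (auto simp: norm_vector_smult vec_eq_iff algebra_simps)
    then have "((\<lambda>t. t *s k) has_derivative (\<lambda>s. s *s k)) (at t)"
      by (rule bounded_linear_imp_has_derivative)
    then show ?thesis by (auto intro!: derivative_eq_intros)
  qed
  have der: "\<exists>D. (\<phi> has_field_derivative D) (at t)" for t
  proof -
    obtain D where D: "(f has_derivative D) (at (x + t *s k))" "\<forall>c v. D (c *s v) = c * D v"
      using f unfolding entire_functions_def by blast
    have "(\<phi> has_derivative (\<lambda>s. D (s *s k))) (at t)"
      unfolding \<phi>_def by (rule has_derivative_compose[OF line D(1)])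
    then show ?thesis using D(2) unfolding has_field_derivative_def
      by (intro exI[of _ "D k"]) (simp add: mult_commute_abs)
  qed
  then have hol: "\<phi> holomorphic_on UNIV"
    by (auto simp: holomorphic_on_def field_differentiable_def)
  have "(\<phi> has_derivative (\<lambda>s. f' (s *s k))) (at 0)"
    unfolding \<phi>_def by (rule has_derivative_compose[OF line]) (use f' in simp)
  then have "(\<phi> has_field_derivative f' k) (at 0)"
    using f'(2) unfolding has_field_derivative_def by (simp add: mult_commute_abs)
  then have d0: "deriv \<phi> 0 = f' k" by (rule DERIV_imp_deriv)
  have "norm ((deriv ^^ 1) \<phi> 0) \<le> fact 1 * e / 1 ^ 1"
  proof (rule Cauchy_inequality)
    show "\<phi> holomorphic_on ball 0 1" using hol holomorphic_on_subset by blast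
    show "continuous_on (cball 0 1) \<phi>"
      using holomorphic_on_imp_continuous_on[OF hol] continuous_on_subset by blast
    fix t :: complex assume "norm (0 - t) = 1"
    then show "norm (\<phi> t) \<le> e" unfolding \<phi>_def
      by (intro bound) (simp add: dist_norm norm_vector_smult nk)
  qed simp
  then have "norm (f' k) \<le> e" by (simp add: d0)
  moreover have "h = of_real (norm h) *s k" using False by (simp add: k_def vec_eq_iff)
  then have "f' h = of_real (norm h) * f' k" using f'(2) by metis
  ultimately show ?thesis
    using mult_left_mono[of "norm (f' k)" e "norm h"] by (simp add: norm_mult mult.commute)
qed

text \<open>By \<open>entire_derivative_bound\<close> uniform convergence of the functions on a ball forces uniform
  convergence of the derivatives on a smaller ball. So the limit is differentiable, and its
  derivative is complex linear because it is the pointwise limit of the derivatives.\<close>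

lemma entire_locally_uniform_limit:
  fixes f :: "nat \<Rightarrow> complex ^ 'd::finite \<Rightarrow> complex"
  assumes f: "\<And>n. f n \<in> entire_functions"
    and lim: "\<And>B. uniform_limit (cball 0 B) f F sequentially"
  shows "F \<in> entire_functions"
  unfolding entire_functions_def
proof (intro CollectI allI)
  fix z
  obtain D where D: "\<And>n x. (f n has_derivative D n x) (at x)" "\<And>n x c v. D n x (c *s v) = c * D n x v"
    using f unfolding entire_functions_def by simp metis
  define S :: "(complex ^ 'd) set" where "S = ball z 1"
  have Cauchy_D: "\<exists>N. \<forall>m\<ge>N. \<forall>n\<ge>N. \<forall>x\<in>S. \<forall>h. norm (D m x h - D n x h) \<le> e * norm h" if "e > 0" for e
  proof -
    have "uniformly_Cauchy_on (cball 0 (norm z + 2)) f"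
      using lim uniformly_convergent_Cauchy uniformly_convergent_on_def by blast
    then obtain N where N: "\<And>m n y. m \<ge> N \<Longrightarrow> n \<ge> N \<Longrightarrow> y \<in> cball 0 (norm z + 2) \<Longrightarrow> dist (f m y) (f n y) < e"
      using \<open>e > 0\<close> unfolding uniformly_Cauchy_on_def by metis
    show ?thesis
    proof (intro exI[of _ N] allI impI ballI)
      fix m n x h assume mn: "N \<le> m" "N \<le> n" and x: "x \<in> S"
      have ent: "(\<lambda>y. f m y + (-1) * f n y) \<in> entire_functions"
        by (intro entire_add entire_mult entire_const f)
      have "norm (D m x h + (-1) * D n x h) \<le> e * norm h"
      proof (rule entire_derivative_bound[OF ent])
        show "((\<lambda>y. f m y + (-1) * f n y) has_derivative (\<lambda>h. D m x h + (-1) * D n x h)) (at x)"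
          by (intro has_derivative_add has_derivative_mult_right D)
        show "D m x (c *s v) + (-1) * D n x (c *s v) = c * (D m x v + (-1) * D n x v)" for c v
          by (simp add: D algebra_simps)
        fix y assume "dist x y \<le> 1"
        then have "norm y \<le> norm z + 2"
          using x norm_triangle_sub[of y z] dist_triangle[of y z x]
          by (simp add: S_def dist_commute dist_norm[symmetric])
        then show "norm (f m y + (-1) * f n y) \<le> e"
          using N[OF mn, of y] by (simp add: dist_norm)
      qed
      then show "norm (D m x h - D n x h) \<le> e * norm h" by simp
    qed
  qed
  have conv: "convergent (\<lambda>n. D n x h)" if "x \<in> S" for x h
  proof -
    have "Cauchy (\<lambda>n. D n x h)"
    proof (rule metric_CauchyI)
      fix e :: real assume "e > 0"
      then have "e / (norm h + 1) > 0" by (simp add: add_nonneg_pos)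
      from Cauchy_D[OF this] obtain N where
        N: "\<forall>m\<ge>N. \<forall>n\<ge>N. \<forall>x\<in>S. \<forall>h'. norm (D m x h' - D n x h') \<le> e / (norm h + 1) * norm h'" by blast
      have "norm h + 1 > 0" by (simp add: add_nonneg_pos)
      then have "e / (norm h + 1) * norm h < e"
        using \<open>e > 0\<close> by (simp add: field_simps)
      then show "\<exists>N. \<forall>m\<ge>N. \<forall>n\<ge>N. dist (D m x h) (D n x h) < e"
        using N \<open>x \<in> S\<close> unfolding dist_norm by (meson le_less_trans)
    qed
    then show ?thesis by (simp add: Cauchy_convergent_iff)
  qed
  define D' where "D' x h = Lim sequentially (\<lambda>n. D n x h)" for x h
  have D': "(\<lambda>n. D n x h) \<longlonglongrightarrow> D' x h" if "x \<in> S" for x h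
    using conv[OF that, of h] unfolding D'_def by (simp add: convergent_LIMSEQ_iff)
  have unif: "\<forall>\<^sub>F n in sequentially. \<forall>x\<in>S. \<forall>h. norm (D n x h - D' x h) \<le> e * norm h" if "e > 0" for e
  proof -
    from Cauchy_D[OF that] obtain N where
      N: "\<forall>m\<ge>N. \<forall>n\<ge>N. \<forall>x\<in>S. \<forall>h. norm (D m x h - D n x h) \<le> e * norm h" by blast
    have "norm (D n x h - D' x h) \<le> e * norm h" if "n \<ge> N" "x \<in> S" for n x h
    proof (rule tendsto_upperbound)
      show "(\<lambda>m. norm (D n x h - D m x h)) \<longlonglongrightarrow> norm (D n x h - D' x h)"
        by (intro tendsto_intros D' that)
      show "\<forall>\<^sub>F m in sequentially. norm (D n x h - D m x h) \<le> e * norm h"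
        unfolding eventually_sequentially using N that by blast
    qed simp
    then show ?thesis by (auto simp: eventually_sequentially)
  qed
  have point: "(\<lambda>n. f n x) \<longlonglongrightarrow> F x" for x
    using tendsto_uniform_limitI[OF lim[of "norm x"], of x] by simp
  have "\<exists>g. \<forall>x\<in>S. (\<lambda>n. f n x) \<longlonglongrightarrow> g x \<and> (g has_derivative D' x) (at x within S)"
  proof (rule has_derivative_sequence[OF _ _ unif])
    show "convex S" by (simp add: S_def)
    show "\<And>n x. x \<in> S \<Longrightarrow> (f n has_derivative D n x) (at x within S)"
      using D(1) has_derivative_at_withinI by blast
    show "z \<in> S" by (simp add: S_def)
    show "(\<lambda>n. f n z) \<longlonglongrightarrow> F z" by (rule point)
  qed
  then obtain g where g: "\<And>x. x \<in> S \<Longrightarrow> (\<lambda>n. f n x) \<longlonglongrightarrow> g x"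
    "\<And>x. x \<in> S \<Longrightarrow> (g has_derivative D' x) (at x within S)" by blast
  have zS: "z \<in> S" "open S" by (auto simp: S_def)
  have gF: "g x = F x" if "x \<in> S" for x
    using g(1)[OF that] point LIMSEQ_unique by blast
  have "(F has_derivative D' z) (at z within S)"
    by (rule has_derivative_transform[OF zS(1) _ g(2)[OF zS(1)]]) (simp add: gF)
  then have "(F has_derivative D' z) (at z)"
    using at_within_open[OF zS] by simp
  moreover have "D' z (c *s v) = c * D' z v" for c v
  proof (rule LIMSEQ_unique)
    show "(\<lambda>n. D n z (c *s v)) \<longlonglongrightarrow> D' z (c *s v)" by (rule D'[OF zS(1)])
    show "(\<lambda>n. D n z (c *s v)) \<longlonglongrightarrow> c * D' z v"
      unfolding D(2) by (intro tendsto_intros D'[OF zS(1)])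
  qed
  ultimately show "\<exists>f'. (F has_derivative f') (at z) \<and> (\<forall>c v. f' (c *s v) = c * f' v)" by blast
qed


section \<open>Runge approximation on boxes\<close>

text \<open>Boundedness on \<open>K\<close> is part of the definition so that products of approximable functions are approximable.\<close>

definition approximable_on :: "(complex ^ 'd::finite) set \<Rightarrow> (complex ^ 'd \<Rightarrow> complex) set" where
  "approximable_on K = {f. (\<exists>B. \<forall>z\<in>K. norm (f z) \<le> B) \<and>
     (\<forall>e>0. \<exists>p\<in>entire_functions. \<forall>z\<in>K. norm (f z - p z) < e)}"

lemma approximable_bounded:
  assumes "f \<in> approximable_on K"
  shows "\<exists>B>0. \<forall>z\<in>K. norm (f z) \<le> B"
proof -
  obtain B where "\<forall>z\<in>K. norm (f z) \<le> B" using assms unfolding approximable_on_def by blast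
  then have "\<forall>z\<in>K. norm (f z) \<le> max B 1" by (simp add: max.coboundedI1)
  then show ?thesis by (intro exI[of _ "max B 1"]) auto
qed

lemma approximableD:
  "f \<in> approximable_on K \<Longrightarrow> e > 0 \<Longrightarrow> \<exists>p\<in>entire_functions. \<forall>z\<in>K. norm (f z - p z) < e"
  unfolding approximable_on_def by blast

lemma approximable_entire:
  "bounded K \<Longrightarrow> f \<in> entire_functions \<Longrightarrow> f \<in> approximable_on K"
  unfolding approximable_on_def by (auto intro!: entire_bounded_on bexI[of _ f])

lemma approximable_limit:
  assumes "\<And>e. e > 0 \<Longrightarrow> \<exists>g\<in>approximable_on K. \<forall>z\<in>K. norm (f z - g z) < e"
  shows "f \<in> approximable_on K"
  unfolding approximable_on_def
proof (intro CollectI conjI allI impI)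
  obtain g where g: "g \<in> approximable_on K" "\<forall>z\<in>K. norm (f z - g z) < 1" using assms[of 1] by auto
  then obtain B where "\<forall>z\<in>K. norm (g z) \<le> B" unfolding approximable_on_def by blast
  then have "\<forall>z\<in>K. norm (f z) \<le> B + 1"
    using g(2) norm_triangle_sub by (smt (verit, best))
  then show "\<exists>B. \<forall>z\<in>K. norm (f z) \<le> B" by blast
next
  fix e :: real assume "e > 0"
  then obtain g where g: "g \<in> approximable_on K" "\<forall>z\<in>K. norm (f z - g z) < e / 2"
    using assms[of "e/2"] by auto
  then obtain p where p: "p \<in> entire_functions" "\<forall>z\<in>K. norm (g z - p z) < e / 2"
    using \<open>e > 0\<close> approximableD[OF g(1), of "e / 2"] by auto
  have "\<forall>z\<in>K. norm (f z - p z) < e"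
    using norm_diff_triangle_less[of "f z" "g z" "e/2" "p z" "e/2" for z] g(2) p(2)
    by (metis field_sum_of_halves)
  then show "\<exists>p\<in>entire_functions. \<forall>z\<in>K. norm (f z - p z) < e" using p(1) by blast
qed

lemma approximable_cong:
  assumes "f \<in> approximable_on K" "\<And>z. z \<in> K \<Longrightarrow> g z = f z"
  shows "g \<in> approximable_on K"
  using assms by (intro approximable_limit) force

lemma approximable_add:
  assumes "f \<in> approximable_on K" "g \<in> approximable_on K"
  shows "(\<lambda>z. f z + g z) \<in> approximable_on K"
  unfolding approximable_on_def
proof (intro CollectI conjI allI impI)
  obtain B C where "\<forall>z\<in>K. norm (f z) \<le> B" "\<forall>z\<in>K. norm (g z) \<le> C"
    using assms unfolding approximable_on_def by blast
  then have "\<forall>z\<in>K. norm (f z + g z) \<le> B + C"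
    by (simp add: norm_triangle_mono)
  then show "\<exists>B. \<forall>z\<in>K. norm (f z + g z) \<le> B" by blast
next
  fix e :: real assume "e > 0"
  then obtain p q where "p \<in> entire_functions" "\<forall>z\<in>K. norm (f z - p z) < e / 2"
    "q \<in> entire_functions" "\<forall>z\<in>K. norm (g z - q z) < e / 2"
    using approximableD[OF assms(1), of "e/2"] approximableD[OF assms(2), of "e/2"] by auto
  moreover have "norm (f z + g z - (p z + q z)) < e"
    if "norm (f z - p z) < e / 2" "norm (g z - q z) < e / 2" for z
    using norm_add_less[OF that] by (simp add: add_diff_add)
  ultimately show "\<exists>p\<in>entire_functions. \<forall>z\<in>K. norm (f z + g z - p z) < e"
    by (intro bexI[of _ "\<lambda>z. p z + q z"] entire_add ballI) auto
qed

lemma approximable_mult: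
  assumes "f \<in> approximable_on K" "g \<in> approximable_on K"
  shows "(\<lambda>z. f z * g z) \<in> approximable_on K"
  unfolding approximable_on_def
proof (intro CollectI conjI allI impI)
  obtain B C where BC: "B > 0" "C > 0" "\<forall>z\<in>K. norm (f z) \<le> B" "\<forall>z\<in>K. norm (g z) \<le> C"
    using assms approximable_bounded by metis
  then have "\<forall>z\<in>K. norm (f z * g z) \<le> B * C"
    by (simp add: norm_mult mult_mono)
  then show "\<exists>B. \<forall>z\<in>K. norm (f z * g z) \<le> B" by blast
  fix e :: real assume "e > 0"
  define d where "d = min 1 (e / (B + C + 1))"
  have d: "d > 0" "d \<le> 1" using \<open>e > 0\<close> BC by (auto simp: d_def)
  have "d * (B + C + 1) \<le> e / (B + C + 1) * (B + C + 1)"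
    using BC by (intro mult_right_mono) (auto simp: d_def)
  then have d3: "d * (B + C + 1) \<le> e" using BC by simp
  then obtain p q where p: "p \<in> entire_functions" "\<forall>z\<in>K. norm (f z - p z) < d"
    and q: "q \<in> entire_functions" "\<forall>z\<in>K. norm (g z - q z) < d"
    using approximableD[OF assms(1) d(1)] approximableD[OF assms(2) d(1)] by auto
  have "norm (f z * g z - p z * q z) < e" if z: "z \<in> K" for z
  proof -
    have eq: "f z * g z - p z * q z = f z * (g z - q z) + g z * (f z - p z) - (f z - p z) * (g z - q z)"
      by (simp add: algebra_simps)
    have le: "norm (f z * g z - p z * q z) \<le> norm (f z) * norm (g z - q z) + norm (g z) * norm (f z - p z)
        + norm (f z - p z) * norm (g z - q z)"
      unfolding eq norm_mult[symmetric] by (rule order.trans[OF norm_triangle_ineq4 add_right_mono[OF norm_triangle_ineq]])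
    have "norm (f z) * norm (g z - q z) \<le> B * norm (g z - q z)" "B * norm (g z - q z) < B * d"
      using BC q z by (auto intro: mult_right_mono)
    moreover have "norm (g z) * norm (f z - p z) \<le> C * d"
      using BC p z d by (intro mult_mono) (auto simp: less_imp_le)
    moreover have "norm (f z - p z) * norm (g z - q z) \<le> 1 * d"
      using p q z d by (intro mult_mono) (auto simp: less_imp_le intro: order.trans)
    ultimately have "norm (f z * g z - p z * q z) < B * d + C * d + 1 * d" using le by linarith
    then show ?thesis using d3 by (simp add: algebra_simps)
  qed
  then show "\<exists>p\<in>entire_functions. \<forall>z\<in>K. norm (f z * g z - p z) < e"
    by (intro bexI[of _ "\<lambda>z. p z * q z"] entire_mult p q) auto
qed

lemma approximable_const: "(\<lambda>z. c) \<in> approximable_on K"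
  unfolding approximable_on_def by (auto intro!: bexI[of _ "\<lambda>_. c"] entire_const)

lemma approximable_diff:
  assumes "f \<in> approximable_on K" "g \<in> approximable_on K"
  shows "(\<lambda>z. f z - g z) \<in> approximable_on K"
  by (rule approximable_cong[OF approximable_add[OF assms(1) approximable_mult[OF approximable_const[of "-1"] assms(2)]]])
     simp

lemma approximable_sum:
  assumes "finite S" "\<And>s. s \<in> S \<Longrightarrow> f s \<in> approximable_on K"
  shows "(\<lambda>z. \<Sum>s\<in>S. f s z) \<in> approximable_on K"
  using assms by (induction S) (auto intro: approximable_const approximable_add)

lemma approximable_prod:
  assumes "finite S" "\<And>s. s \<in> S \<Longrightarrow> f s \<in> approximable_on K"
  shows "(\<lambda>z. \<Prod>s\<in>S. f s z) \<in> approximable_on K"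
  using assms by (induction S) (auto intro: approximable_const approximable_mult)

lemma approximable_power:
  assumes "f \<in> approximable_on K"
  shows "(\<lambda>z. f z ^ n) \<in> approximable_on K"
  using assms by (induction n) (auto intro: approximable_const approximable_mult)

text \<open>The geometric series in \<open>v\<close> converges uniformly on \<open>K\<close>.\<close>

lemma approximable_geometric:
  assumes v: "v \<in> approximable_on K" and half: "\<And>z. z \<in> K \<Longrightarrow> norm (v z) \<le> 1 / 2"
  shows "(\<lambda>z. 1 / (1 - v z)) \<in> approximable_on K"
proof (rule approximable_limit)
  fix e :: real assume "e > 0"
  then obtain n where n: "(1 / 2) ^ n < e / 2" using real_arch_pow_inv[of "e/2" "1/2"] by auto
  have "norm (1 / (1 - v z) - (\<Sum>k<n. v z ^ k)) < e" if z: "z \<in> K" for z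
  proof -
    have v1: "v z \<noteq> 1" using half[OF z] by auto
    have "1 - norm (v z) \<le> norm (1 - v z)" using norm_triangle_ineq2[of 1 "v z"] by simp
    then have ge: "norm (1 - v z) \<ge> 1 / 2" using half[OF z] by linarith
    have "1 / (1 - v z) - (\<Sum>k<n. v z ^ k) = v z ^ n / (1 - v z)"
      using v1 by (simp add: sum_gp_strict field_simps)
    also have "norm \<dots> \<le> (1/2) ^ n / (1/2)"
      unfolding norm_divide norm_power using half[OF z] ge by (intro frac_le power_mono) auto
    also have "\<dots> < e" using n by simp
    finally show ?thesis .
  qed
  then show "\<exists>g\<in>approximable_on K. \<forall>z\<in>K. norm (1 / (1 - v z) - g z) < e"
    by (intro bexI[of _ "\<lambda>z. \<Sum>k<n. v z ^ k"] approximable_sum approximable_power v) auto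
qed

text \<open>Pole pushing, as in Runge's theorem. Far up on the imaginary axis, \<open>1 / (u - w)\<close> is a
  geometric series in \<open>u\<close>. If the pole then moves down the axis by \<open>\<delta> / 2\<close>, the new function
  is a geometric series in the old one, because \<open>u\<close> keeps distance \<open>\<delta>\<close> from the axis.\<close>

lemma approximable_inverse:
  assumes u: "u \<in> approximable_on K" and "\<delta> > 0" and re: "\<And>z. z \<in> K \<Longrightarrow> \<bar>Re (u z)\<bar> \<ge> \<delta>"
  shows "(\<lambda>z. 1 / u z) \<in> approximable_on K"
proof -
  obtain B where B: "B > 0" "\<forall>z\<in>K. norm (u z) \<le> B" using approximable_bounded[OF u] by blast
  define w where "w k = \<i> * of_real (2 * B - real k * (\<delta> / 2))" for k
  have far: "norm (u z - w k) \<ge> \<delta>" if "z \<in> K" for z k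
    using re[OF that] abs_Re_le_cmod[of "u z - w k"] by (simp add: w_def)
  have "(\<lambda>z. 1 / (u z - w k)) \<in> approximable_on K" for k
  proof (induction k)
    case 0
    have "(\<lambda>z. (- 1 / w 0) * (1 / (1 - (1 / w 0) * u z))) \<in> approximable_on K"
      using B by (intro approximable_mult approximable_const approximable_geometric u)
         (auto simp: w_def norm_mult norm_divide field_simps)
    then show ?case
    proof (rule approximable_cong)
      fix z assume "z \<in> K"
      have "w 0 \<noteq> 0" using B by (simp add: w_def)
      moreover have "u z - w 0 \<noteq> 0" using far[OF \<open>z \<in> K\<close>, of 0] \<open>\<delta> > 0\<close> by auto
      ultimately show "1 / (u z - w 0) = (- 1 / w 0) * (1 / (1 - (1 / w 0) * u z))"
        by (simp add: divide_simps)
    qed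
  next
    case (Suc k)
    define h where "h = w (Suc k) - w k"
    have h: "norm h = \<delta> / 2"
    proof -
      have "h = \<i> * of_real (- (\<delta> / 2))" unfolding h_def w_def by (simp add: algebra_simps)
      then show ?thesis using \<open>\<delta> > 0\<close> by (simp add: norm_mult del: of_real_minus of_real_divide)
    qed
    have "(\<lambda>z. 1 / (u z - w k) * (1 / (1 - h * (1 / (u z - w k))))) \<in> approximable_on K"
    proof (intro approximable_mult approximable_const approximable_geometric Suc)
      fix z assume "z \<in> K"
      then have "\<delta> / 2 / norm (u z - w k) \<le> \<delta> / 2 / \<delta>"
        using far[of z k] \<open>\<delta> > 0\<close> by (intro divide_left_mono mult_pos_pos) auto
      then show "norm (h * (1 / (u z - w k))) \<le> 1 / 2"
        using \<open>\<delta> > 0\<close> h by (simp add: norm_mult norm_divide)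
    qed
    then show ?case
    proof (rule approximable_cong)
      fix z assume "z \<in> K"
      have "u z - w k \<noteq> 0" using far[OF \<open>z \<in> K\<close>, of k] \<open>\<delta> > 0\<close> by auto
      moreover have "u z - w (Suc k) \<noteq> 0" using far[OF \<open>z \<in> K\<close>, of "Suc k"] \<open>\<delta> > 0\<close> by auto
      ultimately show "1 / (u z - w (Suc k)) = 1 / (u z - w k) * (1 / (1 - h * (1 / (u z - w k))))"
        unfolding h_def by (simp add: divide_simps)
    qed
  qed
  then have step: "(\<lambda>z. 1 / (u z - w k)) \<in> approximable_on K" for k .
  \<comment> \<open>the last pole in the closed upper half of the axis; from there \<open>0\<close> is within one step\<close>
  define k where "k = nat \<lfloor>4 * B / \<delta>\<rfloor>"
  have "real k \<le> 4 * B / \<delta>" "4 * B / \<delta> < real k + 1"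
    using B(1) \<open>\<delta> > 0\<close> unfolding k_def by (simp_all add: of_nat_floor)
  then have wk: "norm (w k) \<le> \<delta> / 2"
    using \<open>\<delta> > 0\<close> unfolding w_def norm_mult norm_of_real by (simp add: field_simps abs_if)
  have "(\<lambda>z. 1 / (u z - w k) * (1 / (1 - (- w k) * (1 / (u z - w k))))) \<in> approximable_on K"
  proof (intro approximable_mult approximable_const approximable_geometric step)
    fix z assume "z \<in> K"
    then have "norm (w k) / norm (u z - w k) \<le> \<delta> / 2 / \<delta>"
      using far[of z k] \<open>\<delta> > 0\<close> wk by (intro frac_le) auto
    then show "norm (- w k * (1 / (u z - w k))) \<le> 1 / 2"
      using \<open>\<delta> > 0\<close> by (simp add: norm_mult norm_divide)
  qed
  then show ?thesis
  proof (rule approximable_cong)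
    fix z assume "z \<in> K"
    have "u z - w k \<noteq> 0" using far[OF \<open>z \<in> K\<close>, of k] \<open>\<delta> > 0\<close> by auto
    moreover have "u z \<noteq> 0" using re[OF \<open>z \<in> K\<close>] \<open>\<delta> > 0\<close> by auto
    ultimately show "1 / u z = 1 / (u z - w k) * (1 / (1 - (- w k) * (1 / (u z - w k))))"
      by (simp add: divide_simps)
  qed
qed

text \<open>
  Newton's iteration for \<open>u\<^sup>2 = 1\<close>. The Cayley transform \<open>(u - 1) / (u + 1)\<close> conjugates it to
  squaring, and maps the right half-plane to the unit disc; so the iteration converges to
  the sign of the real part. Each step uses only sums and inverses, which keep
  functions approximable.
\<close>

fun newton_sign :: "nat \<Rightarrow> complex \<Rightarrow> complex" where
  "newton_sign 0 w = w"
| "newton_sign (Suc n) w = (newton_sign n w + 1 / newton_sign n w) / 2"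

lemma newton_sign_uminus: "newton_sign n (- w) = - newton_sign n w"
  by (induction n) (auto simp: field_simps)

lemma newton_sign_Re:
  assumes "\<delta> > 0" "Re w \<ge> \<delta>"
  shows "Re (newton_sign n w) \<ge> \<delta> / 2 ^ n"
proof (induction n)
  case (Suc n)
  let ?v = "newton_sign n w"
  have "Re ?v > 0" using Suc assms(1) by (smt (verit) divide_pos_pos zero_less_power)
  then have "Re (1 / ?v) \<ge> 0" by (simp add: Re_divide)
  moreover have "Re (newton_sign (Suc n) w) = (Re ?v + Re (1 / ?v)) / 2"
    by (simp add: complex_eq_iff[of "_ / 2"] Re_divide_numeral)
  ultimately show ?case using Suc by simp
qed (use assms in simp)

lemma newton_sign_abs_Re:
  assumes "\<delta> > 0" "\<bar>Re w\<bar> \<ge> \<delta>"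
  shows "\<bar>Re (newton_sign n w)\<bar> \<ge> \<delta> / 2 ^ n"
  using newton_sign_Re[of \<delta> w n] newton_sign_Re[of \<delta> "- w" n] assms
  by (auto simp: newton_sign_uminus abs_if split: if_splits)

lemma newton_sign_cayley:
  assumes "Re w > 0"
  shows "(newton_sign n w - 1) / (newton_sign n w + 1) = ((w - 1) / (w + 1)) ^ (2 ^ n)"
proof (induction n)
  case (Suc n)
  let ?v = "newton_sign n w"
  have "Re ?v \<ge> Re w / 2 ^ n" using assms by (intro newton_sign_Re) auto
  then have "Re ?v > 0" using assms by (smt (verit) divide_pos_pos zero_less_power)
  then have nz: "?v \<noteq> 0" "?v + 1 \<noteq> 0" by (auto simp: complex_eq_iff)
  have "newton_sign (Suc n) w - 1 = (?v - 1)\<^sup>2 / (2 * ?v)"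
    "newton_sign (Suc n) w + 1 = (?v + 1)\<^sup>2 / (2 * ?v)"
    using nz by (simp_all add: divide_simps power2_eq_square) (simp_all add: algebra_simps)
  then have "(newton_sign (Suc n) w - 1) / (newton_sign (Suc n) w + 1) = ((?v - 1) / (?v + 1))\<^sup>2"
    using nz by (simp add: power_divide)
  then show ?case by (simp add: Suc power_mult[symmetric] mult.commute)
qed simp

lemma newton_sign_converges:
  assumes "\<delta> > 0" "B > 0" "e > 0"
  shows "\<exists>n. \<forall>w. Re w \<ge> \<delta> \<and> norm w \<le> B \<longrightarrow> norm (newton_sign n w - 1) < e"
proof -
  \<comment> \<open>\<open>\<theta>\<close> bounds the Cayley transform on the region, by
    \<open>norm (w - 1) ^ 2 = norm (w + 1) ^ 2 - 4 * Re w\<close>; the minimum with \<open>B\<close> keeps the radicand nonnegative\<close>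
  define \<theta> where "\<theta> = sqrt (1 - 4 * min \<delta> B / (B + 1)\<^sup>2)"
  have "4 * min \<delta> B \<le> (B + 1)\<^sup>2"
    using assms sum_squares_ge_zero[of "B - 1" 0] by (simp add: power2_eq_square algebra_simps min_def)
  then have q: "0 < 4 * min \<delta> B / (B + 1)\<^sup>2" "4 * min \<delta> B / (B + 1)\<^sup>2 \<le> 1"
    using assms by auto
  then have \<theta>: "0 \<le> \<theta>" "\<theta> < 1" unfolding \<theta>_def by auto
  have cay: "norm ((w - 1) / (w + 1)) \<le> \<theta>" if w: "Re w \<ge> \<delta>" "norm w \<le> B" for w
  proof -
    have nz: "norm (w + 1) > 0" using w assms by (auto simp: complex_eq_iff)
    have "norm (w + 1) \<le> B + 1" using w(2) norm_triangle_ineq[of w 1] by simp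
    then have le: "(norm (w + 1))\<^sup>2 \<le> (B + 1)\<^sup>2" by (simp add: power_mono)
    have "(norm (w - 1))\<^sup>2 = (norm (w + 1))\<^sup>2 - 4 * Re w"
      by (simp add: cmod_power2) (simp add: power2_eq_square algebra_simps)
    then have "(norm ((w - 1) / (w + 1)))\<^sup>2 = 1 - 4 * Re w / (norm (w + 1))\<^sup>2"
      using nz unfolding norm_divide power_divide by (simp add: diff_divide_distrib)
    also have "\<dots> \<le> 1 - 4 * min \<delta> B / (B + 1)\<^sup>2"
      using w le nz assms by (intro diff_left_mono frac_le) auto
    finally show ?thesis unfolding \<theta>_def by (intro real_le_rsqrt) simp
  qed
  define \<eta> where "\<eta> = min (1 / 2) (e / 5)"
  have \<eta>: "\<eta> > 0" "\<eta> \<le> 1/2" "4 * \<eta> < e" using assms by (auto simp: \<eta>_def min_def)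
  obtain n where n: "\<theta> ^ n < \<eta>" using real_arch_pow_inv[OF \<eta>(1) \<theta>(2)] by blast
  have "\<theta> ^ (2 ^ n) \<le> \<theta> ^ n" using \<theta> by (intro power_decreasing) (auto intro: less_imp_le)
  with n have n2: "\<theta> ^ (2 ^ n) < \<eta>" by simp
  have "norm (newton_sign n w - 1) < e" if w: "Re w \<ge> \<delta>" "norm w \<le> B" for w
  proof -
    define c where "c = ((w - 1) / (w + 1)) ^ (2 ^ n)"
    let ?v = "newton_sign n w"
    have "Re ?v \<ge> \<delta> / 2 ^ n" by (intro newton_sign_Re assms w)
    then have "Re ?v > 0" using assms by (smt (verit) divide_pos_pos zero_less_power)
    then have nz: "?v + 1 \<noteq> 0" by (auto simp: complex_eq_iff)
    have c: "norm c < \<eta>"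
      using power_mono[OF cay[OF w] norm_ge_zero, of "2 ^ n"] n2 by (simp add: c_def norm_power)
    have "(?v - 1) / (?v + 1) = c"
      unfolding c_def using w assms by (intro newton_sign_cayley) auto
    then have v: "(?v - 1) * (1 - c) = 2 * c" using nz by (simp add: field_simps)
    have "1 - norm c \<le> norm (1 - c)" using norm_triangle_ineq2[of 1 c] by simp
    then have "norm (?v - 1) * (1/2) \<le> norm (?v - 1) * norm (1 - c)"
      using c \<eta> by (intro mult_left_mono) auto
    also have "\<dots> = 2 * norm c" by (metis v norm_mult norm_numeral)
    finally show ?thesis using c \<eta> by simp
  qed
  then show ?thesis by blast
qed

text \<open>The indicator function of the half-plane is \<open>(1 + sign) / 2\<close>, and the sign is the uniform
  limit of Newton's iteration.\<close>

lemma approximable_half_plane: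
  assumes u: "u \<in> approximable_on K" and \<delta>: "\<delta> > 0" "\<And>z. z \<in> K \<Longrightarrow> \<bar>Re (u z)\<bar> \<ge> \<delta>"
  shows "(\<lambda>z. if Re (u z) > 0 then 1 else 0) \<in> approximable_on K"
proof (rule approximable_limit)
  fix e :: real assume e: "e > 0"
  obtain B where B: "B > 0" "\<forall>z\<in>K. norm (u z) \<le> B" using approximable_bounded[OF u] by blast
  obtain n where n: "\<And>w. Re w \<ge> \<delta> \<Longrightarrow> norm w \<le> B \<Longrightarrow> norm (newton_sign n w - 1) < e"
    using newton_sign_converges[OF \<delta>(1) B(1) e] by blast
  have app: "(\<lambda>z. newton_sign m (u z)) \<in> approximable_on K" for m
  proof (induction m)
    case (Suc m)
    have "(\<lambda>z. (1/2) * (newton_sign m (u z) + 1 / newton_sign m (u z))) \<in> approximable_on K"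
      using \<delta>(1) by (intro approximable_mult approximable_const approximable_add Suc
          approximable_inverse[OF Suc, of "\<delta> / 2 ^ m"] newton_sign_abs_Re \<delta>) auto
    then show ?case by simp
  qed (simp add: u)
  have "norm ((if Re (u z) > 0 then 1 else 0) - (1/2) * (newton_sign n (u z) + 1)) < e" if z: "z \<in> K" for z
  proof (cases "Re (u z) > 0")
    case True
    then have "norm (newton_sign n (u z) - 1) < e" using \<delta>(2)[OF z] B z by (intro n) auto
    moreover have "1 - (1/2) * (newton_sign n (u z) + 1) = - (1/2) * (newton_sign n (u z) - 1)"
      by (simp add: field_simps)
    ultimately show ?thesis using True e by (simp only: norm_mult) simp
  next
    case False
    then have "norm (newton_sign n (- u z) - 1) < e" using \<delta>(2)[OF z] B z by (intro n) auto
    moreover have "(if Re (u z) > 0 then 1 else 0) - (1/2) * (newton_sign n (u z) + 1)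
        = (1/2) * (newton_sign n (- u z) - 1)"
      using False by (simp add: field_simps newton_sign_uminus)
    ultimately show ?thesis using e by (simp only: norm_mult) simp
  qed
  then show "\<exists>g\<in>approximable_on K. \<forall>z\<in>K. norm ((if Re (u z) > 0 then 1 else 0) - g z) < e"
    by (intro bexI[of _ "\<lambda>z. (1/2) * (newton_sign n (u z) + 1)"] approximable_mult approximable_const
        approximable_add app) auto
qed

lemma approximable_interval:
  assumes u: "u \<in> approximable_on K" and K: "\<And>z. z \<in> K \<Longrightarrow> Re (u z) \<in> (\<Union>i\<in>J. {\<alpha> i..\<beta> i})"
    and J: "finite J" "j \<in> J" "\<And>i. i \<in> J \<Longrightarrow> i \<noteq> j \<Longrightarrow> {\<alpha> i..\<beta> i} \<inter> {\<alpha> j..\<beta> j} = {}"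
  shows "(\<lambda>z. if Re (u z) \<in> {\<alpha> j..\<beta> j} then 1 else 0) \<in> approximable_on K"
proof (cases "\<alpha> j \<le> \<beta> j")
  case True
  have "compact {\<alpha> j..\<beta> j}" "closed (\<Union>i\<in>J-{j}. {\<alpha> i..\<beta> i})" "{\<alpha> j..\<beta> j} \<inter> (\<Union>i\<in>J-{j}. {\<alpha> i..\<beta> i}) = {}"
    using J by (auto simp del: Int_atLeastAtMost)
  from separate_compact_closed[OF this] obtain d where d: "d > 0"
    "\<And>x y. x \<in> {\<alpha> j..\<beta> j} \<Longrightarrow> y \<in> (\<Union>i\<in>J-{j}. {\<alpha> i..\<beta> i}) \<Longrightarrow> d \<le> dist x y" by blast
  define \<delta> where "\<delta> = d / 2"
  have \<delta>: "\<delta> > 0" using d by (simp add: \<delta>_def)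
  have pos: "Re (u z) \<in> {\<alpha> j..\<beta> j} \<or> Re (u z) \<le> \<alpha> j - 2 * \<delta> \<or> Re (u z) \<ge> \<beta> j + 2 * \<delta>" if z: "z \<in> K" for z
  proof (cases "Re (u z) \<in> {\<alpha> j..\<beta> j}")
    case False
    then have "Re (u z) \<in> (\<Union>i\<in>J-{j}. {\<alpha> i..\<beta> i})" using K[OF z] by blast
    then have "d \<le> dist (\<alpha> j) (Re (u z))" "d \<le> dist (\<beta> j) (Re (u z))"
      using d(2) True by auto
    then show ?thesis using False True by (auto simp: \<delta>_def dist_real_def abs_if split: if_splits)
  qed auto
  define a b :: complex where "a = of_real (\<alpha> j - \<delta>)" and "b = of_real (\<beta> j + \<delta>)"
  have "(\<lambda>z. (if Re (u z - a) > 0 then 1 else 0) * (1 - (if Re (u z - b) > 0 then 1 else 0)))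
      \<in> approximable_on K"
  proof (intro approximable_mult approximable_diff approximable_const approximable_half_plane[OF _ \<delta>] u)
    fix z assume "z \<in> K"
    then show "\<delta> \<le> \<bar>Re (u z - a)\<bar>" "\<delta> \<le> \<bar>Re (u z - b)\<bar>"
      using pos[of z] True \<delta> unfolding a_def b_def by (auto simp: abs_if)
  qed
  then show ?thesis
  proof (rule approximable_cong)
    fix z assume "z \<in> K"
    then show "(if Re (u z) \<in> {\<alpha> j..\<beta> j} then 1 else 0) =
        (if Re (u z - a) > 0 then 1 else 0) * (1 - (if Re (u z - b) > 0 then 1 else (0::complex)))"
      using pos[of z] True \<delta> unfolding a_def b_def by auto
  qed
next
  case False
  then show ?thesis by (intro approximable_cong[OF approximable_const[of 0]]) auto
qed

text \<open>Real and imaginary parts share one index type, so that boxes, lattices and grids in \<open>\<complex>\<^sup>d\<close>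
  are described by one condition for every index.\<close>

definition real_coord :: "'d \<times> bool \<Rightarrow> complex ^ 'd \<Rightarrow> real" where
  "real_coord p v = (if snd p then Re (v $ fst p) else Im (v $ fst p))"

definition of_real_coords :: "('d \<times> bool \<Rightarrow> real) \<Rightarrow> complex ^ 'd::finite" where
  "of_real_coords x = (\<chi> i. Complex (x (i, True)) (x (i, False)))"

lemma real_coord_of_real_coords [simp]: "real_coord p (of_real_coords x) = x p"
  by (cases p) (auto simp: real_coord_def of_real_coords_def)

lemma real_coord_add [simp]: "real_coord p (v + w) = real_coord p v + real_coord p w"
  and real_coord_diff [simp]: "real_coord p (v - w) = real_coord p v - real_coord p w"
  by (auto simp: real_coord_def)

lemma vec_eq_real_coords: "v = w \<longleftrightarrow> (\<forall>p. real_coord p v = real_coord p w)"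
  by (auto simp: real_coord_def vec_eq_iff complex_eq_iff)

lemma abs_real_coord_le_norm: "\<bar>real_coord p v\<bar> \<le> norm (v :: complex ^ 'd::finite)"
  using abs_Re_le_cmod[of "v $ fst p"] abs_Im_le_cmod[of "v $ fst p"] Finite_Cartesian_Product.norm_nth_le[of v "fst p"]
  by (auto simp: real_coord_def)

lemma bounded_real_coords:
  assumes "\<And>v p. v \<in> K \<Longrightarrow> \<bar>real_coord p v\<bar> \<le> B"
  shows "bounded (K :: (complex ^ 'd::finite) set)"
  unfolding bounded_iff
proof (intro exI ballI)
  fix v assume "v \<in> K"
  then have "norm (v $ i) \<le> 2 * B" for i
    using assms[of v "(i, True)"] assms[of v "(i, False)"] cmod_le[of "v $ i"] by (auto simp: real_coord_def)
  then show "norm v \<le> (\<Sum>i\<in>(UNIV :: 'd set). 2 * B)"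
    unfolding norm_vec_def by (intro order.trans[OF L2_set_le_sum] sum_mono) auto
qed

text \<open>Runge approximation on finitely many boxes. Each box is a product of intervals from one
  disjoint family, so its indicator function is a product of indicator functions of
  intervals in one real coordinate. These are approximable, hence so is the function that equals
  \<open>T s\<close> on the box with index \<open>s\<close>.\<close>

lemma entire_approximation_on_boxes:
  fixes T :: "('d::finite \<times> bool \<Rightarrow> 'j) \<Rightarrow> complex ^ 'd \<Rightarrow> complex"
  assumes J: "finite J" "\<And>i j. i \<in> J \<Longrightarrow> j \<in> J \<Longrightarrow> i \<noteq> j \<Longrightarrow> {\<alpha> i..\<beta> i} \<inter> {\<alpha> j..\<beta> j} = {}"
    and T: "\<And>s. T s \<in> entire_functions" and e: "e > 0"
  shows "\<exists>P\<in>entire_functions. \<forall>s z. (\<forall>p. s p \<in> J \<and> real_coord p z \<in> {\<alpha> (s p)..\<beta> (s p)})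
      \<longrightarrow> norm (T s z - P z) < e"
proof -
  define I where "I = (\<Union>j\<in>J. {\<alpha> j..\<beta> j})"
  define K :: "(complex ^ 'd) set" where "K = {z. \<forall>p. real_coord p z \<in> I}"
  have "bounded I" unfolding I_def by (intro bounded_UN J(1) ballI) auto
  then obtain B where B: "\<And>x. x \<in> I \<Longrightarrow> \<bar>x\<bar> \<le> B" unfolding bounded_iff by auto
  have "bounded K" by (rule bounded_real_coords[of _ B]) (auto simp: K_def intro: B)
  note ent = approximable_entire[OF this]
  define ind :: "'j \<Rightarrow> real \<Rightarrow> complex" where "ind j x = (if x \<in> {\<alpha> j..\<beta> j} then 1 else 0)" for j x
  have ind: "(\<lambda>z. ind j (real_coord p z)) \<in> approximable_on K" if "j \<in> J" for j p
  proof -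
    \<comment> \<open>an entire function with real part \<open>real_coord p\<close>\<close>
    define u where "u z = (if snd p then 1 else - \<i>) * z $ fst p" for z :: "complex ^ 'd"
    have u: "Re (u z) = real_coord p z" for z by (simp add: u_def real_coord_def)
    have "u \<in> entire_functions" unfolding u_def by (intro entire_mult entire_const entire_coord)
    then have "(\<lambda>z. if Re (u z) \<in> {\<alpha> j..\<beta> j} then 1 else 0) \<in> approximable_on K"
      using that by (intro approximable_interval[where J = J] ent J)
        (auto simp: u K_def I_def simp del: split_paired_All)
    then show ?thesis unfolding ind_def u .
  qed
  define S where "S = PiE (UNIV :: ('d \<times> bool) set) (\<lambda>_. J)"
  have S: "finite S" unfolding S_def using J(1) by (intro finite_PiE) auto
  have "(\<lambda>z. \<Sum>s\<in>S. (\<Prod>p\<in>UNIV. ind (s p) (real_coord p z)) * T s z) \<in> approximable_on K"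
    by (intro approximable_sum S approximable_mult approximable_prod ind ent T) (auto simp: S_def)
  from approximableD[OF this e] obtain P where P: "P \<in> entire_functions"
    "\<And>z. z \<in> K \<Longrightarrow> norm ((\<Sum>s\<in>S. (\<Prod>p\<in>UNIV. ind (s p) (real_coord p z)) * T s z) - P z) < e" by blast
  show ?thesis
  proof (intro bexI[OF _ P(1)] allI impI)
    fix s :: "'d \<times> bool \<Rightarrow> 'j" and z
    assume s: "\<forall>p. s p \<in> J \<and> real_coord p z \<in> {\<alpha> (s p)..\<beta> (s p)}"
    have sS: "s \<in> S" using s by (auto simp: S_def)
    have "z \<in> K" using s unfolding K_def I_def by blast
    have one: "ind (s p) (real_coord p z) = 1" for p using s by (simp add: ind_def del: split_paired_All)
    have zero: "(\<Prod>p\<in>UNIV. ind (t p) (real_coord p z)) = 0" if "t \<in> S" "t \<noteq> s" for t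
    proof -
      obtain p where p: "t p \<noteq> s p" using \<open>t \<noteq> s\<close> by blast
      have "{\<alpha> (t p)..\<beta> (t p)} \<inter> {\<alpha> (s p)..\<beta> (s p)} = {}"
        using p s \<open>t \<in> S\<close> by (intro J) (auto simp: S_def simp del: split_paired_All)
      then have "real_coord p z \<notin> {\<alpha> (t p)..\<beta> (t p)}" using s by blast
      then have "ind (t p) (real_coord p z) = 0" unfolding ind_def by (rule if_not_P)
      then show ?thesis by (intro prod_zero bexI[of _ p]) simp_all
    qed
    have "(\<Sum>t\<in>S. (\<Prod>p\<in>UNIV. ind (t p) (real_coord p z)) * T t z) = (\<Sum>t\<in>S. if t = s then T s z else 0)"
      by (intro sum.cong refl) (auto simp: one zero)
    also have "\<dots> = T s z" using S sS by simp
    finally show "norm (T s z - P z) < e" using P(2)[OF \<open>z \<in> K\<close>] by simp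
  qed
qed


section \<open>A dense sequence of entire functions\<close>

text \<open>On a ball, a function whose oscillation is controlled at scale \<open>1 / Suc m\<close> is determined up to \<open>4 / Suc N\<close>
  by its rounded values on a finite net. There are countably many such data, and one entire
  function is chosen for each of those that occur.\<close>

lemma entire_dense_sequence:
  "\<exists>q :: nat \<Rightarrow> complex ^ 'd::finite \<Rightarrow> complex. (\<forall>n. q n \<in> entire_functions) \<and>
     (\<forall>f\<in>entire_functions. \<forall>B e. e > 0 \<longrightarrow> (\<exists>n. \<forall>w\<in>cball 0 B. norm (q n w - f w) < e))"
proof -
  have "\<exists>X. finite X \<and> cball (0 :: complex ^ 'd) (real N) \<subseteq> (\<Union>x\<in>X. ball x (1 / real (Suc m)))" for N m
    using compact_cball[of "0 :: complex ^ 'd" "real N"] unfolding compact_eq_totally_bounded by simp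
  then obtain X where X: "\<And>N m. finite (X N m)"
    "\<And>N m. cball (0 :: complex ^ 'd) (real N) \<subseteq> (\<Union>x\<in>X N m. ball x (1 / real (Suc m)))" by metis
  define digit where "digit N w = (\<lfloor>real (Suc N) * Re w\<rfloor>, \<lfloor>real (Suc N) * Im w\<rfloor>)" for N w
  define data where "data N m f = (\<lambda>x\<in>X N m. digit N (f x))" for N m and f :: "complex ^ 'd \<Rightarrow> complex"
  define steady where "steady N m f \<longleftrightarrow> f \<in> entire_functions \<and>
      (\<forall>x\<in>cball 0 (real N + 1). \<forall>y\<in>cball 0 (real N + 1). dist x y < 1 / real (Suc m) \<longrightarrow> norm (f x - f y) < 1 / real (Suc N))"
    for N m and f :: "complex ^ 'd \<Rightarrow> complex"
  define pick where "pick N m D = (SOME f. steady N m f \<and> data N m f = D)" for N m D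
  define Q where "Q = (\<Union>N. \<Union>m. pick N m ` {D \<in> PiE (X N m) (\<lambda>_. UNIV). \<exists>f. steady N m f \<and> data N m f = D})"
  have pick: "steady N m (pick N m (data N m f)) \<and> data N m (pick N m (data N m f)) = data N m f"
    if "steady N m f" for N m f
    unfolding pick_def by (rule someI[of _ f]) (use that in simp)
  have Q_entire: "Q \<subseteq> entire_functions"
  proof
    fix h assume "h \<in> Q"
    then obtain N m f where "steady N m f" "h = pick N m (data N m f)" unfolding Q_def by auto
    then show "h \<in> entire_functions" using pick[of N m f] unfolding steady_def by simp
  qed
  have "countable Q" unfolding Q_def
    by (intro countable_UN countableI_type countable_image countable_subset[OF _ countable_PiE[OF X(1)]]) auto
  have dense: "\<exists>q\<in>Q. \<forall>w\<in>cball 0 B. norm (q w - f w) < e" if f: "f \<in> entire_functions" and e: "e > 0" for f B e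
  proof -
    obtain N1 where N1: "B \<le> real N1" using real_arch_simple by blast
    obtain N2 where N2: "4 / e < real N2" using reals_Archimedean2 by blast
    define N where "N = max N1 N2"
    have N: "B \<le> real N" "4 / real (Suc N) < e"
    proof -
      show "B \<le> real N" using N1 by (simp add: N_def)
      have "4 / e < real (Suc N)" using N2 by (simp add: N_def)
      then show "4 / real (Suc N) < e" using e by (simp add: field_simps)
    qed
    have "uniformly_continuous_on (cball 0 (real N + 1)) f"
      by (intro compact_uniformly_continuous entire_continuous_on f compact_cball)
    then obtain d where d: "d > 0" "\<And>x y. x \<in> cball 0 (real N + 1) \<Longrightarrow> y \<in> cball 0 (real N + 1) \<Longrightarrow>
        dist x y < d \<Longrightarrow> norm (f x - f y) < 1 / real (Suc N)"
      unfolding uniformly_continuous_on_def dist_norm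
      by (metis norm_minus_commute of_nat_0_less_iff zero_less_Suc zero_less_divide_1_iff)
    obtain m where m: "1 / real (Suc m) < d" using nat_approx_posE[OF d(1)] by (metis of_nat_Suc)
    have "steady N m f" unfolding steady_def using f d(2) m by fastforce
    from pick[OF this] obtain q where q: "q = pick N m (data N m f)" "steady N m q" "data N m q = data N m f" by blast
    have "data N m f \<in> {D \<in> PiE (X N m) (\<lambda>_. UNIV). \<exists>f. steady N m f \<and> data N m f = D}"
      using \<open>steady N m f\<close> by (auto simp: data_def)
    then have "q \<in> Q" unfolding Q_def q(1) by blast
    moreover have "norm (q w - f w) < e" if w: "w \<in> cball 0 B" for w
    proof -
      have wN: "w \<in> cball 0 (real N)" using w N by auto
      then obtain x where x: "x \<in> X N m" "dist x w < 1 / real (Suc m)" using X(2)[of N m] by auto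
      have "norm x \<le> real N + 1"
      proof -
        have "1 / real (Suc m) \<le> 1" by simp
        then have "dist x w \<le> 1" using x(2) by linarith
        then show ?thesis using wN norm_triangle_ineq2[of x w] by (simp add: dist_norm)
      qed
      then have xw: "x \<in> cball 0 (real N + 1)" "w \<in> cball 0 (real N + 1)" using wN by auto
      have "digit N (q x) = digit N (f x)"
        using fun_cong[OF q(3), of x] x(1) by (simp add: data_def)
      then have "\<bar>real (Suc N) * Re (q x) - real (Suc N) * Re (f x)\<bar> < 1"
        "\<bar>real (Suc N) * Im (q x) - real (Suc N) * Im (f x)\<bar> < 1"
        unfolding digit_def prod.inject by linarith+
      then have "real (Suc N) * \<bar>Re (q x - f x)\<bar> < 1" "real (Suc N) * \<bar>Im (q x - f x)\<bar> < 1"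
        unfolding minus_complex.simps by (simp_all add: abs_mult right_diff_distrib[symmetric])
      then have "real (Suc N) * norm (q x - f x) < 2"
        using cmod_le[of "q x - f x"] mult_left_mono[of "norm (q x - f x)" "\<bar>Re (q x - f x)\<bar> + \<bar>Im (q x - f x)\<bar>" "real (Suc N)"]
        by (simp add: distrib_left)
      then have a: "norm (q x - f x) < 2 / real (Suc N)" by (simp add: field_simps)
      have b: "norm (q w - q x) < 1 / real (Suc N)" "norm (f x - f w) < 1 / real (Suc N)"
        using q(2) \<open>steady N m f\<close> xw x(2) unfolding steady_def by (metis dist_commute)+
      have "q w - f w = (q w - q x) + (q x - f x) + (f x - f w)" by simp
      then have "norm (q w - f w) \<le> norm (q w - q x) + norm (q x - f x) + norm (f x - f w)"
        using norm_triangle_ineq[of "(q w - q x) + (q x - f x)" "f x - f w"]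
          norm_triangle_ineq[of "q w - q x" "q x - f x"] by simp
      also have "\<dots> < 1 / real (Suc N) + 2 / real (Suc N) + 1 / real (Suc N)" using a b by linarith
      also have "\<dots> = 4 / real (Suc N)" by (simp add: add_divide_distrib[symmetric])
      finally show ?thesis using N by simp
    qed
    ultimately show ?thesis by (intro bexI[of _ q]) auto
  qed
  have "Q \<noteq> {}" using dense[OF entire_const, of 1] by auto
  then obtain q :: "nat \<Rightarrow> complex ^ 'd \<Rightarrow> complex" where "range q = Q"
    using uncountable_def \<open>countable Q\<close> by blast
  then have "(\<forall>n. q n \<in> entire_functions) \<and>
     (\<forall>f\<in>entire_functions. \<forall>B e. e > 0 \<longrightarrow> (\<exists>n. \<forall>w\<in>cball 0 B. norm (q n w - f w) < e))"
    using Q_entire dense[unfolded \<open>range q = Q\<close>[symmetric]] by auto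
  then show ?thesis by (rule exI[of _ q])
qed


section \<open>Borel sets of entire functions\<close>

text \<open>The translation \<open>z\<close> that works for \<open>f\<close> works for all functions near \<open>f\<close> on the translated
  ball, because the maximum of the error over the compact ball leaves room below \<open>e\<close>.\<close>

lemma entire_orbit_ball_open:
  fixes q :: "complex ^ 'd::finite \<Rightarrow> complex"
  assumes q: "q \<in> entire_functions"
  shows "openin entire_topology {f \<in> entire_functions. \<exists>z. \<forall>w\<in>cball 0 B. norm (f (w + z) - q w) < e}"
    (is "openin _ ?W")
  unfolding openin_entire_topology
proof (intro conjI ballI)
  fix f assume "f \<in> ?W"
  then obtain z where f: "f \<in> entire_functions" and z: "\<And>w. w \<in> cball 0 B \<Longrightarrow> norm (f (w + z) - q w) < e" by blast
  have "\<exists>d>0. \<forall>w\<in>cball 0 B. norm (f (w + z) - q w) \<le> e - d"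
  proof (cases "cball (0 :: complex ^ 'd) B = {}")
    case False
    have "continuous_on (cball 0 B) (\<lambda>w. norm (f (w + z) - q w))"
      by (intro continuous_intros entire_continuous_on entire_translate f q)
    from continuous_attains_sup[OF compact_cball False this] obtain x where
      x: "x \<in> cball 0 B" "\<forall>y\<in>cball 0 B. norm (f (y + z) - q y) \<le> norm (f (x + z) - q x)" by blast
    then show ?thesis using z[OF x(1)] by (intro exI[of _ "e - norm (f (x + z) - q x)"]) auto
  next
    case True
    show ?thesis unfolding True by (rule exI[of _ 1]) simp
  qed
  then obtain d where d: "d > 0" "\<And>w. w \<in> cball 0 B \<Longrightarrow> norm (f (w + z) - q w) \<le> e - d" by blast
  have "{g \<in> entire_functions. \<forall>w\<in>(\<lambda>w. w + z) ` cball 0 B. dist (g w) (f w) < d} \<subseteq> ?W"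
  proof safe
    fix g :: "complex ^ 'd \<Rightarrow> complex"
    assume g: "\<forall>w\<in>(\<lambda>w. w + z) ` cball 0 B. dist (g w) (f w) < d"
    have "norm (g (w + z) - q w) < e" if w: "w \<in> cball 0 B" for w
    proof -
      have "norm (g (w + z) - f (w + z)) < d" using g w by (simp add: dist_norm)
      then show ?thesis
        using d(2)[OF w] norm_triangle_ineq[of "g (w + z) - f (w + z)" "f (w + z) - q w"] by simp
    qed
    then show "\<exists>z. \<forall>w\<in>cball 0 B. norm (g (w + z) - q w) < e" by blast
  qed
  moreover have "compact ((\<lambda>w. w + z) ` cball 0 B)"
    by (intro compact_continuous_image continuous_intros compact_cball)
  ultimately show "\<exists>K e. compact K \<and> 0 < e \<and> {g \<in> entire_functions. \<forall>w\<in>K. dist (g w) (f w) < e} \<subseteq> ?W"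
    using d(1) by blast
qed blast

lemma space_borel_of: "space (borel_of X) = topspace X"
  unfolding borel_of_def by (rule space_measure_of_conv)

lemma sets_borel_of: "sets (borel_of X) = sigma_sets (topspace X) {U. openin X U}"
  unfolding borel_of_def by (rule sets_measure_of) (auto dest: openin_subset)

lemma openin_borel_of: "openin X U \<Longrightarrow> U \<in> sets (borel_of X)"
  unfolding sets_borel_of by auto

lemma measurable_borel_of:
  assumes "f \<in> space M \<rightarrow> topspace X" "\<And>U. openin X U \<Longrightarrow> f -` U \<inter> space M \<in> sets M"
  shows "f \<in> measurable M (borel_of X)"
  unfolding borel_of_def using assms
  by (intro measurable_measure_of) (auto dest: openin_subset)

lemma measurable_eval_entire:
  "(\<lambda>f. f w) \<in> borel_measurable (borel_of (entire_topology :: (complex ^ 'd::finite \<Rightarrow> complex) topology))"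
proof (rule borel_measurableI)
  fix V :: "complex set" assume V: "open V"
  have "openin entire_topology {f \<in> (entire_functions :: (complex ^ 'd \<Rightarrow> complex) set). f w \<in> V}"
    unfolding openin_entire_topology
  proof (intro conjI ballI)
    fix f assume "f \<in> {f \<in> (entire_functions :: (complex ^ 'd \<Rightarrow> complex) set). f w \<in> V}"
    then obtain e where "e > 0" "ball (f w) e \<subseteq> V" using V openE by blast
    then show "\<exists>K e. compact K \<and> 0 < e \<and> {g \<in> entire_functions. \<forall>w\<in>K. dist (g w) (f w) < e}
        \<subseteq> {f \<in> (entire_functions :: (complex ^ 'd \<Rightarrow> complex) set). f w \<in> V}"
      by (intro exI[of _ "{w}"] exI[of _ e]) (auto simp: dist_commute subset_iff)
  qed auto
  then have "{f \<in> (entire_functions :: (complex ^ 'd \<Rightarrow> complex) set). f w \<in> V} \<in> sets (borel_of entire_topology)"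
    by (rule openin_borel_of)
  moreover have "(\<lambda>f. f w) -` V \<inter> space (borel_of (entire_topology :: (complex ^ 'd \<Rightarrow> complex) topology)) = {f \<in> entire_functions. f w \<in> V}"
    by (auto simp: space_borel_of topspace_entire_topology)
  ultimately show "(\<lambda>f. f w) -` V \<inter> space (borel_of (entire_topology :: (complex ^ 'd \<Rightarrow> complex) topology)) \<in> sets (borel_of entire_topology)"
    by simp
qed

text \<open>Every open set is a union of sets from a countable family, namely of closed balls around the members of a dense
  sequence, for the supremum over a ball of \<open>\<complex>\<^sup>d\<close>. Membership in such a set is decided by
  countably many evaluations.\<close>

lemma measurable_into_entire:
  fixes \<Phi> :: "'a \<Rightarrow> complex ^ 'd::finite \<Rightarrow> complex"
  assumes ent: "\<And>x. x \<in> space M \<Longrightarrow> \<Phi> x \<in> entire_functions"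
    and meas: "\<And>w. (\<lambda>x. \<Phi> x w) \<in> borel_measurable M"
  shows "\<Phi> \<in> measurable M (borel_of entire_topology)"
proof (rule measurable_borel_of)
  show "\<Phi> \<in> space M \<rightarrow> topspace entire_topology" using ent by (simp add: topspace_entire_topology)
  fix U :: "(complex ^ 'd \<Rightarrow> complex) set" assume U: "openin entire_topology U"
  obtain q :: "nat \<Rightarrow> complex ^ 'd \<Rightarrow> complex" where q: "\<And>n. q n \<in> entire_functions"
    "\<And>f B e. f \<in> entire_functions \<Longrightarrow> e > 0 \<Longrightarrow> \<exists>n. \<forall>w\<in>cball 0 B. norm (q n w - f w) < e"
    using entire_dense_sequence by blast
  define b where "b n N m = {f \<in> entire_functions. \<forall>w\<in>cball 0 (real N). norm (f w - q n w) \<le> 1 / real (Suc m)}" for n N m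
  have meas_b: "\<Phi> -` b n N m \<inter> space M \<in> sets M" for n N m
  proof -
    obtain D :: "(complex ^ 'd) set" where D: "countable D" "D \<subseteq> cball 0 (real N)" "cball 0 (real N) \<subseteq> closure D"
      using separable by blast
    then have "D \<noteq> {}" by force
    then obtain d :: "nat \<Rightarrow> complex ^ 'd" where d: "range d = D" using D(1) uncountable_def by blast
    have "(\<forall>w\<in>cball 0 (real N). norm (\<Phi> x w - q n w) \<le> 1 / real (Suc m)) \<longleftrightarrow>
        (\<forall>w\<in>D. norm (\<Phi> x w - q n w) \<le> 1 / real (Suc m))" if x: "x \<in> space M" for x
    proof
      assume r: "\<forall>w\<in>D. norm (\<Phi> x w - q n w) \<le> 1 / real (Suc m)"
      show "\<forall>w\<in>cball 0 (real N). norm (\<Phi> x w - q n w) \<le> 1 / real (Suc m)"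
      proof
        fix w :: "complex ^ 'd" assume "w \<in> cball 0 (real N)"
        then have "w \<in> closure D" using D by blast
        then show "norm (\<Phi> x w - q n w) \<le> 1 / real (Suc m)"
          by (rule continuous_on_closure_norm_le[rotated 2])
             (use r continuous_on_diff[OF entire_continuous_on[OF ent[OF x]] entire_continuous_on[OF q(1)]] in auto)
      qed
    qed (use D in blast)
    then have "\<Phi> -` b n N m \<inter> space M = {x \<in> space M. \<forall>w\<in>D. norm (\<Phi> x w - q n w) \<le> 1 / real (Suc m)}"
      using ent by (auto simp: b_def)
    also have "\<dots> = {x \<in> space M. \<forall>i::nat. norm (\<Phi> x (d i) - q n (d i)) \<le> 1 / real (Suc m)}"
      using d by blast
    also have "\<dots> \<in> sets M"
      using meas[measurable] by measurable
    finally show ?thesis .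
  qed
  have "U = (\<Union>p\<in>{p. b (fst p) (fst (snd p)) (snd (snd p)) \<subseteq> U}. b (fst p) (fst (snd p)) (snd (snd p)))"
  proof (intro equalityI subsetI)
    fix f assume f: "f \<in> U"
    then obtain K e where K: "compact K" "e > 0" "{g \<in> entire_functions. \<forall>w\<in>K. dist (g w) (f w) < e} \<subseteq> U"
      and fe: "f \<in> entire_functions" using U unfolding openin_entire_topology by blast
    obtain B where B: "\<forall>w\<in>K. norm w \<le> B" using compact_imp_bounded[OF K(1)] bounded_iff by metis
    obtain N where N: "B \<le> real N" using real_arch_simple by blast
    obtain m where m: "1 / real (Suc m) < e / 2" using nat_approx_posE[of "e/2"] K(2) by (metis half_gt_zero of_nat_Suc)
    obtain n where n: "\<forall>w\<in>cball 0 (real N). norm (q n w - f w) < 1 / real (Suc m)"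
      using q(2)[OF fe, of "1 / real (Suc m)" "real N"] by auto
    have "f \<in> b n N m" using fe n by (auto simp: b_def norm_minus_commute less_imp_le)
    moreover have "b n N m \<subseteq> U"
    proof (rule order.trans[OF subsetI K(3)])
      fix g assume g: "g \<in> b n N m"
      have "dist (g w) (f w) < e" if "w \<in> K" for w
      proof -
        have w: "w \<in> cball 0 (real N)" using B N that by force
        have "norm (g w - q n w) \<le> 1 / real (Suc m)" "norm (q n w - f w) < 1 / real (Suc m)"
          using g n w by (auto simp: b_def)
        then show ?thesis using m norm_triangle_ineq[of "g w - q n w" "q n w - f w"] by (simp add: dist_norm)
      qed
      then show "g \<in> {g \<in> entire_functions. \<forall>w\<in>K. dist (g w) (f w) < e}" using g by (simp add: b_def)
    qed
    ultimately show "f \<in> (\<Union>p\<in>{p. b (fst p) (fst (snd p)) (snd (snd p)) \<subseteq> U}. b (fst p) (fst (snd p)) (snd (snd p)))"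
      by (intro UN_I[of "(n, N, m)"]) auto
  qed blast
  then have "\<Phi> -` U \<inter> space M = (\<Union>p\<in>{p. b (fst p) (fst (snd p)) (snd (snd p)) \<subseteq> U}. \<Phi> -` b (fst p) (fst (snd p)) (snd (snd p)) \<inter> space M)"
    by blast
  also have "\<dots> \<in> sets M" by (intro sets.countable_UN' countableI_type image_subsetI meas_b)
  finally show "\<Phi> -` U \<inter> space M \<in> sets M" .
qed

lemma measurable_translate:
  "translate z \<in> measurable (borel_of entire_topology)
     (borel_of (entire_topology :: (complex ^ 'd::finite \<Rightarrow> complex) topology))"
proof (rule measurable_into_entire)
  show "translate z f \<in> entire_functions"
    if "f \<in> space (borel_of entire_topology)" for f :: "complex ^ 'd \<Rightarrow> complex"
    using that unfolding translate_def space_borel_of topspace_entire_topology by (rule entire_translate)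
qed (simp add: translate_def measurable_eval_entire)

text \<open>Visiting the neighbourhoods of all members of a dense sequence is a countable intersection of open
  conditions. That \<open>W\<close> is a Borel set allows statements about almost every point to be
  carried over to the image measure.\<close>

lemma universal_functions_Borel_core:
  fixes q :: "nat \<Rightarrow> complex ^ 'd::finite \<Rightarrow> complex"
  assumes q: "\<And>n. q n \<in> entire_functions"
    and dense: "\<And>f B e. f \<in> entire_functions \<Longrightarrow> e > 0 \<Longrightarrow> \<exists>n. \<forall>w\<in>cball 0 B. norm (q n w - f w) < e"
  defines "W \<equiv> {f \<in> entire_functions. \<forall>n N m. \<exists>z. \<forall>w\<in>cball 0 (real N). norm (f (w + z) - q n w) < 1 / real (Suc m)}"
  shows "W \<in> sets (borel_of entire_topology)" "W \<subseteq> universal_functions"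
proof -
  let ?V = "\<lambda>n N m. {f \<in> entire_functions. \<exists>z. \<forall>w\<in>cball 0 (real N). norm (f (w + z) - q n w) < 1 / real (Suc m)}"
  have "W = (\<Inter>n. \<Inter>N. \<Inter>m. ?V n N m)" unfolding W_def by blast
  also have "\<dots> \<in> sets (borel_of entire_topology)"
    by (intro sets.countable_INT' countableI_type UNIV_not_empty image_subsetI openin_borel_of
        entire_orbit_ball_open q)
  finally show "W \<in> sets (borel_of entire_topology)" .
  show "W \<subseteq> universal_functions"
  proof
    fix f assume f: "f \<in> W"
    then have fe: "f \<in> entire_functions" by (simp add: W_def)
    have "h \<in> entire_topology closure_of range (\<lambda>z. translate z f)" if h: "h \<in> entire_functions" for h
      unfolding in_closure_of topspace_entire_topology
    proof (intro conjI h allI impI)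
      fix T assume "h \<in> T \<and> openin entire_topology T"
      then obtain K e where K: "compact K" "e > 0" "{g \<in> entire_functions. \<forall>w\<in>K. dist (g w) (h w) < e} \<subseteq> T"
        unfolding openin_entire_topology by blast
      obtain B where B: "\<forall>w\<in>K. norm w \<le> B" using compact_imp_bounded[OF K(1)] bounded_iff by metis
      obtain N where N: "B \<le> real N" using real_arch_simple by blast
      obtain m where m: "1 / real (Suc m) < e / 2" using nat_approx_posE[of "e/2"] K(2) by (metis half_gt_zero of_nat_Suc)
      obtain n where n: "\<forall>w\<in>cball 0 (real N). norm (q n w - h w) < 1 / real (Suc m)"
        using dense[OF h, of "1 / real (Suc m)" "real N"] by auto
      obtain z where z: "\<forall>w\<in>cball 0 (real N). norm (f (w + z) - q n w) < 1 / real (Suc m)"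
        using f unfolding W_def by blast
      have "dist (translate z f w) (h w) < e" if "w \<in> K" for w
      proof -
        have w: "w \<in> cball 0 (real N)" using B N that by force
        then have "norm (f (w + z) - q n w) < 1 / real (Suc m)" "norm (q n w - h w) < 1 / real (Suc m)"
          using n z by auto
        then show ?thesis using m norm_triangle_ineq[of "f (w + z) - q n w" "q n w - h w"]
          by (simp add: dist_norm translate_def)
      qed
      moreover have "translate z f \<in> entire_functions"
        unfolding translate_def by (rule entire_translate[OF fe])
      ultimately show "\<exists>y. y \<in> range (\<lambda>z. translate z f) \<and> y \<in> T" using K(3) by blast
    qed
    then have "entire_topology closure_of range (\<lambda>z. translate z f) = topspace entire_topology"
      using closure_of_subset_topspace[of entire_topology "range (\<lambda>z. translate z f)"]
      unfolding topspace_entire_topology by blast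
    then show "f \<in> universal_functions" unfolding universal_functions_def using fe by blast
  qed
qed


text \<open>Coordinates are indexed by pairs that have to stay intact under simplification.\<close>

declare split_paired_All [simp del] split_paired_Ex [simp del]

section \<open>Reduction modulo a square lattice\<close>

definition reduce :: "real \<Rightarrow> real \<Rightarrow> real" where
  "reduce R x = x - R * of_int \<lfloor>x / R\<rfloor>"

definition reduce_vec :: "real \<Rightarrow> complex ^ 'd \<Rightarrow> complex ^ 'd::finite" where
  "reduce_vec R v = of_real_coords (\<lambda>p. reduce R (real_coord p v))"

lemma real_coord_reduce_vec [simp]: "real_coord p (reduce_vec R v) = reduce R (real_coord p v)"
  by (simp add: reduce_vec_def)

lemma reduce_range: "R > 0 \<Longrightarrow> reduce R x \<in> {0..<R}"
  using floor_divide_lower[of R x] floor_divide_upper[of R x] by (auto simp: reduce_def algebra_simps)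

lemma reduce_unique:
  assumes "R > 0" "x \<in> {0..<R}"
  shows "reduce R (x + R * of_int k) = x"
proof -
  have "\<lfloor>(x + R * of_int k) / R\<rfloor> = k"
    using assms by (intro floor_unique) (auto simp: field_simps)
  then show ?thesis by (simp add: reduce_def)
qed

lemma reduce_id: "R > 0 \<Longrightarrow> x \<in> {0..<R} \<Longrightarrow> reduce R x = x"
  using reduce_unique[of R x 0] by simp

text \<open>Reduction modulo \<open>R\<close> acts on the index of a grid cell of side \<open>1 / c\<close> as reduction modulo
  the number of cells in a period.\<close>

lemma floor_mult_reduce:
  assumes "c > 0" "N > 0" "c * R = of_int N"
  shows "\<lfloor>c * reduce R x\<rfloor> = \<lfloor>c * x\<rfloor> mod N"
proof -
  have R: "R = of_int N / c" using assms by (simp add: field_simps)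
  have "\<lfloor>x / R\<rfloor> = \<lfloor>c * x / of_int N\<rfloor>" using assms by (simp add: R mult.commute)
  also have "\<dots> = \<lfloor>c * x\<rfloor> div N" using assms by (intro floor_divide_real_eq_div) simp
  finally have "c * reduce R x = c * x - of_int (N * (\<lfloor>c * x\<rfloor> div N))"
    using assms by (simp add: reduce_def right_diff_distrib mult.assoc[symmetric])
  then have "\<lfloor>c * reduce R x\<rfloor> = \<lfloor>c * x\<rfloor> - N * (\<lfloor>c * x\<rfloor> div N)" by (simp only: floor_diff_of_int)
  then show ?thesis by (simp add: minus_mult_div_eq_mod)
qed

definition inner_box :: "real \<Rightarrow> real \<Rightarrow> (complex ^ 'd) set" where
  "inner_box l m = {z. \<forall>p. real_coord p z \<in> {l..m - l}}"

text \<open>One step of the recursive construction, with \<open>l\<close>, \<open>m\<close> and \<open>b * m\<close> in the roles of three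
  consecutive side lengths. The intervals \<open>[k * m + l, k * m + m - l]\<close> leave gaps of length
  \<open>2 * l\<close> around the multiples of \<open>m\<close>, and the gap around \<open>2 * m\<close> has room for the interval
  of radius \<open>l / 2\<close> on which a copy of \<open>q\<close> is placed.\<close>

lemma next_level_function:
  fixes P q :: "complex ^ 'd::finite \<Rightarrow> complex"
  assumes l: "l > 0" and m: "m > 0" and P: "P \<in> entire_functions" and q: "q \<in> entire_functions" and e: "e > 0"
  shows "\<exists>P'\<in>entire_functions.
    (\<forall>z k. z \<in> inner_box l m \<and> z + of_real_coords (\<lambda>p. m * of_int (k p)) \<in> inner_box m (of_int b * m) \<longrightarrow>
       norm (P' (z + of_real_coords (\<lambda>p. m * of_int (k p))) - P z) < e) \<and>
    (\<forall>w. (\<forall>p. \<bar>real_coord p w\<bar> \<le> l / 2) \<longrightarrow> norm (P' (of_real_coords (\<lambda>_. 2 * m) + w) - q w) < e)"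
proof -
  \<comment> \<open>\<open>Some k\<close> stands for the tile with number \<open>k\<close>, \<open>None\<close> for the interval reserved for \<open>q\<close>\<close>
  define J where "J = insert None (Some ` {0..<b})"
  define \<alpha> where "\<alpha> j = (case j of None \<Rightarrow> 2 * m - l / 2 | Some k \<Rightarrow> of_int k * m + l)" for j
  define \<beta> where "\<beta> j = (case j of None \<Rightarrow> 2 * m + l / 2 | Some k \<Rightarrow> of_int k * m + m - l)" for j
  have finJ: "finite J" by (simp add: J_def)
  have some_none: "{\<alpha> (Some k)..\<beta> (Some k)} \<inter> {\<alpha> None..\<beta> None} = {}" for k :: int
  proof (cases "k \<le> 1")
    case True
    then have "of_int k * m \<le> 1 * m" using m by (intro mult_right_mono) auto
    then show ?thesis using l by (auto simp: \<alpha>_def \<beta>_def)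
  next
    case False
    then have "of_int k * m \<ge> 2 * m" using m by (intro mult_right_mono) auto
    then show ?thesis using l by (auto simp: \<alpha>_def \<beta>_def)
  qed
  have some_some: "{\<alpha> (Some k)..\<beta> (Some k)} \<inter> {\<alpha> (Some k')..\<beta> (Some k')} = {}" if "k < k'" for k k' :: int
  proof -
    have "of_int (k + 1) * m \<le> of_int k' * m" using m that by (intro mult_right_mono) (auto simp del: of_int_add)
    then show ?thesis using l by (auto simp: \<alpha>_def \<beta>_def algebra_simps)
  qed
  have disj: "{\<alpha> i..\<beta> i} \<inter> {\<alpha> j..\<beta> j} = {}" if "i \<noteq> j" for i j
  proof (cases i; cases j)
    fix k k' assume ij: "i = Some k" "j = Some k'"
    with that have "k < k' \<or> k' < k" by auto
    then show ?thesis using some_some[of k k'] some_some[of k' k] ij by (auto simp only: Int_commute)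
  qed (use that some_none in \<open>auto simp only: Int_commute\<close>)
  define T where "T s = (if s = (\<lambda>_. None) then (\<lambda>z. q (z + - of_real_coords (\<lambda>_. 2 * m)))
      else (\<lambda>z. P (z + - of_real_coords (\<lambda>p. m * of_int (the (s p))))))" for s :: "'d \<times> bool \<Rightarrow> int option"
  have "T s \<in> entire_functions" for s
    using entire_translate[OF q] entire_translate[OF P] by (simp add: T_def del: add_uminus_conv_diff)
  then obtain P' where P': "P' \<in> entire_functions"
    "\<And>s z. (\<And>p. s p \<in> J) \<Longrightarrow> (\<And>p. real_coord p z \<in> {\<alpha> (s p)..\<beta> (s p)}) \<Longrightarrow> norm (T s z - P' z) < e"
    using entire_approximation_on_boxes[of J \<alpha> \<beta> T, OF finJ disj _ e] by blast
  show ?thesis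
  proof (intro bexI[OF _ P'(1)] conjI allI impI)
    fix z :: "complex ^ 'd" and k
    assume z: "z \<in> inner_box l m \<and> z + of_real_coords (\<lambda>p. m * of_int (k p)) \<in> inner_box m (of_int b * m)"
    let ?s = "\<lambda>p. Some (k p)"
    have zk: "real_coord p z \<in> {l..m - l}" "real_coord p z + m * of_int (k p) \<in> {m..of_int b * m - m}" for p
      using z by (auto simp: inner_box_def)
    have "k p \<in> {0..<b}" for p
    proof -
      have "m * of_int (k p) > 0" "m * of_int (k p) < of_int b * m"
        using zk[of p, unfolded atLeastAtMost_iff] l m by linarith+
      then show ?thesis using m by (simp add: mult.commute[of m] zero_less_mult_iff)
    qed
    then have "?s p \<in> J" for p by (simp add: J_def)
    moreover have "real_coord p (z + of_real_coords (\<lambda>p. m * of_int (k p))) \<in> {\<alpha> (?s p)..\<beta> (?s p)}" for p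
      using zk(1)[of p] by (simp add: \<alpha>_def \<beta>_def mult.commute)
    ultimately have "norm (T ?s (z + of_real_coords (\<lambda>p. m * of_int (k p)))
        - P' (z + of_real_coords (\<lambda>p. m * of_int (k p)))) < e"
      by (intro P'(2))
    then show "norm (P' (z + of_real_coords (\<lambda>p. m * of_int (k p))) - P z) < e"
      by (simp add: T_def fun_eq_iff norm_minus_commute)
  next
    fix w :: "complex ^ 'd" assume w: "\<forall>p. \<bar>real_coord p w\<bar> \<le> l / 2"
    have "norm (T (\<lambda>_. None) (of_real_coords (\<lambda>_. 2 * m) + w) - P' (of_real_coords (\<lambda>_. 2 * m) + w)) < e"
    proof (rule P'(2))
      fix p
      show "real_coord p (of_real_coords (\<lambda>_. 2 * m) + w) \<in> {\<alpha> None..\<beta> None}"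
        using w[rule_format, of p] by (auto simp: \<alpha>_def \<beta>_def abs_le_iff)
    qed (simp add: J_def)
    then show "norm (P' (of_real_coords (\<lambda>_. 2 * m) + w) - q w) < e"
      by (simp add: T_def norm_minus_commute)
  qed
qed

definition grid_index :: "nat \<Rightarrow> complex ^ 'd \<Rightarrow> 'd \<times> bool \<Rightarrow> int" where
  "grid_index n v = (\<lambda>p. \<lfloor>2 ^ n * real_coord p v\<rfloor>)"

lemma measurable_real_coord [measurable]: "real_coord p \<in> borel_measurable (borel :: (complex ^ 'd::finite) measure)"
proof -
  have "continuous_on UNIV (real_coord p :: complex ^ 'd \<Rightarrow> real)"
    unfolding real_coord_def by (cases "snd p") (auto intro!: continuous_intros)
  then show ?thesis by (rule borel_measurable_continuous_onI)
qed

lemma geometric_tail_bound: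
  fixes x :: "nat \<Rightarrow> 'a::banach"
  assumes step: "\<And>n. n \<ge> N \<Longrightarrow> norm (x (Suc n) - x n) \<le> (1 / 2) ^ n"
    and "n \<ge> N"
  shows "norm (lim x - x n) \<le> 2 * (1 / 2) ^ n"
proof -
  have tail: "norm (x (n + k) - x n) \<le> 2 * (1 / 2) ^ n - 2 * (1 / 2) ^ (n + k)" if "n \<ge> N" for n k
  proof (induction k)
    case (Suc k)
    have "norm (x (n + Suc k) - x n) \<le> norm (x (Suc (n + k)) - x (n + k)) + norm (x (n + k) - x n)"
      using norm_triangle_ineq[of "x (Suc (n + k)) - x (n + k)" "x (n + k) - x n"] by simp
    also have "\<dots> \<le> (1 / 2) ^ (n + k) + (2 * (1 / 2) ^ n - 2 * (1 / 2) ^ (n + k))"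
      using step[of "n + k"] that Suc by (intro add_mono) auto
    finally show ?case by simp
  qed simp
  have near: "norm (x m - x n) \<le> 2 * (1 / 2) ^ n" if "n \<ge> N" "m \<ge> n" for m n
  proof -
    have "norm (x m - x n) \<le> 2 * (1 / 2) ^ n - 2 * (1 / 2) ^ m"
      using tail[OF that(1), of "m - n"] that(2) by simp
    moreover have "(1 / 2 :: real) ^ m \<ge> 0" by simp
    ultimately show ?thesis by linarith
  qed
  have "Cauchy x"
  proof (rule metric_CauchyI)
    fix e :: real assume "e > 0"
    then obtain n0 where n0: "(1 / 2) ^ n0 < e / 4" using real_arch_pow_inv[of "e/4" "1/2"] by auto
    define n where "n = max n0 N"
    have "(1 / 2 :: real) ^ n \<le> (1 / 2) ^ n0" by (intro power_decreasing) (auto simp: n_def)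
    with n0 have n: "2 * (1 / 2 :: real) ^ n < e / 2" by linarith
    have nN: "n \<ge> N" by (simp add: n_def)
    have "dist (x i) (x j) < e" if "i \<ge> n" "j \<ge> n" for i j
      using near[OF nN that(1)] near[OF nN that(2)] n dist_triangle_half_l[of "x i" "x n" e "x j"]
      by (simp add: dist_norm norm_minus_commute)
    then show "\<exists>M. \<forall>m\<ge>M. \<forall>n\<ge>M. dist (x m) (x n) < e" by blast
  qed
  then have lim: "x \<longlonglongrightarrow> lim x" by (simp add: Cauchy_convergent_iff convergent_LIMSEQ_iff)
  show "norm (lim x - x n) \<le> 2 * (1 / 2) ^ n"
  proof (rule tendsto_upperbound)
    show "(\<lambda>m. norm (x m - x n)) \<longlonglongrightarrow> norm (lim x - x n)" by (intro tendsto_intros lim)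
    show "\<forall>\<^sub>F m in sequentially. norm (x m - x n) \<le> 2 * (1 / 2) ^ n"
      unfolding eventually_sequentially using near[OF \<open>n \<ge> N\<close>] by blast
  qed simp
qed

section \<open>Towers of tori\<close>

text \<open>A probability space with a measure-preserving action \<open>\<tau>\<close> of \<open>\<complex>\<^sup>d\<close> that is seen through
  a tower of tori: \<open>Z n g\<close> is the representative of \<open>g\<close> in the torus with side length \<open>R (Suc n)\<close>, the
  maps \<open>Z n\<close> are equivariant and compatible, and together they generate the measurable sets.
  The \<open>n\<close>-th cube has side \<open>R (Suc n)\<close> so that the margin \<open>R n\<close> is the side of the tiles one
  level below.\<close>

locale torus_tower = prob_space M
  for M :: "'g measure" +
  fixes a :: "nat \<Rightarrow> nat" and Z :: "nat \<Rightarrow> 'g \<Rightarrow> complex ^ 'd::finite" and \<tau> :: "complex ^ 'd \<Rightarrow> 'g \<Rightarrow> 'g"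
    and R :: "nat \<Rightarrow> real"
  assumes a_pos: "a n > 0" and a_summable: "summable (\<lambda>n. 1 / real (a n))"
    and R_0: "R 0 = 1" and R_Suc: "R (Suc n) = real (a n) * R n"
    and Z_measurable [measurable]: "Z n \<in> borel_measurable M"
    and Z_range: "g \<in> space M \<Longrightarrow> real_coord p (Z n g) \<in> {0..<R (Suc n)}"
    and Z_compat: "g \<in> space M \<Longrightarrow> Z n g = reduce_vec (R (Suc n)) (Z (Suc n) g)"
    and Z_tau: "g \<in> space M \<Longrightarrow> Z n (\<tau> z g) = reduce_vec (R (Suc n)) (Z n g + z)"
    and tau_tau: "g \<in> space M \<Longrightarrow> \<tau> w (\<tau> z g) = \<tau> (w + z) g"
    and tau_measurable [measurable]: "\<tau> z \<in> measurable M M"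
    and tau_preserves: "distr M M (\<tau> z) = M"
    and generated: "sets M \<subseteq> sigma_sets (space M) {{g \<in> space M. grid_index n (Z n g) = s} | n s. True}"
begin

lemma tau_space: "g \<in> space M \<Longrightarrow> \<tau> z g \<in> space M"
  using measurable_space[OF tau_measurable] .

lemma measure_tau_vimage: "A \<in> sets M \<Longrightarrow> measure M (\<tau> z -` A \<inter> space M) = measure M A"
  using measure_distr[OF tau_measurable, of A z] by (simp add: tau_preserves)

lemma R_pos: "R n > 0"
  by (induction n) (auto simp: R_0 R_Suc a_pos)

lemma R_mono_Suc: "R n \<le> R (Suc n)"
  using a_pos[of n] R_pos[of n] by (simp add: R_Suc)

lemma R_mono: "n \<le> m \<Longrightarrow> R n \<le> R m"
  by (rule lift_Suc_mono_le[of R]) (rule R_mono_Suc)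

lemma R_ge_1: "R n \<ge> 1"
  using R_mono[of 0 n] by (simp add: R_0)

lemma R_int: "\<exists>N>0. R n = of_int N"
proof (induction n)
  case (Suc n)
  then obtain N where "N > 0" "R n = of_int N" by blast
  then show ?case by (intro exI[of _ "int (a n) * N"]) (simp add: R_Suc a_pos)
qed (simp add: R_0 exI[of _ 1])

lemma eventually_a_ge: "eventually (\<lambda>n. a n \<ge> k) sequentially"
proof -
  have "(\<lambda>n. 1 / real (a n)) \<longlonglongrightarrow> 0" by (rule summable_LIMSEQ_zero[OF a_summable])
  then have "eventually (\<lambda>n. 1 / real (a n) < 1 / real (Suc k)) sequentially"
    by (rule order_tendstoD) simp
  then show ?thesis
  proof eventually_elim
    case (elim n)
    then have "real (Suc k) < real (a n)" using a_pos[of n] by (simp add: field_simps)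
    then show ?case by linarith
  qed
qed

lemma eventually_R_ge: "eventually (\<lambda>n. R n \<ge> B) sequentially"
proof -
  obtain n0 where n0: "\<And>n. n \<ge> n0 \<Longrightarrow> a n \<ge> 2"
    using eventually_a_ge[of 2] unfolding eventually_sequentially by blast
  have "R (n0 + k) \<ge> real k" for k
  proof (induction k)
    case (Suc k)
    have "2 * R (n0 + k) \<le> real (a (n0 + k)) * R (n0 + k)"
      using n0[of "n0 + k"] R_pos[of "n0 + k"] by (intro mult_right_mono) auto
    then have "2 * R (n0 + k) \<le> R (Suc (n0 + k))" by (simp only: R_Suc)
    then show ?case using Suc R_ge_1[of "n0 + k"] by simp
  qed (use R_pos less_imp_le in auto)
  moreover obtain k where "B \<le> real k" using real_arch_simple by blast
  ultimately have "R n \<ge> B" if "n \<ge> n0 + k" for n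
    using R_mono[OF that] by (meson order.trans)
  then show ?thesis unfolding eventually_sequentially by blast
qed


subsection \<open>Almost every point stays away from the boundaries\<close>

definition slice :: "nat \<Rightarrow> 'd \<times> bool \<Rightarrow> int \<Rightarrow> 'g set" where
  "slice n p j = {g \<in> space M. \<lfloor>real_coord p (Z n g) / R n\<rfloor> = j}"

lemma slice_sets [measurable]: "slice n p j \<in> sets M"
  unfolding slice_def by measurable

lemma slice_range:
  assumes "g \<in> slice n p j"
  shows "0 \<le> j \<and> j < int (a n)"
proof -
  have g: "g \<in> space M" "\<lfloor>real_coord p (Z n g) / R n\<rfloor> = j" using assms by (auto simp: slice_def)
  have "0 \<le> real_coord p (Z n g) / R n" "real_coord p (Z n g) / R n < real (a n)"
    using Z_range[OF g(1), of p n] R_pos[of n] by (auto simp: R_Suc field_simps)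
  then show ?thesis using g(2) by linarith
qed

lemma slice_translate:
  fixes p :: "'d \<times> bool"
  assumes j: "0 \<le> j" "j < int (a n)"
  defines "z \<equiv> of_real_coords (\<lambda>p'. if p' = p then of_int j * R n else 0)"
  shows "\<tau> z -` slice n p j \<inter> space M = slice n p 0"
proof -
  have "\<lfloor>real_coord p (Z n (\<tau> z g)) / R n\<rfloor> = j \<longleftrightarrow> \<lfloor>real_coord p (Z n g) / R n\<rfloor> = 0"
    if g: "g \<in> space M" for g
  proof -
    let ?x = "real_coord p (Z n g)"
    have "\<lfloor>real_coord p (Z n (\<tau> z g)) / R n\<rfloor> = \<lfloor>(1 / R n) * reduce (R (Suc n)) (?x + of_int j * R n)\<rfloor>"
      by (simp add: Z_tau[OF g] z_def)
    also have "\<dots> = \<lfloor>(1 / R n) * (?x + of_int j * R n)\<rfloor> mod int (a n)"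
      using R_pos[of n] a_pos by (intro floor_mult_reduce) (auto simp: R_Suc)
    also have "(1 / R n) * (?x + of_int j * R n) = ?x / R n + of_int j"
      using R_pos[of n] by (simp add: field_simps)
    also have "\<lfloor>\<dots>\<rfloor> = \<lfloor>?x / R n\<rfloor> + j" by simp
    finally have eq: "\<lfloor>real_coord p (Z n (\<tau> z g)) / R n\<rfloor> = (\<lfloor>?x / R n\<rfloor> + j) mod int (a n)" .
    have d: "0 \<le> \<lfloor>?x / R n\<rfloor>" "\<lfloor>?x / R n\<rfloor> < int (a n)"
      using slice_range[of g n p "\<lfloor>?x / R n\<rfloor>"] g by (auto simp: slice_def)
    have "(d + j) mod A = j \<longleftrightarrow> d = 0" if "0 \<le> d" "d < A" "0 \<le> j" "j < A" for d A :: int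
    proof (cases "d + j < A")
      case False
      then have "(d + j - A) mod A = d + j - A" using that by (intro mod_pos_pos_trivial) auto
      then have "(d + j) mod A = d + j - A" by simp
      then show ?thesis using that False by auto
    qed (use that in auto)
    from this[OF d j] show ?thesis unfolding eq .
  qed
  then show ?thesis by (auto simp: slice_def tau_space)
qed

text \<open>The \<open>a n\<close> slices are disjoint and, being translates of each other, have equal measure.\<close>

lemma measure_slice: "measure M (slice n p j) \<le> 1 / real (a n)"
proof -
  have eq: "measure M (slice n p i) = measure M (slice n p 0)" if "i \<in> {0..<int (a n)}" for i
    using slice_translate[of i n p] that
      measure_tau_vimage[OF slice_sets[of n p i], of "of_real_coords (\<lambda>p'. if p' = p then of_int i * R n else 0)"]
    by simp
  have "real (a n) * measure M (slice n p 0) = (\<Sum>i\<in>{0..<int (a n)}. measure M (slice n p i))"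
    using sum.cong[OF refl eq, of "{0..<int (a n)}" "\<lambda>i. i"] by simp
  also have "\<dots> = measure M (\<Union>i\<in>{0..<int (a n)}. slice n p i)"
    by (rule finite_measure_finite_Union[symmetric]) (auto simp: disjoint_family_on_def slice_def)
  also have "\<dots> \<le> 1" by simp
  finally have 0: "measure M (slice n p 0) \<le> 1 / real (a n)" using a_pos[of n] by (simp add: field_simps)
  show ?thesis
  proof (cases "j \<in> {0..<int (a n)}")
    case False
    then have "slice n p j = {}" using slice_range by fastforce
    then show ?thesis by simp
  next
    case True
    then show ?thesis using 0 eq[of j] by simp
  qed
qed

text \<open>
  The margin is \<open>2 * R n\<close>, so that a translation by at most \<open>R n\<close> in every coordinate ends in
  \<open>inner_box (R n) (R (Suc n))\<close>.
\<close>

definition deep :: "nat \<Rightarrow> 'g \<Rightarrow> bool" where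
  "deep n g \<longleftrightarrow> (\<forall>p. real_coord p (Z n g) \<in> {2 * R n..R (Suc n) - 2 * R n})"

lemma deep_measurable [measurable]: "Measurable.pred M (deep n)"
  unfolding deep_def by measurable

text \<open>A point that fails to be deep at level \<open>n\<close> lies in one of the two outermost slices on
  either side of some coordinate, which together have measure of order \<open>1 / a n\<close>.\<close>

lemma AE_eventually_deep: "AE g in M. eventually (\<lambda>n. deep n g) sequentially"
proof -
  define A where "A n = (\<Union>p. \<Union>j\<in>{0, 1, int (a n) - 2, int (a n) - 1}. slice n p j)" for n
  have A [measurable]: "A n \<in> sets M" for n unfolding A_def by measurable
  define c where "c = real CARD('d \<times> bool) * 4"
  have bound: "measure M (A n) \<le> c * (1 / real (a n))" for n
  proof -
    have "measure M (A n) \<le> (\<Sum>p\<in>(UNIV :: ('d \<times> bool) set). measure M (\<Union>j\<in>{0, 1, int (a n) - 2, int (a n) - 1}. slice n p j))"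
      unfolding A_def by (intro measure_UNION_le) auto
    also have "\<dots> \<le> (\<Sum>p\<in>(UNIV :: ('d \<times> bool) set). 4 * (1 / real (a n)))"
    proof (rule sum_mono)
      fix p :: "'d \<times> bool"
      let ?J = "{0, 1, int (a n) - 2, int (a n) - 1}"
      have "measure M (\<Union>j\<in>?J. slice n p j) \<le> (\<Sum>j\<in>?J. measure M (slice n p j))"
        by (intro measure_UNION_le) auto
      also have "\<dots> \<le> (\<Sum>j\<in>?J. 1 / real (a n))" by (intro sum_mono measure_slice)
      also have "\<dots> = real (card ?J) * (1 / real (a n))" by simp
      also have "real (card ?J) \<le> 4"
        using card_length[of "[0, 1, int (a n) - 2, int (a n) - 1]"] by simp
      finally show "measure M (\<Union>j\<in>?J. slice n p j) \<le> 4 * (1 / real (a n))"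
        by (simp add: mult_right_mono divide_right_mono)
    qed
    also have "\<dots> = c * (1 / real (a n))" by (simp add: c_def)
    finally show ?thesis .
  qed
  have "summable (\<lambda>n. measure M (A n))"
    by (rule summable_comparison_test'[OF summable_mult[OF a_summable, of c], of 0]) (use bound in auto)
  then have "AE g in M. eventually (\<lambda>n. g \<in> space M - A n) sequentially"
    by (intro borel_cantelli_AE1) (auto simp: less_top[symmetric])
  then show ?thesis
  proof eventually_elim
    case (elim g)
    then show ?case
    proof eventually_elim
      case (elim n)
      show ?case unfolding deep_def
      proof
        fix p
        define d where "d = \<lfloor>real_coord p (Z n g) / R n\<rfloor>"
        have g: "g \<in> slice n p d" using elim by (simp add: slice_def d_def)
        have "d \<notin> {0, 1, int (a n) - 2, int (a n) - 1}" using elim g unfolding A_def by blast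
        with slice_range[OF g] have d: "2 \<le> d" "d \<le> int (a n) - 3" by auto
        have "of_int d \<le> real_coord p (Z n g) / R n" "real_coord p (Z n g) / R n \<le> of_int d + 1"
          unfolding d_def by linarith+
        then have "of_int 2 \<le> real_coord p (Z n g) / R n" "real_coord p (Z n g) / R n \<le> of_int (int (a n) - 2)"
          using d by linarith+
        then show "real_coord p (Z n g) \<in> {2 * R n..R (Suc n) - 2 * R n}"
          using R_pos[of n] by (auto simp: R_Suc field_simps)
      qed
    qed
  qed
qed


subsection \<open>The limit function\<close>

text \<open>The copy of \<open>q n\<close> is placed around the lattice point all of whose real coordinates are
  \<open>2 * R (Suc n)\<close>, because as soon as \<open>a (Suc n) \<ge> 4\<close> it lies in the inner box of the next level
  and is preserved by the later functions.\<close>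

definition coherent :: "(nat \<Rightarrow> complex ^ 'd \<Rightarrow> complex) \<Rightarrow> (nat \<Rightarrow> complex ^ 'd \<Rightarrow> complex) \<Rightarrow> bool" where
  "coherent q P \<longleftrightarrow> (\<forall>n. P n \<in> entire_functions \<and>
    (\<forall>z k. z \<in> inner_box (R n) (R (Suc n)) \<and>
        z + of_real_coords (\<lambda>p. R (Suc n) * of_int (k p)) \<in> inner_box (R (Suc n)) (R (Suc (Suc n))) \<longrightarrow>
       norm (P (Suc n) (z + of_real_coords (\<lambda>p. R (Suc n) * of_int (k p))) - P n z) < (1 / 2) ^ n) \<and>
    (\<forall>w. (\<forall>p. \<bar>real_coord p w\<bar> \<le> R n / 2) \<longrightarrow>
       norm (P (Suc n) (of_real_coords (\<lambda>_. 2 * R (Suc n)) + w) - q n w) < (1 / 2) ^ n))"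

lemma coherent_exists:
  assumes q: "\<And>n. q n \<in> entire_functions"
  shows "\<exists>P. coherent q P"
proof -
  define Q where "Q n P P' \<longleftrightarrow>
    (\<forall>z k. z \<in> inner_box (R n) (R (Suc n)) \<and>
        z + of_real_coords (\<lambda>p. R (Suc n) * of_int (k p)) \<in> inner_box (R (Suc n)) (R (Suc (Suc n))) \<longrightarrow>
       norm (P' (z + of_real_coords (\<lambda>p. R (Suc n) * of_int (k p))) - P z) < (1 / 2) ^ n) \<and>
    (\<forall>w. (\<forall>p. \<bar>real_coord p w\<bar> \<le> R n / 2) \<longrightarrow>
       norm (P' (of_real_coords (\<lambda>_. 2 * R (Suc n)) + w) - q n w) < (1 / 2) ^ n)"
    for n and P P' :: "complex ^ 'd \<Rightarrow> complex"
  have "\<exists>P. \<forall>n. P n \<in> entire_functions \<and> Q n (P n) (P (Suc n))"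
  proof (rule dependent_nat_choice)
    show "\<exists>P. P \<in> (entire_functions :: (complex ^ 'd \<Rightarrow> complex) set)" using entire_const by blast
    fix P :: "complex ^ 'd \<Rightarrow> complex" and n
    assume "P \<in> entire_functions"
    from next_level_function[OF R_pos[of n] R_pos[of "Suc n"] this q[of n], of "(1 / 2) ^ n" "int (a (Suc n))"]
    show "\<exists>P'. P' \<in> entire_functions \<and> Q n P P'" by (auto simp: Q_def R_Suc[of "Suc n"])
  qed
  then show ?thesis unfolding coherent_def Q_def by blast
qed

lemma coherent_step:
  assumes P: "coherent q P" and g: "g \<in> space M"
    and n: "Z n g \<in> inner_box (R n) (R (Suc n))" "Z (Suc n) g \<in> inner_box (R (Suc n)) (R (Suc (Suc n)))"
  shows "norm (P (Suc n) (Z (Suc n) g) - P n (Z n g)) \<le> (1 / 2) ^ n"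
proof -
  have "Z (Suc n) g = Z n g + of_real_coords (\<lambda>p. R (Suc n) * of_int \<lfloor>real_coord p (Z (Suc n) g) / R (Suc n)\<rfloor>)"
    unfolding vec_eq_real_coords
  proof
    fix p
    have "real_coord p (Z n g) = reduce (R (Suc n)) (real_coord p (Z (Suc n) g))"
      by (subst Z_compat[OF g]) simp
    then show "real_coord p (Z (Suc n) g) = real_coord p
        (Z n g + of_real_coords (\<lambda>p. R (Suc n) * of_int \<lfloor>real_coord p (Z (Suc n) g) / R (Suc n)\<rfloor>))"
      by (simp add: reduce_def)
  qed
  then show ?thesis using P n unfolding coherent_def by (metis less_imp_le)
qed

definition limit_function :: "(nat \<Rightarrow> complex ^ 'd \<Rightarrow> complex) \<Rightarrow> 'g \<Rightarrow> complex" where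
  "limit_function P g = lim (\<lambda>n. P n (Z n g))"

lemma limit_function_near:
  assumes P: "coherent q P" and g: "g \<in> space M"
    and n: "\<And>n. n \<ge> N \<Longrightarrow> Z n g \<in> inner_box (R n) (R (Suc n))" and "m \<ge> N"
  shows "norm (limit_function P g - P m (Z m g)) \<le> 2 * (1 / 2) ^ m"
  unfolding limit_function_def
  by (rule geometric_tail_bound[of N "\<lambda>n. P n (Z n g)"])
     (use coherent_step[OF P g] n \<open>m \<ge> N\<close> in auto)

lemma limit_function_measurable:
  assumes "coherent q P"
  shows "limit_function P \<in> borel_measurable M"
proof -
  have [measurable]: "P n \<in> borel_measurable borel" for n
    using assms unfolding coherent_def by (intro borel_measurable_continuous_onI entire_continuous_on) auto
  show ?thesis unfolding limit_function_def[abs_def] by measurable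
qed

lemma deep_translate:
  assumes g: "g \<in> space M" "deep n g" and z: "\<And>p. \<bar>real_coord p z\<bar> \<le> R n"
  shows "Z n (\<tau> z g) = Z n g + z" "Z n (\<tau> z g) \<in> inner_box (R n) (R (Suc n))"
proof -
  have r: "real_coord p (Z n g + z) \<in> {R n..R (Suc n) - R n}" for p
    using g(2) z[of p] by (auto simp: deep_def abs_le_iff) (smt (verit, best))+
  have "reduce (R (Suc n)) (real_coord p (Z n g + z)) = real_coord p (Z n g + z)" for p
    using r[of p] R_pos[of n] R_pos[of "Suc n"] by (intro reduce_id) auto
  then show eq: "Z n (\<tau> z g) = Z n g + z"
    unfolding Z_tau[OF g(1)] vec_eq_real_coords real_coord_reduce_vec by blast
  show "Z n (\<tau> z g) \<in> inner_box (R n) (R (Suc n))"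
    unfolding eq inner_box_def using r by blast
qed

text \<open>On a ball of radius \<open>B\<close>, once \<open>R n \<ge> B\<close> and \<open>g\<close> is deep at all later levels, the translates
  remain in the inner boxes, where consecutive \<open>P n\<close> differ by at most \<open>2\<^sup>-\<^sup>n\<close>. The
  convergence is therefore uniform on the ball.\<close>

lemma limit_function_entire:
  assumes P: "coherent q P" and g: "g \<in> space M" and deep: "eventually (\<lambda>n. deep n g) sequentially"
  shows "(\<lambda>z. limit_function P (\<tau> z g)) \<in> entire_functions"
proof (rule entire_locally_uniform_limit)
  show "(\<lambda>z. P n (z + Z n g)) \<in> entire_functions" for n
    using P unfolding coherent_def by (intro entire_translate) blast
  fix B :: real
  obtain N where N: "\<And>n. n \<ge> N \<Longrightarrow> deep n g \<and> R n \<ge> B"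
    using eventually_conj[OF deep eventually_R_ge[of B]] unfolding eventually_sequentially by blast
  show "uniform_limit (cball 0 B) (\<lambda>n z. P n (z + Z n g)) (\<lambda>z. limit_function P (\<tau> z g)) sequentially"
  proof (rule uniform_limitI)
    fix e :: real assume "e > 0"
    then obtain k where k: "(1 / 2) ^ k < e / 2" using real_arch_pow_inv[of "e/2" "1/2"] by auto
    have "dist (P n (z + Z n g)) (limit_function P (\<tau> z g)) < e" if n: "n \<ge> max N k" and z: "z \<in> cball 0 B" for n z
    proof -
      have zR: "\<bar>real_coord p z\<bar> \<le> R m" if "m \<ge> N" for p m
        using abs_real_coord_le_norm[of p z] z N[OF that] by auto
      have box: "Z m (\<tau> z g) = Z m g + z" "Z m (\<tau> z g) \<in> inner_box (R m) (R (Suc m))" if "m \<ge> N" for m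
        using deep_translate[OF g _ zR[OF that]] N[OF that] by auto
      have "norm (limit_function P (\<tau> z g) - P n (Z n (\<tau> z g))) \<le> 2 * (1 / 2) ^ n"
        using n by (intro limit_function_near[OF P tau_space[OF g] box(2)]) auto
      also have "(1 / 2 :: real) ^ n \<le> (1 / 2) ^ k" using n by (intro power_decreasing) auto
      finally show ?thesis using k box(1)[of n] n by (simp add: dist_norm norm_minus_commute add.commute)
    qed
    then show "\<forall>\<^sub>F n in sequentially. \<forall>z\<in>cball 0 B. dist (P n (z + Z n g)) (limit_function P (\<tau> z g)) < e"
      unfolding eventually_sequentially by blast
  qed
qed

text \<open>The translation \<open>z\<close> takes the representative at level \<open>Suc n\<close> to the place where \<open>P (Suc n)\<close>
  copies \<open>q n\<close>. It moves every coordinate by at most \<open>R (Suc (Suc n))\<close>, which is harmless at all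
  higher levels, so the limit function still follows \<open>P (Suc n)\<close> there.\<close>

lemma limit_function_visits:
  assumes P: "coherent q P" and g: "g \<in> space M" and deep: "eventually (\<lambda>n. deep n g) sequentially"
  shows "eventually (\<lambda>n. \<exists>z. \<forall>w\<in>cball 0 B.
      norm (limit_function P (\<tau> (w + z) g) - q n w) < 2 * (1 / 2) ^ n) sequentially"
proof -
  obtain N where N: "\<And>n. n \<ge> N \<Longrightarrow> deep n g \<and> R n \<ge> 2 * B \<and> a n \<ge> 4"
    using eventually_conj[OF deep eventually_conj[OF eventually_R_ge[of "2 * B"] eventually_a_ge[of 4]]]
    unfolding eventually_sequentially by blast
  have "norm (limit_function P (\<tau> (w + z) g) - q n w) < 2 * (1 / 2) ^ n"
    if n: "n \<ge> N" and w: "w \<in> cball 0 B" and z: "z = of_real_coords (\<lambda>_. 2 * R (Suc n)) - Z (Suc n) g" for n w z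
  proof -
    define h where "h = \<tau> (w + z) g"
    have h: "h \<in> space M" unfolding h_def by (rule tau_space[OF g])
    let ?c = "of_real_coords (\<lambda>_. 2 * R (Suc n)) + w"
    have wR: "\<bar>real_coord p w\<bar> \<le> R n / 2" for p
      using abs_real_coord_le_norm[of p w] w N[OF n] by auto
    have "4 * R (Suc n) \<le> real (a (Suc n)) * R (Suc n)"
      using N[of "Suc n"] n R_pos[of "Suc n"] by (intro mult_right_mono) auto
    then have R4: "4 * R (Suc n) \<le> R (Suc (Suc n))" by (simp only: R_Suc)
    have c: "real_coord p ?c \<in> {R (Suc n)..R (Suc (Suc n)) - R (Suc n)}" for p
      using wR[of p] R4 R_mono_Suc[of n] R_pos[of n] by (auto simp: abs_le_iff) 
    have sum: "Z (Suc n) g + (w + z) = ?c" by (simp add: z)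
    have "reduce (R (Suc (Suc n))) (real_coord p ?c) = real_coord p ?c" for p
      using c[of p] R_pos[of "Suc n"] R_pos[of "Suc (Suc n)"] by (intro reduce_id) auto
    then have Zh: "Z (Suc n) h = ?c"
      unfolding h_def Z_tau[OF g] vec_eq_real_coords real_coord_reduce_vec sum by blast
    have box: "Z m h \<in> inner_box (R m) (R (Suc m))" if m: "m \<ge> Suc n" for m
    proof (cases "m = Suc n")
      case True
      then show ?thesis unfolding True Zh inner_box_def using c by blast
    next
      case False
      have "\<bar>real_coord p (w + z)\<bar> \<le> R m" for p
      proof -
        have "real_coord p (w + z) = real_coord p ?c - real_coord p (Z (Suc n) g)" by (simp add: z)
        moreover have "real_coord p (Z (Suc n) g) \<in> {0..<R (Suc (Suc n))}" by (rule Z_range[OF g])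
        ultimately have "\<bar>real_coord p (w + z)\<bar> \<le> R (Suc (Suc n))"
          using c[of p] R_pos[of "Suc n"] unfolding abs_le_iff atLeastAtMost_iff atLeastLessThan_iff by linarith
        also have "\<dots> \<le> R m" using False m by (intro R_mono) auto
        finally show ?thesis .
      qed
      then show ?thesis unfolding h_def using N[of m] m n by (intro deep_translate g) auto
    qed
    have "norm (limit_function P h - P (Suc n) (Z (Suc n) h)) \<le> 2 * (1 / 2) ^ Suc n"
      by (intro limit_function_near[OF P h box]) auto
    moreover have "norm (P (Suc n) (Z (Suc n) h) - q n w) < (1 / 2) ^ n"
      using P wR unfolding coherent_def Zh by blast
    ultimately show ?thesis
      using norm_triangle_ineq[of "limit_function P h - P (Suc n) (Z (Suc n) h)" "P (Suc n) (Z (Suc n) h) - q n w"]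
      by (simp add: h_def)
  qed
  then show ?thesis unfolding eventually_sequentially by blast
qed


subsection \<open>Ergodicity\<close>

definition cell_set :: "nat \<Rightarrow> ('d \<times> bool \<Rightarrow> int) set \<Rightarrow> 'g set" where
  "cell_set n S = {g \<in> space M. grid_index n (Z n g) \<in> S}"

lemma cell_set_sets [measurable]: "cell_set n S \<in> sets M"
proof -
  have "{g \<in> space M. grid_index n (Z n g) = s} \<in> sets M" for s
    unfolding grid_index_def fun_eq_iff by measurable
  moreover have "cell_set n S = (\<Union>s\<in>S. {g \<in> space M. grid_index n (Z n g) = s})"
    by (auto simp: cell_set_def)
  ultimately show ?thesis by (auto intro!: sets.countable_UN')
qed

definition cells_per_axis :: "nat \<Rightarrow> int" where
  "cells_per_axis n = \<lfloor>2 ^ n * R (Suc n)\<rfloor>"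

lemma cells_per_axis: "cells_per_axis n > 0" "2 ^ n * R (Suc n) = of_int (cells_per_axis n)"
proof -
  obtain N where "N > 0" "R (Suc n) = of_int N" using R_int by blast
  then have "2 ^ n * R (Suc n) = of_int (2 ^ n * N)" "2 ^ n * N > 0" by auto
  then show "cells_per_axis n > 0" "2 ^ n * R (Suc n) = of_int (cells_per_axis n)"
    unfolding cells_per_axis_def by (simp_all only: floor_of_int)
qed

lemma grid_index_refine:
  assumes "g \<in> space M"
  shows "grid_index n (Z n g) = (\<lambda>p. (grid_index (Suc n) (Z (Suc n) g) p div 2) mod cells_per_axis n)"
proof
  fix p
  let ?x = "real_coord p (Z (Suc n) g)"
  have "grid_index n (Z n g) p = \<lfloor>2 ^ n * reduce (R (Suc n)) ?x\<rfloor>"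
    unfolding grid_index_def by (subst Z_compat[OF assms]) simp
  also have "\<dots> = \<lfloor>2 ^ n * ?x\<rfloor> mod cells_per_axis n"
    using cells_per_axis[of n] by (intro floor_mult_reduce) auto
  also have "2 ^ n * ?x = 2 ^ Suc n * ?x / of_int 2" by simp
  also have "\<lfloor>\<dots>\<rfloor> = \<lfloor>2 ^ Suc n * ?x\<rfloor> div 2" by (rule floor_divide_real_eq_div) simp
  finally show "grid_index n (Z n g) p = (grid_index (Suc n) (Z (Suc n) g) p div 2) mod cells_per_axis n"
    by (simp add: grid_index_def)
qed

lemma cell_set_refine:
  assumes "n \<le> m"
  shows "\<exists>S'. cell_set n S = cell_set m S'"
  using assms
proof (induction m rule: dec_induct)
  case (step m)
  then obtain S' where "cell_set n S = cell_set m S'" by blast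
  also have "\<dots> = cell_set (Suc m) {s. (\<lambda>p. (s p div 2) mod cells_per_axis m) \<in> S'}"
    unfolding cell_set_def
  proof (intro Collect_cong conj_cong refl)
    fix g assume "g \<in> space M"
    from grid_index_refine[OF this, of m]
    show "grid_index m (Z m g) \<in> S' \<longleftrightarrow>
        grid_index (Suc m) (Z (Suc m) g) \<in> {s. (\<lambda>p. (s p div 2) mod cells_per_axis m) \<in> S'}"
      by (simp only: mem_Collect_eq)
  qed
  finally show ?case by blast
qed blast

text \<open>The sets that are approximated in measure by sets of cells form a sigma-algebra that contains
  the cells; unions are handled by passing to a common refinement.\<close>

lemma cell_set_approximation:
  assumes "A \<in> sets M" "e > 0"
  shows "\<exists>n S. measure M (sym_diff A (cell_set n S)) < e"
proof -
  have "A \<in> sigma_sets (space M) {{g \<in> space M. grid_index n (Z n g) = s} | n s. True}"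
    using assms generated by blast
  then have "A \<in> sets M \<and> (\<forall>e>0. \<exists>n S. measure M (sym_diff A (cell_set n S)) < e)"
  proof induction
    case (Basic A)
    then obtain n s where "A = cell_set n {s}" by (auto simp: cell_set_def)
    then show ?case by (auto intro!: exI[of _ n] exI[of _ "{s}"])
  next
    case Empty
    have "cell_set 0 {} = {}" by (simp add: cell_set_def)
    then show ?case by (auto intro!: exI[of _ 0] exI[of _ "{}"])
  next
    case (Compl A)
    have eq: "sym_diff (space M - A) (cell_set n (- S)) = sym_diff A (cell_set n S)" for n S
      using Compl sets.sets_into_space[of A M] by (auto simp: cell_set_def)
    have "\<exists>n S. measure M (sym_diff (space M - A) (cell_set n S)) < e" if "e > 0" for e
    proof -
      obtain n S where "measure M (sym_diff A (cell_set n S)) < e" using Compl.IH \<open>e > 0\<close> by blast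
      then show ?thesis by (intro exI[of _ n] exI[of _ "- S"]) (simp only: eq)
    qed
    then show ?case using Compl.IH by blast
  next
    case (Union A)
    then have A [measurable]: "A i \<in> sets M" for i by blast
    have fin: "\<forall>e>0. \<exists>n S. measure M (sym_diff (\<Union>i<k. A i) (cell_set n S)) < e" for k :: nat
    proof (induction k)
      case 0
      have "cell_set 0 {} = {}" by (simp add: cell_set_def)
      then show ?case by (auto intro!: exI[of _ 0] exI[of _ "{}"])
    next
      case (Suc k)
      show ?case
      proof (intro allI impI)
        fix e :: real assume "e > 0"
        then have "e / 2 > 0" by simp
        obtain n S where nS: "measure M (sym_diff (\<Union>i<k. A i) (cell_set n S)) < e / 2"
          using Suc \<open>e / 2 > 0\<close> by blast
        obtain n' S' where nS': "measure M (sym_diff (A k) (cell_set n' S')) < e / 2"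
          using Union \<open>e / 2 > 0\<close> by blast
        obtain T where T: "cell_set n S = cell_set (max n n') T" using cell_set_refine[of n "max n n'"] by auto
        obtain T' where T': "cell_set n' S' = cell_set (max n n') T'" using cell_set_refine[of n' "max n n'"] by auto
        have "cell_set (max n n') (T \<union> T') = cell_set n S \<union> cell_set n' S'"
          unfolding T T' by (auto simp: cell_set_def)
        then have "sym_diff (\<Union>i<Suc k. A i) (cell_set (max n n') (T \<union> T'))
            \<subseteq> sym_diff (\<Union>i<k. A i) (cell_set n S) \<union> sym_diff (A k) (cell_set n' S')"
          by (auto simp: lessThan_Suc)
        then have "measure M (sym_diff (\<Union>i<Suc k. A i) (cell_set (max n n') (T \<union> T')))
            \<le> measure M (sym_diff (\<Union>i<k. A i) (cell_set n S) \<union> sym_diff (A k) (cell_set n' S'))"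
          by (intro finite_measure_mono) auto
        also have "\<dots> \<le> measure M (sym_diff (\<Union>i<k. A i) (cell_set n S)) + measure M (sym_diff (A k) (cell_set n' S'))"
          by (intro measure_Un_le) auto
        also have "\<dots> < e" using nS nS' by simp
        finally show "\<exists>n S. measure M (sym_diff (\<Union>i<Suc k. A i) (cell_set n S)) < e" by blast
      qed
    qed
    have "\<exists>n S. measure M (sym_diff (\<Union>i. A i) (cell_set n S)) < e" if "e > 0" for e
    proof -
      have "incseq (\<lambda>k. \<Union>i<k. A i)" by (fastforce simp: incseq_def)
      then have "(\<lambda>k. measure M (\<Union>i<k. A i)) \<longlonglongrightarrow> measure M (\<Union>k. \<Union>i<k. A i)"
        by (intro finite_Lim_measure_incseq) auto
      also have "(\<Union>k. \<Union>i<k. A i) = (\<Union>i. A i)" by blast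
      finally have "eventually (\<lambda>k. measure M (\<Union>i<k. A i) > measure M (\<Union>i. A i) - e / 2) sequentially"
        using that by (intro order_tendstoD) auto
      then obtain k where k: "measure M (\<Union>i<k. A i) > measure M (\<Union>i. A i) - e / 2"
        by (auto simp: eventually_sequentially)
      obtain n S where nS: "measure M (sym_diff (\<Union>i<k. A i) (cell_set n S)) < e / 2"
        using fin[of k, rule_format, of "e / 2"] \<open>e > 0\<close> by auto
      have "measure M (sym_diff (\<Union>i. A i) (cell_set n S))
          \<le> measure M (((\<Union>i. A i) - (\<Union>i<k. A i)) \<union> sym_diff (\<Union>i<k. A i) (cell_set n S))"
        by (intro finite_measure_mono) auto
      also have "\<dots> \<le> measure M ((\<Union>i. A i) - (\<Union>i<k. A i)) + measure M (sym_diff (\<Union>i<k. A i) (cell_set n S))"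
        by (intro measure_Un_le) auto
      also have "measure M ((\<Union>i. A i) - (\<Union>i<k. A i)) = measure M (\<Union>i. A i) - measure M (\<Union>i<k. A i)"
        by (intro finite_measure_Diff) auto
      finally show ?thesis using k nS by (intro exI[of _ n] exI[of _ S]) linarith
    qed
    then show ?case by auto
  qed
  then show ?thesis using assms(2) by blast
qed

definition grid_index_set :: "nat \<Rightarrow> ('d \<times> bool \<Rightarrow> int) set" where
  "grid_index_set n = PiE UNIV (\<lambda>_. {0..<cells_per_axis n})"

definition grid_vector :: "nat \<Rightarrow> ('d \<times> bool \<Rightarrow> int) \<Rightarrow> complex ^ 'd" where
  "grid_vector n s = of_real_coords (\<lambda>p. of_int (s p) / 2 ^ n)"

lemma finite_grid_index_set: "finite (grid_index_set n :: ('d \<times> bool \<Rightarrow> int) set)"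
  unfolding grid_index_set_def by (intro finite_PiE) auto

lemma grid_index_translate:
  assumes "g \<in> space M"
  shows "grid_index n (Z n (\<tau> (grid_vector n s) g)) = (\<lambda>p. (grid_index n (Z n g) p + s p) mod cells_per_axis n)"
proof
  fix p
  let ?x = "real_coord p (Z n g)"
  have "grid_index n (Z n (\<tau> (grid_vector n s) g)) p = \<lfloor>2 ^ n * reduce (R (Suc n)) (?x + of_int (s p) / 2 ^ n)\<rfloor>"
    by (simp add: grid_index_def Z_tau[OF assms] grid_vector_def)
  also have "\<dots> = \<lfloor>2 ^ n * (?x + of_int (s p) / 2 ^ n)\<rfloor> mod cells_per_axis n"
    using cells_per_axis[of n] by (intro floor_mult_reduce) auto
  also have "2 ^ n * (?x + of_int (s p) / 2 ^ n) = 2 ^ n * ?x + of_int (s p)" by (simp add: algebra_simps)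
  finally show "grid_index n (Z n (\<tau> (grid_vector n s) g)) p = (grid_index n (Z n g) p + s p) mod cells_per_axis n"
    by (simp add: grid_index_def)
qed

lemma grid_shift_bij:
  "bij_betw (\<lambda>s p. (u p + s p) mod cells_per_axis n) (grid_index_set n) (grid_index_set n)"
proof -
  let ?N = "cells_per_axis n"
  have N: "?N > 0" by (rule cells_per_axis)
  have inj: "inj_on (\<lambda>s p. (u p + s p) mod ?N) (grid_index_set n)"
  proof (rule inj_onI)
    fix s t assume st: "s \<in> grid_index_set n" "t \<in> grid_index_set n"
      and eq: "(\<lambda>p. (u p + s p) mod ?N) = (\<lambda>p. (u p + t p) mod ?N)"
    show "s = t"
    proof
      fix p
      have "(u p + s p) mod ?N = (u p + t p) mod ?N" using eq by metis
      then have "s p mod ?N = t p mod ?N" by (metis add_diff_cancel_left' mod_diff_left_eq)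
      moreover have "s p \<in> {0..<?N}" "t p \<in> {0..<?N}" using st by (auto simp: grid_index_set_def)
      ultimately show "s p = t p" by simp
    qed
  qed
  have "(\<lambda>s p. (u p + s p) mod ?N) ` grid_index_set n \<subseteq> grid_index_set n"
    using N by (auto simp: grid_index_set_def)
  then show ?thesis
    using endo_inj_surj[OF finite_grid_index_set _ inj] inj unfolding bij_betw_def by blast
qed

text \<open>The translations of the grid permute its cells simply transitively. So for each point,
  the number of translations that carry it into a set of cells is the number of these cells.\<close>

lemma grid_average:
  assumes B: "B \<in> sets M"
  shows "(\<Sum>s\<in>grid_index_set n. measure M (B \<inter> (\<tau> (grid_vector n s) -` cell_set n S \<inter> space M)))
    = real (card (grid_index_set n \<inter> S)) * measure M B"
proof -
  let ?I = "grid_index_set n" and ?C = "\<lambda>s. \<tau> (grid_vector n s) -` cell_set n S \<inter> space M"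
  have C: "?C s \<in> sets M" for s by (rule measurable_sets[OF tau_measurable cell_set_sets])
  have count: "(\<Sum>s\<in>?I. indicator (B \<inter> ?C s) g) = real (card (?I \<inter> S)) * indicator B g" for g :: 'g
  proof (cases "g \<in> B")
    case True
    then have g: "g \<in> space M" using B sets.sets_into_space by blast
    let ?h = "\<lambda>s p. (grid_index n (Z n g) p + s p) mod cells_per_axis n"
    have "(\<Sum>s\<in>?I. indicator (B \<inter> ?C s) g) = (\<Sum>s\<in>?I. indicator S (?h s) :: real)"
      using True g grid_index_translate[OF g]
      by (intro sum.cong refl) (simp add: indicator_def cell_set_def tau_space)
    also have "\<dots> = (\<Sum>s\<in>?I. indicator S s)"
      using sum.reindex_bij_betw[OF grid_shift_bij[of "grid_index n (Z n g)" n], of "indicator S :: _ \<Rightarrow> real"] .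
    also have "\<dots> = real (card (?I \<inter> S))" by (simp add: indicator_def finite_grid_index_set)
    finally show ?thesis using True by simp
  qed simp
  have "(\<Sum>s\<in>?I. measure M (B \<inter> ?C s)) = (\<Sum>s\<in>?I. \<integral>g. indicator (B \<inter> ?C s) g \<partial>M)"
    using B C sets.sets_into_space by (intro sum.cong refl) (simp add: Int_absorb2)
  also have "\<dots> = (\<integral>g. (\<Sum>s\<in>?I. indicator (B \<inter> ?C s) g) \<partial>M)"
    using B C by (intro Bochner_Integration.integral_sum[symmetric]) (auto simp: less_top[symmetric])
  also have "\<dots> = (\<integral>g. real (card (?I \<inter> S)) * indicator B g \<partial>M)" by (simp only: count)
  also have "\<dots> = real (card (?I \<inter> S)) * measure M B"
    using B sets.sets_into_space by (simp add: Int_absorb2)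
  finally show ?thesis .
qed

text \<open>Let \<open>C\<close> be a set of cells close to the invariant set \<open>B\<close>. For every translation \<open>t\<close> of the grid,
  the measure of \<open>B \<inter> t\<^sup>-\<^sup>1 C\<close> is close to that of \<open>B \<inter> t\<^sup>-\<^sup>1 B\<close>, which is the measure \<open>b\<close> of \<open>B\<close>. The average
  of the former over \<open>t\<close> is \<open>b\<close> times the measure of \<open>C\<close> by \<open>grid_average\<close>, hence close to \<open>b * b\<close>.
  So \<open>b = b * b\<close>.\<close>

lemma translations_ergodic:
  assumes B: "B \<in> sets M" and inv: "\<And>z. measure M (sym_diff (\<tau> z -` B \<inter> space M) B) = 0"
  shows "measure M B = 0 \<or> measure M B = 1"
proof -
  let ?b = "measure M B"
  have "\<bar>?b * ?b - ?b\<bar> \<le> 2 * e" if "e > 0" for e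
  proof -
    obtain n S where near: "measure M (sym_diff B (cell_set n S)) < e"
      using cell_set_approximation[OF B \<open>e > 0\<close>] by blast
    let ?I = "grid_index_set n" and ?C = "cell_set n S"
    let ?T = "\<lambda>s A. \<tau> (grid_vector n s) -` A \<inter> space M"
    have T: "?T s A \<in> sets M" if "A \<in> sets M" for s A by (rule measurable_sets[OF tau_measurable that])
    note [measurable] = B T[OF cell_set_sets[of n S]] T[OF B]
    have "(\<lambda>_. 0) \<in> ?I" using cells_per_axis[of n] by (auto simp: grid_index_set_def)
    then have I: "card ?I > 0" using finite_grid_index_set[of n] card_gt_0_iff by blast
    have diff: "\<bar>measure M A - measure M A'\<bar> \<le> measure M (sym_diff A A')"
      if [measurable]: "A \<in> sets M" "A' \<in> sets M" for A A'
    proof -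
      have "measure M A \<le> measure M (A' \<union> sym_diff A A')" "measure M A' \<le> measure M (A \<union> sym_diff A A')"
        by (auto intro!: finite_measure_mono)
      moreover have "measure M (A' \<union> sym_diff A A') \<le> measure M A' + measure M (sym_diff A A')"
        "measure M (A \<union> sym_diff A A') \<le> measure M A + measure M (sym_diff A A')"
        by (auto intro!: measure_Un_le)
      ultimately show ?thesis by linarith
    qed
    have each: "\<bar>measure M (B \<inter> ?T s ?C) - ?b\<bar> \<le> e" for s
    proof -
      have "\<bar>measure M (B \<inter> ?T s ?C) - ?b\<bar> \<le> measure M (sym_diff (B \<inter> ?T s ?C) B)"
        by (intro diff) auto
      also have "\<dots> \<le> measure M (?T s (sym_diff B ?C) \<union> sym_diff (?T s B) B)"
        using B sets.sets_into_space by (intro finite_measure_mono) (auto intro!: T)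
      also have "\<dots> \<le> measure M (?T s (sym_diff B ?C)) + measure M (sym_diff (?T s B) B)"
        by (intro measure_Un_le T) auto
      also have "\<dots> = measure M (sym_diff B ?C)"
        using measure_tau_vimage[of "sym_diff B ?C"] inv by simp
      finally show ?thesis using near by simp
    qed
    have whole: "real (card ?I) * measure M ?C = real (card (?I \<inter> S))"
    proof -
      have "(\<Sum>s\<in>?I. measure M (space M \<inter> ?T s ?C)) = (\<Sum>s\<in>?I. measure M ?C)"
        using measure_tau_vimage[OF cell_set_sets[of n S]] by (intro sum.cong refl) (simp add: Int_absorb1)
      then show ?thesis using grid_average[OF sets.top, of n S] by (simp add: prob_space)
    qed
    have "(\<Sum>s\<in>?I. measure M (B \<inter> ?T s ?C)) - real (card ?I) * ?b = (\<Sum>s\<in>?I. measure M (B \<inter> ?T s ?C) - ?b)"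
      by (simp add: sum_subtractf)
    also have "\<bar>\<dots>\<bar> \<le> (\<Sum>s\<in>?I. \<bar>measure M (B \<inter> ?T s ?C) - ?b\<bar>)" by (rule sum_abs)
    also have "\<dots> \<le> (\<Sum>s\<in>?I. e)" by (intro sum_mono each)
    finally have "\<bar>real (card (?I \<inter> S)) * ?b - real (card ?I) * ?b\<bar> \<le> real (card ?I) * e"
      unfolding grid_average[OF B] by simp
    then have "real (card ?I) * \<bar>measure M ?C * ?b - ?b\<bar> \<le> real (card ?I) * e"
      unfolding whole[symmetric] by (simp add: abs_mult right_diff_distrib[symmetric] mult.assoc)
    then have 1: "\<bar>measure M ?C * ?b - ?b\<bar> \<le> e" using I by simp
    have "\<bar>?b - measure M ?C\<bar> * ?b \<le> e * 1"
      using diff[OF B cell_set_sets[of n S]] near by (intro mult_mono) auto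
    then have "\<bar>?b * ?b - measure M ?C * ?b\<bar> \<le> e"
      by (simp add: left_diff_distrib[symmetric] abs_mult)
    with 1 show ?thesis by linarith
  qed
  then have half: "\<bar>?b * ?b - ?b\<bar> \<le> 2 * e" if "e > 0" for e using that .
  have "\<bar>?b * ?b - ?b\<bar> \<le> 0"
  proof (rule field_le_epsilon)
    fix e :: real assume "e > 0"
    then show "\<bar>?b * ?b - ?b\<bar> \<le> 0 + e" using half[of "e / 2"] by (simp del: abs_le_iff)
  qed
  then have "?b * (?b - 1) = 0" by (simp add: algebra_simps)
  then show ?thesis by simp
qed


subsection \<open>The induced measure on entire functions\<close>

text \<open>The map \<open>\<Phi>\<close> that sends a point to its entire function intertwines \<open>\<tau>\<close> with \<open>translate\<close> almost
  everywhere. Invariance and ergodicity of the image measure are pulled back along it.\<close>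

lemma universal_entire_function:
  "\<exists>F :: 'g \<Rightarrow> complex. F \<in> borel_measurable M \<and>
     (AE g in M. (\<lambda>z. F (\<tau> z g)) \<in> universal_functions) \<and>
     (\<exists>\<nu>. ae_push_forward M entire_topology (\<lambda>g z. F (\<tau> z g)) \<nu> \<and>
        ergodic_measure entire_topology translate \<nu> \<and> (AE f in \<nu>. f \<in> universal_functions))"
proof -
  let ?E = "borel_of (entire_topology :: (complex ^ 'd \<Rightarrow> complex) topology)"
  obtain q :: "nat \<Rightarrow> complex ^ 'd \<Rightarrow> complex" where q: "\<And>n. q n \<in> entire_functions"
    and dense: "\<And>f B e. f \<in> entire_functions \<Longrightarrow> e > 0 \<Longrightarrow> \<exists>n. \<forall>w\<in>cball 0 B. norm (q n w - f w) < e"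
    using entire_dense_sequence by blast
  define W where "W = {f \<in> entire_functions. \<forall>n N m. \<exists>z. \<forall>w\<in>cball 0 (real N). norm (f (w + z) - q n w) < 1 / real (Suc m)}"
  have W: "W \<in> sets ?E" "W \<subseteq> universal_functions"
    by (rule universal_functions_Borel_core[of q, folded W_def], fact q, fact dense)+
  \<comment> \<open>with this enumeration every \<open>q n\<close> is copied at infinitely many levels\<close>
  obtain P where P: "coherent (\<lambda>n. q (fst (prod_decode n))) P" using coherent_exists q by metis
  define F where "F = limit_function P"
  have F [measurable]: "F \<in> borel_measurable M" unfolding F_def by (rule limit_function_measurable[OF P])
  define good where "good g \<longleftrightarrow> eventually (\<lambda>n. deep n g) sequentially" for g
  have good [measurable]: "Measurable.pred M good" unfolding good_def[abs_def] eventually_sequentially by measurable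
  have AE_good: "AE g in M. good g" unfolding good_def by (rule AE_eventually_deep)
  have in_W: "(\<lambda>z. F (\<tau> z g)) \<in> W" if g: "g \<in> space M" "good g" for g
    unfolding W_def
  proof (intro CollectI conjI allI)
    show "(\<lambda>z. F (\<tau> z g)) \<in> entire_functions"
      unfolding F_def using limit_function_entire[OF P g(1)] g(2) unfolding good_def by blast
    fix n N m :: nat
    obtain k0 where k0: "\<And>k. k \<ge> k0 \<Longrightarrow> \<exists>z. \<forall>w\<in>cball 0 (real N).
        norm (F (\<tau> (w + z) g) - q (fst (prod_decode k)) w) < 2 * (1 / 2) ^ k"
      using limit_function_visits[OF P g(1), of "real N"] g(2)
      unfolding good_def eventually_sequentially F_def by blast
    define \<epsilon> where "\<epsilon> = 1 / real (Suc m)"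
    obtain k1 where k1: "(1 / 2) ^ k1 < \<epsilon> / 2"
      using real_arch_pow_inv[of "\<epsilon> / 2" "1/2"] by (auto simp: \<epsilon>_def)
    define k where "k = prod_encode (n, max k0 k1)"
    have k: "k \<ge> k0" "k \<ge> k1" using le_prod_encode_2[of "max k0 k1" n] by (auto simp: k_def)
    have "(1 / 2 :: real) ^ k \<le> (1 / 2) ^ k1" using k by (intro power_decreasing) auto
    with k1 have small: "2 * (1 / 2 :: real) ^ k < 1 / real (Suc m)" unfolding \<epsilon>_def[symmetric] by linarith
    have "fst (prod_decode k) = n" by (simp add: k_def)
    with k0[OF k(1)] show "\<exists>z. \<forall>w\<in>cball 0 (real N). norm (F (\<tau> (w + z) g) - q n w) < 1 / real (Suc m)"
      using small by (metis order.strict_trans)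
  qed
  define \<Phi> where "\<Phi> g = (if good g then (\<lambda>z. F (\<tau> z g)) else (\<lambda>_. 0))" for g
  have \<Phi> [measurable]: "\<Phi> \<in> measurable M ?E"
  proof (rule measurable_into_entire)
    show "\<Phi> g \<in> entire_functions" if "g \<in> space M" for g
      using in_W[OF that] entire_const[of 0] unfolding \<Phi>_def W_def by auto
    fix w
    have "(\<lambda>g. if good g then F (\<tau> w g) else 0) \<in> borel_measurable M" by measurable
    then show "(\<lambda>g. \<Phi> g w) \<in> borel_measurable M" by (simp add: \<Phi>_def if_distrib[of "\<lambda>f. f w"])
  qed
  define \<nu> where "\<nu> = distr M ?E \<Phi>"
  have AE_space: "AE g in M. g \<in> space M \<and> good g" using AE_good AE_space by eventually_elim simp
  have AE_\<Phi>: "AE g in M. (\<lambda>z. F (\<tau> z g)) = \<Phi> g" using AE_good by eventually_elim (simp add: \<Phi>_def)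
  interpret \<nu>: prob_space \<nu> unfolding \<nu>_def by (rule prob_space_distr[OF \<Phi>])
  have equivariant: "AE g in M. translate z (\<Phi> g) = \<Phi> (\<tau> z g)" for z
  proof -
    have "AE g in distr M M (\<tau> z). good g" unfolding tau_preserves by (rule AE_good)
    then have "AE g in M. good (\<tau> z g)" by (rule AE_distrD[OF tau_measurable])
    with AE_space show ?thesis
      by eventually_elim (simp add: \<Phi>_def translate_def tau_tau)
  qed
  have sets_\<nu>: "sets \<nu> = sets ?E" and space_\<nu>: "space \<nu> = space ?E" by (simp_all add: \<nu>_def)
  have tr [measurable]: "translate z \<in> measurable ?E ?E" for z by (rule measurable_translate)
  have em: "emeasure \<nu> A = emeasure M (\<Phi> -` A \<inter> space M)" if "A \<in> sets ?E" for A
    unfolding \<nu>_def by (rule emeasure_distr[OF \<Phi> that])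
  have pull: "\<Phi> -` A \<inter> space M \<in> sets M" if "A \<in> sets ?E" for A by (rule measurable_sets[OF \<Phi> that])
  have vim: "translate z -` A \<inter> space ?E \<in> sets ?E" if "A \<in> sets ?E" for z A by (rule measurable_sets[OF tr that])
  have Phi_space: "\<Phi> g \<in> space ?E" if "g \<in> space M" for g using measurable_space[OF \<Phi> that] .
  have "ergodic_measure entire_topology translate \<nu>"
    unfolding ergodic_measure_def
  proof (intro conjI allI ballI impI)
    show "sets \<nu> = sets ?E" by (rule sets_\<nu>)
    show "prob_space \<nu>" by (rule \<nu>.prob_space_axioms)
    show "translate z \<in> measurable \<nu> \<nu>" for z using tr measurable_cong_sets[OF sets_\<nu> sets_\<nu>] by simp
    fix A assume "A \<in> sets \<nu>"
    then have A: "A \<in> sets ?E" by (simp add: sets_\<nu>)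
    show "emeasure \<nu> (translate z -` A \<inter> space \<nu>) = emeasure \<nu> A" for z
    proof -
      have "emeasure \<nu> (translate z -` A \<inter> space \<nu>) = emeasure M (\<Phi> -` (translate z -` A \<inter> space ?E) \<inter> space M)"
        unfolding space_\<nu> by (rule em[OF vim[OF A]])
      also have "\<dots> = emeasure M (\<tau> z -` (\<Phi> -` A \<inter> space M) \<inter> space M)"
      proof (rule emeasure_eq_AE)
        show "AE g in M. (g \<in> \<Phi> -` (translate z -` A \<inter> space ?E) \<inter> space M) =
            (g \<in> \<tau> z -` (\<Phi> -` A \<inter> space M) \<inter> space M)"
          using equivariant[of z] AE_space
          by eventually_elim (simp add: Phi_space tau_space)
      qed (intro pull vim A measurable_sets[OF tau_measurable])+
      also have "\<dots> = emeasure (distr M M (\<tau> z)) (\<Phi> -` A \<inter> space M)"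
        by (rule emeasure_distr[symmetric, OF tau_measurable pull[OF A]])
      also have "\<dots> = emeasure \<nu> A" by (simp add: tau_preserves em[OF A])
      finally show ?thesis .
    qed
    assume inv: "\<forall>z. emeasure \<nu> (sym_diff (translate z -` A \<inter> space \<nu>) A) = 0"
    let ?B = "\<Phi> -` A \<inter> space M"
    have "measure M (sym_diff (\<tau> z -` ?B \<inter> space M) ?B) = 0" for z
    proof -
      let ?D = "sym_diff (translate z -` A \<inter> space ?E) A"
      have D: "?D \<in> sets ?E" using vim[OF A] A by blast
      have "emeasure M (\<Phi> -` ?D \<inter> space M) = 0"
        using inv[rule_format, of z] em[OF D] by (simp add: space_\<nu>)
      moreover have "emeasure M (sym_diff (\<tau> z -` ?B \<inter> space M) ?B) = emeasure M (\<Phi> -` ?D \<inter> space M)"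
      proof (rule emeasure_eq_AE)
        show "AE g in M. (g \<in> sym_diff (\<tau> z -` ?B \<inter> space M) ?B) = (g \<in> \<Phi> -` ?D \<inter> space M)"
          using equivariant[of z] AE_space
          by eventually_elim (auto simp: Phi_space tau_space)
      qed (use pull[OF A] pull[OF D] measurable_sets[OF tau_measurable pull[OF A]] in blast)+
      ultimately show ?thesis by (simp add: measure_def)
    qed
    from translations_ergodic[OF pull[OF A] this]
    show "emeasure \<nu> A = 0 \<or> emeasure \<nu> A = 1"
      unfolding em[OF A] emeasure_eq_measure by auto
  qed
  moreover have "AE f in \<nu>. f \<in> universal_functions"
  proof -
    have "AE f in \<nu>. f \<in> W"
      unfolding \<nu>_def
    proof (subst AE_distr_iff[OF \<Phi>])
      show "{f \<in> space ?E. f \<in> W} \<in> sets ?E"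
        using W(1) sets.sets_into_space[OF W(1)] by (simp add: Collect_conj_eq Int_absorb1)
      show "AE g in M. \<Phi> g \<in> W" using AE_space by eventually_elim (simp add: \<Phi>_def in_W)
    qed
    then show ?thesis by eventually_elim (use W(2) in blast)
  qed
  moreover have "AE g in M. (\<lambda>z. F (\<tau> z g)) \<in> universal_functions"
    using AE_space by eventually_elim (use in_W W(2) in blast)
  moreover have "ae_push_forward M entire_topology (\<lambda>g z. F (\<tau> z g)) \<nu>"
    unfolding ae_push_forward_def using \<Phi> AE_\<Phi> \<nu>_def by blast
  ultimately show ?thesis using F by blast
qed

end


section \<open>The solenoid\<close>

definition reduce_complex :: "real \<Rightarrow> complex \<Rightarrow> complex" where
  "reduce_complex R z = Complex (reduce R (Re z)) (reduce R (Im z))"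

lemma reduce_complex_simps [simp]:
  "Re (reduce_complex R z) = reduce R (Re z)" "Im (reduce_complex R z) = reduce R (Im z)"
  by (simp_all add: reduce_complex_def)

lemma reduce_eq_iff:
  assumes "R > 0"
  shows "reduce R x = reduce R y \<longleftrightarrow> (\<exists>k. x = y + R * of_int k)"
proof
  assume "reduce R x = reduce R y"
  then have "x = y + R * of_int (\<lfloor>x / R\<rfloor> - \<lfloor>y / R\<rfloor>)" by (simp add: reduce_def algebra_simps)
  then show "\<exists>k. x = y + R * of_int k" by blast
next
  assume "\<exists>k. x = y + R * of_int k"
  then obtain k where k: "x = y + R * of_int k" by blast
  have "reduce R (reduce R y + R * of_int (\<lfloor>y / R\<rfloor> + k)) = reduce R y"
    by (rule reduce_unique[OF assms reduce_range[OF assms]])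
  then show "reduce R x = reduce R y" by (simp add: k reduce_def algebra_simps)
qed

text \<open>At the multiples of \<open>R\<close> the function \<open>reduce R\<close> drops to \<open>0\<close>, its least value; so it is lower semicontinuous.\<close>

lemma open_reduce_greater:
  assumes "R > 0"
  shows "open {x. reduce R x > c}"
proof (cases "c < 0")
  case True
  then have "reduce R x > c" for x using reduce_range[OF assms, of x] by auto
  then have "{x. reduce R x > c} = UNIV" by blast
  then show ?thesis by simp
next
  case False
  have "{x. reduce R x > c} = (\<Union>k::int. {of_int k * R + c<..<of_int k * R + R})"
  proof (intro equalityI subsetI)
    fix x assume "x \<in> {x. reduce R x > c}"
    then show "x \<in> (\<Union>k::int. {of_int k * R + c<..<of_int k * R + R})"
      using reduce_range[OF assms, of x] by (intro UN_I[of "\<lfloor>x / R\<rfloor>"]) (auto simp: reduce_def algebra_simps)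
  next
    fix x assume "x \<in> (\<Union>k::int. {of_int k * R + c<..<of_int k * R + R})"
    then obtain k :: int where k: "of_int k * R + c < x" "x < of_int k * R + R" by auto
    have "reduce R ((x - of_int k * R) + R * of_int k) = x - of_int k * R"
      using k False by (intro reduce_unique assms) auto
    then show "x \<in> {x. reduce R x > c}" using k by (simp add: mult.commute)
  qed
  then show ?thesis by auto
qed

locale solenoid_tower =
  fixes r :: "nat \<Rightarrow> nat"
  assumes r_pos: "\<And>n. n \<ge> 1 \<Longrightarrow> r n > 0"
begin

abbreviation R :: "nat \<Rightarrow> real" where "R n \<equiv> real (Rprod r n)"

lemma Rprod_Suc: "Rprod r (Suc n) = r (Suc n) * Rprod r n"
  by (simp add: Rprod_def)

lemma R_pos: "R n > 0"
  using r_pos by (auto simp: Rprod_def intro!: prod_pos)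

lemma lattice_iff: "w \<in> lattice_subgroup r n \<longleftrightarrow> (\<exists>a b. w = Complex (R n * of_int a) (R n * of_int b))"
  by (auto simp: lattice_subgroup_def)

lemma lattice_zero: "0 \<in> lattice_subgroup r n"
  unfolding lattice_iff by (auto intro!: exI[of _ 0] simp: complex_eq_iff)

lemma lattice_add:
  assumes "v \<in> lattice_subgroup r n" "w \<in> lattice_subgroup r n"
  shows "v + w \<in> lattice_subgroup r n"
proof -
  obtain a b a' b' where "v = Complex (R n * of_int a) (R n * of_int b)" "w = Complex (R n * of_int a') (R n * of_int b')"
    using assms unfolding lattice_iff by blast
  then have "v + w = Complex (R n * of_int (a + a')) (R n * of_int (b + b'))"
    by (simp add: complex_eq_iff distrib_left)
  then show ?thesis unfolding lattice_iff by blast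
qed

lemma lattice_minus:
  assumes "v \<in> lattice_subgroup r n"
  shows "- v \<in> lattice_subgroup r n"
proof -
  obtain a b where "v = Complex (R n * of_int a) (R n * of_int b)" using assms unfolding lattice_iff by blast
  then have "- v = Complex (R n * of_int (- a)) (R n * of_int (- b))" by (simp add: complex_eq_iff)
  then show ?thesis unfolding lattice_iff by blast
qed

lemma lattice_Suc: "v \<in> lattice_subgroup r (Suc n) \<Longrightarrow> v \<in> lattice_subgroup r n"
proof -
  assume "v \<in> lattice_subgroup r (Suc n)"
  then obtain a b where "v = Complex (R (Suc n) * of_int a) (R (Suc n) * of_int b)" unfolding lattice_iff by blast
  then have "v = Complex (R n * of_int (int (r (Suc n)) * a)) (R n * of_int (int (r (Suc n)) * b))"
    by (simp add: Rprod_Suc algebra_simps)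
  then show ?thesis unfolding lattice_iff by blast
qed

lemma torus_coset_eq: "torus_coset r n z = {l + z | l. l \<in> lattice_subgroup r n}"
  by (auto simp: torus_coset_def r_coset_def cadd_def)

lemma torus_coset_eq_iff: "torus_coset r n z = torus_coset r n w \<longleftrightarrow> z - w \<in> lattice_subgroup r n"
proof
  assume "torus_coset r n z = torus_coset r n w"
  moreover have "z \<in> torus_coset r n z" unfolding torus_coset_eq using lattice_zero by force
  ultimately obtain l where "l \<in> lattice_subgroup r n" "z = l + w" unfolding torus_coset_eq by blast
  then show "z - w \<in> lattice_subgroup r n" by simp
next
  assume l: "z - w \<in> lattice_subgroup r n"
  have "l' + z = (l' + (z - w)) + w" "l' + w = (l' + - (z - w)) + z" for l' by simp_all
  then show "torus_coset r n z = torus_coset r n w"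
    unfolding torus_coset_eq using lattice_add[OF _ l] lattice_add[OF _ lattice_minus[OF l]] by blast
qed

lemma torus_coset_eq_iff_reduce:
  "torus_coset r n z = torus_coset r n w \<longleftrightarrow> reduce_complex (R n) z = reduce_complex (R n) w"
proof -
  have "z - w \<in> lattice_subgroup r n \<longleftrightarrow> (\<exists>a. Re z = Re w + R n * of_int a) \<and> (\<exists>b. Im z = Im w + R n * of_int b)"
    unfolding lattice_iff by (auto simp: complex_eq_iff algebra_simps)
  then show ?thesis
    by (simp add: torus_coset_eq_iff complex_eq_iff reduce_eq_iff[OF R_pos])
qed

lemma carrier_torus: "carrier (torus r n) = range (torus_coset r n)"
  by (auto simp: torus_def FactGroup_def RCOSETS_def cadd_def torus_coset_def)

lemma torus_mult: "torus_coset r n z \<otimes>\<^bsub>torus r n\<^esub> torus_coset r n w = torus_coset r n (z + w)"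
proof -
  have eq: "torus_coset r n z \<otimes>\<^bsub>torus r n\<^esub> torus_coset r n w
      = {(l + z) + (l' + w) | l l'. l \<in> lattice_subgroup r n \<and> l' \<in> lattice_subgroup r n}"
    by (auto simp: torus_def FactGroup_def set_mult_def cadd_def torus_coset_eq)
  show ?thesis
    unfolding eq
  proof (intro equalityI subsetI)
    fix v assume "v \<in> {(l + z) + (l' + w) | l l'. l \<in> lattice_subgroup r n \<and> l' \<in> lattice_subgroup r n}"
    then obtain l l' where l: "l \<in> lattice_subgroup r n" "l' \<in> lattice_subgroup r n" "v = (l + l') + (z + w)"
      by (auto simp: algebra_simps)
    then show "v \<in> torus_coset r n (z + w)" using lattice_add[OF l(1,2)] unfolding torus_coset_eq by blast
  next
    fix v assume "v \<in> torus_coset r n (z + w)"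
    then obtain l where "l \<in> lattice_subgroup r n" "v = (l + z) + (0 + w)"
      unfolding torus_coset_eq by (auto simp: algebra_simps)
    then show "v \<in> {(l + z) + (l' + w) | l l'. l \<in> lattice_subgroup r n \<and> l' \<in> lattice_subgroup r n}"
      using lattice_zero by blast
  qed
qed

lemma torus_proj_coset: "torus_proj r n (torus_coset r (Suc n) z) = torus_coset r n z"
proof -
  have eq: "torus_proj r n (torus_coset r (Suc n) z)
      = {l + (l' + z) | l l'. l \<in> lattice_subgroup r n \<and> l' \<in> lattice_subgroup r (Suc n)}"
    by (auto simp: torus_proj_def set_mult_def cadd_def torus_coset_eq)
  show ?thesis
    unfolding eq
  proof (intro equalityI subsetI)
    fix v assume "v \<in> {l + (l' + z) | l l'. l \<in> lattice_subgroup r n \<and> l' \<in> lattice_subgroup r (Suc n)}"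
    then obtain l l' where l: "l \<in> lattice_subgroup r n" "l' \<in> lattice_subgroup r (Suc n)" "v = (l + l') + z"
      by (auto simp: algebra_simps)
    then show "v \<in> torus_coset r n z"
      using lattice_add[OF l(1) lattice_Suc[OF l(2)]] unfolding torus_coset_eq by blast
  next
    fix v assume "v \<in> torus_coset r n z"
    then obtain l where "l \<in> lattice_subgroup r n" "v = l + (0 + z)" unfolding torus_coset_eq by auto
    then show "v \<in> {l + (l' + z) | l l'. l \<in> lattice_subgroup r n \<and> l' \<in> lattice_subgroup r (Suc n)}"
      using lattice_zero by blast
  qed
qed

definition torus_rep :: "nat \<Rightarrow> complex set \<Rightarrow> complex" where
  "torus_rep n C = reduce_complex (R n) (SOME z. C = torus_coset r n z)"

lemma torus_rep_coset: "torus_rep n (torus_coset r n z) = reduce_complex (R n) z"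
proof -
  have "torus_coset r n z = torus_coset r n (SOME w. torus_coset r n z = torus_coset r n w)"
    by (rule someI) (rule refl)
  then show ?thesis unfolding torus_rep_def torus_coset_eq_iff_reduce by simp
qed

lemma torus_coset_reduce: "torus_coset r n (reduce_complex (R n) z) = torus_coset r n z"
  unfolding torus_coset_eq_iff_reduce
  using reduce_id[OF R_pos reduce_range[OF R_pos]] by (simp add: complex_eq_iff)

lemma torus_coset_rep: "C \<in> range (torus_coset r n) \<Longrightarrow> torus_coset r n (torus_rep n C) = C"
  by (auto simp: torus_rep_coset torus_coset_reduce)

lemma solenoid_carrier_iff:
  "x \<in> solenoid_carrier r \<longleftrightarrow> x \<in> extensional {1..} \<and> (\<forall>n\<ge>1. x n \<in> range (torus_coset r n))
     \<and> (\<forall>n\<ge>1. torus_proj r n (x (Suc n)) = x n)"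
  by (auto simp: solenoid_carrier_def carrier_torus PiE_def Pi_def)

lemma solenoid_level:
  assumes x: "x \<in> solenoid_carrier r" and "1 \<le> j" "j \<le> m"
  shows "x j = torus_coset r j (torus_rep m (x m))"
  using assms(3)
proof (induction m rule: dec_induct)
  case base
  then show ?case using x \<open>1 \<le> j\<close> torus_coset_rep[of "x j" j] by (simp add: solenoid_carrier_iff)
next
  case (step m)
  have "m \<ge> 1" using step \<open>1 \<le> j\<close> by simp
  define w where "w = torus_rep (Suc m) (x (Suc m))"
  have w: "x (Suc m) = torus_coset r (Suc m) w"
    using x torus_coset_rep[of "x (Suc m)" "Suc m"] by (simp add: solenoid_carrier_iff w_def)
  have "torus_proj r m (x (Suc m)) = x m" using x \<open>m \<ge> 1\<close> unfolding solenoid_carrier_iff by blast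
  then have "x m = torus_coset r m w" by (simp add: w torus_proj_coset)
  then have rep_eq: "torus_rep m (x m) = reduce_complex (R m) w" by (simp add: torus_rep_coset)
  have sub: "l \<in> lattice_subgroup r j" if "l \<in> lattice_subgroup r m" for l
    using \<open>j \<le> m\<close> that by (induction m rule: dec_induct) (auto dest: lattice_Suc)
  have "reduce_complex (R m) w - w \<in> lattice_subgroup r m"
    using torus_coset_reduce[of m w] unfolding torus_coset_eq_iff .
  then have "torus_coset r j (reduce_complex (R m) w) = torus_coset r j w"
    unfolding torus_coset_eq_iff by (rule sub)
  then show ?case using step.IH rep_eq by (simp add: w_def)
qed

text \<open>The index is shifted by one to match \<open>torus_tower\<close>, where \<open>Z n\<close> lives in the cube of
  side \<open>R (Suc n)\<close>.\<close>

definition coord :: "nat \<Rightarrow> (nat \<Rightarrow> complex set) \<Rightarrow> complex" where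
  "coord n x = torus_rep (Suc n) (x (Suc n))"

lemma coord_range: "Re (coord n x) \<in> {0..<R (Suc n)}" "Im (coord n x) \<in> {0..<R (Suc n)}"
  using reduce_range[OF R_pos] by (auto simp: coord_def torus_rep_def)

lemma coord_compat:
  assumes x: "x \<in> solenoid_carrier r"
  shows "coord n x = reduce_complex (R (Suc n)) (coord (Suc n) x)"
  unfolding coord_def using solenoid_level[OF x, of "Suc n" "Suc (Suc n)"] by (simp add: torus_rep_coset)

definition shift :: "complex \<Rightarrow> (nat \<Rightarrow> complex set) \<Rightarrow> nat \<Rightarrow> complex set" where
  "shift z x = x \<otimes>\<^bsub>solenoid r\<^esub> solenoid_diag r z"

lemma solenoid_mult: "x \<otimes>\<^bsub>solenoid r\<^esub> y = (\<lambda>n\<in>{1..}. x n \<otimes>\<^bsub>torus r n\<^esub> y n)"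
  by (simp add: solenoid_def product_group_def)

lemma shift_apply:
  assumes "x \<in> solenoid_carrier r" "n \<ge> 1"
  shows "shift z x n = torus_coset r n (torus_rep n (x n) + z)"
proof -
  have "shift z x n = x n \<otimes>\<^bsub>torus r n\<^esub> torus_coset r n z"
    using assms(2) by (simp add: shift_def solenoid_mult solenoid_diag_def)
  also have "x n = torus_coset r n (torus_rep n (x n))" using assms by (simp add: solenoid_carrier_iff torus_coset_rep)
  finally show ?thesis by (simp add: torus_mult[symmetric])
qed

lemma solenoid_diag_carrier: "solenoid_diag r z \<in> solenoid_carrier r"
  by (auto simp: solenoid_carrier_iff solenoid_diag_def torus_proj_coset)

lemma shift_carrier:
  assumes x: "x \<in> solenoid_carrier r"
  shows "shift z x \<in> solenoid_carrier r"
  unfolding solenoid_carrier_iff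
proof (intro conjI allI impI)
  show "shift z x \<in> extensional {1..}" by (simp add: shift_def solenoid_mult)
  fix n :: nat assume n: "1 \<le> n"
  show "shift z x n \<in> range (torus_coset r n)" using shift_apply[OF x n] by simp
  have "torus_coset r n (torus_rep (Suc n) (x (Suc n))) = torus_coset r n (torus_rep n (x n))"
    using solenoid_level[OF x n, of "Suc n"] solenoid_level[OF x n, of n] by simp
  then have "torus_coset r n (torus_rep (Suc n) (x (Suc n)) + z) = torus_coset r n (torus_rep n (x n) + z)"
    unfolding torus_coset_eq_iff by simp
  then show "torus_proj r n (shift z x (Suc n)) = shift z x n"
    using n by (simp add: shift_apply[OF x] torus_proj_coset)
qed

lemma coord_shift:
  assumes "x \<in> solenoid_carrier r"
  shows "coord n (shift z x) = reduce_complex (R (Suc n)) (coord n x + z)"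
  unfolding coord_def using shift_apply[OF assms, of "Suc n"] by (simp add: torus_rep_coset)

lemma solenoid_eqI:
  assumes "x \<in> solenoid_carrier r" "y \<in> solenoid_carrier r" "\<And>n. coord n x = coord n y"
  shows "x = y"
proof (rule extensionalityI)
  show "x \<in> extensional {1..}" "y \<in> extensional {1..}" using assms by (simp_all add: solenoid_carrier_iff)
  fix n :: nat assume "n \<in> {1..}"
  then obtain m where n: "n = Suc m" by (cases n) auto
  have "torus_coset r n (torus_rep n (x n)) = torus_coset r n (torus_rep n (y n))"
    using assms(3)[of m] by (simp add: coord_def n)
  then show "x n = y n" using assms(1,2) n by (simp add: solenoid_carrier_iff torus_coset_rep)
qed

lemma reduce_complex_add: "reduce_complex (R n) (reduce_complex (R n) z + w) = reduce_complex (R n) (z + w)"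
proof -
  have "torus_coset r n (reduce_complex (R n) z + w) = torus_coset r n (z + w)"
    using torus_coset_reduce[of n z] unfolding torus_coset_eq_iff by simp
  then show ?thesis unfolding torus_coset_eq_iff_reduce .
qed

lemma shift_shift:
  assumes "x \<in> solenoid_carrier r"
  shows "shift w (shift z x) = shift (w + z) x"
proof (rule solenoid_eqI)
  fix n
  show "coord n (shift w (shift z x)) = coord n (shift (w + z) x)"
    using assms by (simp add: coord_shift shift_carrier reduce_complex_add) (simp add: algebra_simps)
qed (intro shift_carrier assms)+

lemma shift_0: "x \<in> solenoid_carrier r \<Longrightarrow> shift 0 x = x"
proof (rule solenoid_eqI)
  fix n assume "x \<in> solenoid_carrier r"
  then show "coord n (shift 0 x) = coord n x"
    using coord_range[of n x] reduce_id[OF R_pos] by (simp add: coord_shift complex_eq_iff)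
qed (intro shift_carrier)

lemma shift_commute:
  assumes x: "x \<in> solenoid_carrier r"
  shows "solenoid_diag r z \<otimes>\<^bsub>solenoid r\<^esub> x = shift z x"
  unfolding shift_def solenoid_mult
proof (intro restrict_ext)
  fix n :: nat assume n: "n \<in> {1..}"
  then obtain w where "x n = torus_coset r n w" using x by (force simp: solenoid_carrier_iff)
  then show "solenoid_diag r z n \<otimes>\<^bsub>torus r n\<^esub> x n = x n \<otimes>\<^bsub>torus r n\<^esub> solenoid_diag r z n"
    using n by (simp add: solenoid_diag_def torus_mult add.commute)
qed


subsection \<open>Topology and Borel sets of the solenoid\<close>

lemma openin_torus:
  "openin (torus_topology r n) U \<longleftrightarrow> U \<subseteq> range (torus_coset r n) \<and> open {z. torus_coset r n z \<in> U}"
  by (simp add: torus_topology_def openin_quotient_topology)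

lemma topspace_torus: "topspace (torus_topology r n) = range (torus_coset r n)"
proof
  show "topspace (torus_topology r n) \<subseteq> range (torus_coset r n)"
    using openin_topspace[of "torus_topology r n"] unfolding openin_torus by blast
  have "openin (torus_topology r n) (range (torus_coset r n))" by (simp add: openin_torus)
  then show "range (torus_coset r n) \<subseteq> topspace (torus_topology r n)" by (rule openin_subset)
qed

lemma topspace_solenoid: "topspace (solenoid_topology r) = solenoid_carrier r"
  by (auto simp: solenoid_topology_def topspace_torus solenoid_carrier_iff PiE_def Pi_def)

lemma openin_solenoid_level:
  assumes n: "n \<ge> 1" and U: "openin (torus_topology r n) U"
  shows "openin (solenoid_topology r) {x \<in> solenoid_carrier r. x n \<in> U}"
proof -
  have "continuous_map (solenoid_topology r) (torus_topology r n) (\<lambda>x. x n)"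
    unfolding solenoid_topology_def
    by (intro continuous_map_from_subtopology continuous_map_product_projection) (use n in simp)
  from openin_continuous_map_preimage[OF this U] show ?thesis by (simp add: topspace_solenoid)
qed

lemma coord_measurable:
  assumes sets: "sets M = sets (borel_of (solenoid_topology r))"
  shows "coord n \<in> borel_measurable M"
proof -
  have space: "space M = solenoid_carrier r"
    using sets_eq_imp_space_eq[OF sets] by (simp add: space_borel_of topspace_solenoid)
  have half: "{x \<in> space M. c < p (coord n x)} \<in> sets M"
    if p: "\<And>z. p (reduce_complex (R (Suc n)) z) = reduce (R (Suc n)) (p z)" "continuous_on UNIV p" for p :: "complex \<Rightarrow> real" and c
  proof -
    let ?U = "{C \<in> range (torus_coset r (Suc n)). c < p (torus_rep (Suc n) C)}"
    have "{z. torus_coset r (Suc n) z \<in> ?U} = p -` {x. c < reduce (R (Suc n)) x}"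
      by (auto simp: torus_rep_coset p(1))
    moreover have "open \<dots>" by (intro open_vimage p(2) open_reduce_greater R_pos)
    ultimately have "openin (torus_topology r (Suc n)) ?U" by (simp add: openin_torus)
    from openin_solenoid_level[OF _ this]
    have "{x \<in> solenoid_carrier r. x (Suc n) \<in> ?U} \<in> sets M"
      unfolding sets by (intro openin_borel_of) simp
    also have "{x \<in> solenoid_carrier r. x (Suc n) \<in> ?U} = {x \<in> space M. c < p (coord n x)}"
      by (auto simp: space coord_def solenoid_carrier_iff)
    finally show ?thesis .
  qed
  have "(\<lambda>x. Re (coord n x)) \<in> borel_measurable M" "(\<lambda>x. Im (coord n x)) \<in> borel_measurable M"
    unfolding borel_measurable_iff_greater by (auto intro!: half continuous_intros)
  then show ?thesis by (simp add: borel_measurable_complex_iff)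
qed

definition cell :: "nat \<Rightarrow> int \<times> int \<Rightarrow> (nat \<Rightarrow> complex set) set" where
  "cell n s = {x \<in> solenoid_carrier r. (\<lfloor>2 ^ n * Re (coord n x)\<rfloor>, \<lfloor>2 ^ n * Im (coord n x)\<rfloor>) = s}"

text \<open>A basic neighbourhood restricts finitely many levels. The coordinate at one high level
  determines all of them, and since the restrictions are invariant under the
  lattices, a small cell at that level satisfies each of them.\<close>

lemma cells_form_basis:
  assumes U: "openin (solenoid_topology r) U" and x: "x \<in> U"
  shows "\<exists>n s. x \<in> cell n s \<and> cell n s \<subseteq> U"
proof -
  have xc: "x \<in> solenoid_carrier r" using U x openin_subset topspace_solenoid by blast
  obtain T where T: "openin (product_topology (torus_topology r) {1..}) T" "U = T \<inter> solenoid_carrier r"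
    using U unfolding solenoid_topology_def openin_subtopology by blast
  have xT: "x \<in> T" using x T(2) by blast
  obtain V where V: "finite {i \<in> {1..}. V i \<noteq> topspace (torus_topology r i)}"
    "\<And>i. i \<in> {1..} \<Longrightarrow> openin (torus_topology r i) (V i)" "x \<in> PiE {1..} V" "PiE {1..} V \<subseteq> T"
    using T(1)[unfolded openin_product_topology_alt, rule_format, OF xT] by blast
  define J where "J = {i \<in> {1..}. V i \<noteq> topspace (torus_topology r i)}"
  have J: "finite J" "\<And>j. j \<in> J \<Longrightarrow> 1 \<le> j" using V(1) by (auto simp: J_def)
  have "\<exists>e>0. ball (torus_rep j (x j)) e \<subseteq> {z. torus_coset r j z \<in> V j}" if "j \<in> J" for j
  proof -
    have "open {z. torus_coset r j z \<in> V j}" using V(2)[of j] J(2)[OF that] by (simp add: openin_torus)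
    moreover have "x j \<in> V j" using V(3) J(2)[OF that] by auto
    then have "torus_rep j (x j) \<in> {z. torus_coset r j z \<in> V j}"
      using torus_coset_rep[of "x j" j] xc J(2)[OF that] by (simp add: solenoid_carrier_iff)
    ultimately show ?thesis by (meson openE)
  qed
  then obtain e where e: "\<And>j. j \<in> J \<Longrightarrow> e j > 0"
    "\<And>j. j \<in> J \<Longrightarrow> ball (torus_rep j (x j)) (e j) \<subseteq> {z. torus_coset r j z \<in> V j}" by metis
  define \<epsilon> where "\<epsilon> = Min (insert 1 (e ` J))"
  have \<epsilon>: "\<epsilon> > 0" "\<And>j. j \<in> J \<Longrightarrow> \<epsilon> \<le> e j" using J(1) e(1) by (auto simp: \<epsilon>_def)
  obtain n0 where n0: "(1 / 2) ^ n0 < \<epsilon> / 2" using real_arch_pow_inv[of "\<epsilon> / 2" "1/2"] \<epsilon> by auto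
  define n where "n = Max (insert n0 J)"
  have n: "n \<ge> n0" "\<And>j. j \<in> J \<Longrightarrow> j \<le> n" using J(1) by (auto simp: n_def)
  have "(1 / 2 :: real) ^ n \<le> (1 / 2) ^ n0" using n by (intro power_decreasing) auto
  with n0 have small: "2 * (1 / 2) ^ n < \<epsilon>" by linarith
  define s where "s = (\<lfloor>2 ^ n * Re (coord n x)\<rfloor>, \<lfloor>2 ^ n * Im (coord n x)\<rfloor>)"
  have "cell n s \<subseteq> U"
  proof
    fix y assume y: "y \<in> cell n s"
    then have yc: "y \<in> solenoid_carrier r" by (simp add: cell_def)
    have close: "norm (coord n y - coord n x) < \<epsilon>"
    proof -
      have near: "\<bar>u - v\<bar> < (1 / 2) ^ n" if "\<lfloor>2 ^ n * u\<rfloor> = \<lfloor>2 ^ n * v\<rfloor>" for u v :: real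
      proof -
        have "\<bar>2 ^ n * u - 2 ^ n * v\<bar> < 1" using that by linarith
        then have "2 ^ n * \<bar>u - v\<bar> < 1" by (simp add: right_diff_distrib[symmetric] abs_mult)
        then show ?thesis by (simp add: field_simps)
      qed
      have "\<bar>Re (coord n y - coord n x)\<bar> < (1 / 2) ^ n" "\<bar>Im (coord n y - coord n x)\<bar> < (1 / 2) ^ n"
        using y near by (auto simp: cell_def s_def)
      then show ?thesis using cmod_le[of "coord n y - coord n x"] small by linarith
    qed
    have "y j \<in> V j" if j: "1 \<le> j" for j
    proof (cases "j \<in> J")
      case False
      then have "V j = range (torus_coset r j)" using j by (simp add: J_def topspace_torus)
      then show ?thesis using yc j by (simp add: solenoid_carrier_iff)
    next
      case True
      have jn: "j \<le> Suc n" using n(2)[OF True] by simp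
      define l where "l = coord n x - torus_rep j (x j)"
      have "torus_coset r j (coord n x) = torus_coset r j (torus_rep j (x j))"
        using solenoid_level[OF xc j jn] solenoid_level[OF xc j order_refl] by (simp add: coord_def)
      then have l: "l \<in> lattice_subgroup r j" unfolding torus_coset_eq_iff l_def .
      have "coord n y - l \<in> ball (torus_rep j (x j)) (e j)"
        using close \<epsilon>(2)[OF True] by (simp add: dist_norm l_def norm_minus_commute algebra_simps)
      then have "torus_coset r j (coord n y - l) \<in> V j" using e(2)[OF True] by blast
      moreover have "torus_coset r j (coord n y - l) = torus_coset r j (coord n y)"
        unfolding torus_coset_eq_iff using lattice_minus[OF l] by simp
      ultimately show ?thesis using solenoid_level[OF yc j jn] by (simp add: coord_def)
    qed
    moreover have "y \<in> extensional {1..}" using yc by (simp add: solenoid_carrier_iff)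
    ultimately have "y \<in> PiE {1..} V" by (auto simp: PiE_def)
    then show "y \<in> U" using V(4) T(2) yc by blast
  qed
  moreover have "x \<in> cell n s" using xc by (simp add: cell_def s_def)
  ultimately show ?thesis by blast
qed

lemma sets_solenoid_cells:
  assumes sets: "sets M = sets (borel_of (solenoid_topology r))"
  shows "sets M = sigma_sets (solenoid_carrier r) {cell n s | n s. True}"
proof
  have space: "space M = solenoid_carrier r"
    using sets_eq_imp_space_eq[OF sets] by (simp add: space_borel_of topspace_solenoid)
  show "sigma_sets (solenoid_carrier r) {cell n s | n s. True} \<subseteq> sets M"
  proof (unfold space[symmetric], rule sets.sigma_sets_subset, safe)
    fix n s
    note [measurable] = coord_measurable[OF sets]
    have "{x \<in> space M. \<lfloor>2 ^ n * Re (coord n x)\<rfloor> = fst s \<and> \<lfloor>2 ^ n * Im (coord n x)\<rfloor> = snd s} \<in> sets M"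
      by measurable
    then show "cell n s \<in> sets M" by (simp add: cell_def space prod_eq_iff)
  qed
  interpret sigma_algebra "solenoid_carrier r" "sigma_sets (solenoid_carrier r) {cell n s | n s. True}"
    by (rule sigma_algebra_sigma_sets) (auto simp: cell_def)
  show "sets M \<subseteq> sigma_sets (solenoid_carrier r) {cell n s | n s. True}"
    unfolding sets sets_borel_of topspace_solenoid
  proof (rule sigma_sets_mono, safe)
    fix U assume U: "openin (solenoid_topology r) U"
    have "U = (\<Union>p\<in>{p. cell (fst p) (snd p) \<subseteq> U}. cell (fst p) (snd p))"
    proof (intro equalityI subsetI)
      fix x assume "x \<in> U"
      then obtain n s where "x \<in> cell n s" "cell n s \<subseteq> U" using cells_form_basis[OF U] by blast
      then show "x \<in> (\<Union>p\<in>{p. cell (fst p) (snd p) \<subseteq> U}. cell (fst p) (snd p))"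
        by (intro UN_I[of "(n, s)"]) auto
    qed blast
    also have "\<dots> \<in> sigma_sets (solenoid_carrier r) {cell n s | n s. True}"
      by (intro countable_UN' countableI_type image_subsetI) auto
    finally show "U \<in> sigma_sets (solenoid_carrier r) {cell n s | n s. True}" .
  qed
qed

lemma reduce_complex_measurable [measurable]: "reduce_complex c \<in> borel_measurable borel"
  unfolding borel_measurable_complex_iff reduce_complex_simps reduce_def by measurable

lemma shift_measurable:
  assumes sets: "sets M = sets (borel_of (solenoid_topology r))"
  shows "shift z \<in> measurable M M"
proof (rule measurable_sigma_sets[OF sets_solenoid_cells[OF sets]])
  have space: "space M = solenoid_carrier r"
    using sets_eq_imp_space_eq[OF sets] by (simp add: space_borel_of topspace_solenoid)
  show "{cell n s | n s. True} \<subseteq> Pow (solenoid_carrier r)" by (auto simp: cell_def)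
  show "shift z \<in> space M \<rightarrow> solenoid_carrier r" using shift_carrier by (simp add: space)
  fix A assume "A \<in> {cell n s | n s. True}"
  then obtain n s where A: "A = cell n s" by blast
  note [measurable] = coord_measurable[OF sets]
  have "{x \<in> space M. \<lfloor>2 ^ n * Re (reduce_complex (R (Suc n)) (coord n x + z))\<rfloor> = fst s \<and>
      \<lfloor>2 ^ n * Im (reduce_complex (R (Suc n)) (coord n x + z))\<rfloor> = snd s} \<in> sets M"
    by measurable
  also have "{x \<in> space M. \<lfloor>2 ^ n * Re (reduce_complex (R (Suc n)) (coord n x + z))\<rfloor> = fst s \<and>
      \<lfloor>2 ^ n * Im (reduce_complex (R (Suc n)) (coord n x + z))\<rfloor> = snd s} = shift z -` A \<inter> space M"
    by (auto simp: A cell_def space prod_eq_iff coord_shift shift_carrier)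
  finally show "shift z -` A \<inter> space M \<in> sets M" .
qed

lemma shift_preserves:
  assumes haar: "haar_prob_measure (solenoid r) (solenoid_topology r) \<rho>"
  shows "distr \<rho> \<rho> (shift z) = \<rho>"
proof (rule measure_eqI)
  have sets: "sets \<rho> = sets (borel_of (solenoid_topology r))" using haar by (simp add: haar_prob_measure_def)
  have space: "space \<rho> = solenoid_carrier r"
    using sets_eq_imp_space_eq[OF sets] by (simp add: space_borel_of topspace_solenoid)
  fix A assume "A \<in> sets (distr \<rho> \<rho> (shift z))"
  then have A: "A \<in> sets \<rho>" by simp
  have sub: "A \<subseteq> solenoid_carrier r" using sets.sets_into_space[OF A] by (simp add: space)
  have "shift z -` A \<inter> space \<rho> = shift (- z) ` A"
  proof (intro equalityI subsetI)
    fix x assume x: "x \<in> shift z -` A \<inter> space \<rho>"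
    then have "x = shift (- z) (shift z x)" using shift_shift shift_0 by (simp add: space)
    then show "x \<in> shift (- z) ` A" using x by blast
  next
    fix x assume "x \<in> shift (- z) ` A"
    then show "x \<in> shift z -` A \<inter> space \<rho>"
      using sub shift_shift shift_0 shift_carrier by (auto simp: space subset_iff)
  qed
  also have "\<dots> = (\<lambda>x. solenoid_diag r (- z) \<otimes>\<^bsub>solenoid r\<^esub> x) ` A"
    using sub shift_commute by (intro image_cong) auto
  finally have "emeasure \<rho> (shift z -` A \<inter> space \<rho>) = emeasure \<rho> A"
    using haar A solenoid_diag_carrier[of "- z"] by (simp add: haar_prob_measure_def solenoid_def)
  then show "emeasure (distr \<rho> \<rho> (shift z)) A = emeasure \<rho> A"
    using emeasure_distr[OF shift_measurable[OF sets] A] by simp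
qed simp

definition power_coord :: "nat \<Rightarrow> ('d::finite \<Rightarrow> nat \<Rightarrow> complex set) \<Rightarrow> complex ^ 'd" where
  "power_coord n g = (\<chi> i. coord n (g i))"

definition power_shift :: "complex ^ 'd::finite \<Rightarrow> ('d \<Rightarrow> nat \<Rightarrow> complex set) \<Rightarrow> 'd \<Rightarrow> nat \<Rightarrow> complex set" where
  "power_shift z g = (\<lambda>i. shift (z $ i) (g i))"

lemma coset_function_eq: "coset_function r F = (\<lambda>g z. F (power_shift z g))"
  by (intro ext) (simp add: coset_function_def solenoid_power_def product_group_def solenoid_power_diag_def
      power_shift_def shift_def restrict_def)

lemma real_coord_power_coord:
  "real_coord p (power_coord n g) = (if snd p then Re (coord n (g (fst p))) else Im (coord n (g (fst p))))"
  by (simp add: real_coord_def power_coord_def)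

text \<open>Invariance under translations and generation by cells pass from the solenoid to its power because
  both can be checked one component at a time.\<close>

lemma power_torus_tower:
  fixes \<rho> :: "(nat \<Rightarrow> complex set) measure"
  assumes summable: "summable (\<lambda>n. 1 / real (r (Suc n)))"
    and haar: "haar_prob_measure (solenoid r) (solenoid_topology r) \<rho>"
  shows "torus_tower (\<Pi>\<^sub>M i\<in>(UNIV :: 'd::finite set). \<rho>) (\<lambda>n. r (Suc n)) power_coord power_shift R"
proof -
  let ?M = "\<Pi>\<^sub>M i\<in>(UNIV :: 'd::finite set). \<rho>"
  have sets: "sets \<rho> = sets (borel_of (solenoid_topology r))" and prob: "prob_space \<rho>"
    using haar by (simp_all add: haar_prob_measure_def)
  have space: "space \<rho> = solenoid_carrier r"
    using sets_eq_imp_space_eq[OF sets] by (simp add: space_borel_of topspace_solenoid)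
  have space_M: "space ?M = {g. \<forall>i. g i \<in> solenoid_carrier r}"
    by (auto simp: space_PiM space PiE_def Pi_def)
  note [measurable] = coord_measurable[OF sets] shift_measurable[OF sets]
  interpret \<rho>: prob_space \<rho> by (rule prob)
  interpret product_prob_space "\<lambda>_. \<rho>" "UNIV :: 'd set" by unfold_locales
  interpret M: prob_space ?M by (intro prob_space_PiM prob)
  have coord_M: "power_coord n \<in> borel_measurable ?M" for n
  proof -
    have "(\<lambda>g. \<Sum>i\<in>(UNIV :: 'd set). axis i (coord n (g i))) \<in> borel_measurable ?M"
    proof (rule borel_measurable_sum)
      fix i :: 'd
      have "continuous_on UNIV (axis i :: complex \<Rightarrow> complex ^ 'd)"
        unfolding axis_def
      proof (rule continuous_on_vec_lambda)
        show "continuous_on UNIV (\<lambda>c :: complex. if j = i then c else 0)" for j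
          by (cases "j = i") (auto intro: continuous_on_id continuous_on_const)
      qed
      then have [measurable]: "(axis i :: complex \<Rightarrow> complex ^ 'd) \<in> borel_measurable borel"
        by (rule borel_measurable_continuous_onI)
      show "(\<lambda>g. axis i (coord n (g i))) \<in> borel_measurable ?M" by measurable
    qed
    also have "(\<lambda>g. \<Sum>i\<in>(UNIV :: 'd set). axis i (coord n (g i))) = power_coord n"
      by (auto simp: power_coord_def vec_eq_iff fun_eq_iff axis_def)
    finally show ?thesis .
  qed
  have shift_M: "power_shift z \<in> measurable ?M ?M" for z
    unfolding power_shift_def[abs_def]
    by (rule measurable_PiM_single') (auto simp: space_PiM space PiE_def Pi_def shift_carrier)
  show ?thesis
  proof
    show "0 < r (Suc n)" for n by (rule r_pos) simp
    show "summable (\<lambda>n. 1 / real (r (Suc n)))" by (rule summable)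
    show "R 0 = 1" by (simp add: Rprod_def)
    show "R (Suc n) = real (r (Suc n)) * R n" for n by (simp add: Rprod_Suc)
    show "power_coord n \<in> borel_measurable ?M" for n by (rule coord_M)
    show "power_shift z \<in> measurable ?M ?M" for z by (rule shift_M)
    fix g :: "'d \<Rightarrow> nat \<Rightarrow> complex set" assume "g \<in> space ?M"
    then have g: "g i \<in> solenoid_carrier r" for i by (simp add: space_M)
    show "real_coord p (power_coord n g) \<in> {0..<R (Suc n)}" for p n
      using coord_range by (simp add: real_coord_power_coord)
    show "power_coord n g = reduce_vec (R (Suc n)) (power_coord (Suc n) g)" for n
      unfolding vec_eq_real_coords real_coord_reduce_vec real_coord_power_coord
    proof
      fix p :: "'d \<times> bool"
      note eq = coord_compat[of "g (fst p)" n, OF g]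
      show "(if snd p then Re (coord n (g (fst p))) else Im (coord n (g (fst p)))) = reduce (R (Suc n))
          (if snd p then Re (coord (Suc n) (g (fst p))) else Im (coord (Suc n) (g (fst p))))"
        using arg_cong[OF eq, of Re] arg_cong[OF eq, of Im]
        by (cases "snd p") (simp_all only: reduce_complex_simps if_True if_False)
    qed
    show "power_coord n (power_shift z g) = reduce_vec (R (Suc n)) (power_coord n g + z)" for n z
      unfolding vec_eq_real_coords real_coord_reduce_vec real_coord_add real_coord_power_coord
      using coord_shift[OF g] by (auto simp: power_shift_def real_coord_def)
    show "power_shift w (power_shift z g) = power_shift (w + z) g" for w z
      using shift_shift[OF g] by (simp add: power_shift_def)
  next
    fix z :: "complex ^ 'd"
    show "distr ?M ?M (power_shift z) = ?M"
    proof (rule PiM_eqI)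
      fix A assume A: "\<And>i. i \<in> (UNIV :: 'd set) \<Longrightarrow> A i \<in> sets \<rho>"
      have "power_shift z -` PiE UNIV A \<inter> space ?M = PiE UNIV (\<lambda>i. shift (z $ i) -` A i \<inter> space \<rho>)"
        by (auto simp: power_shift_def space_PiM PiE_def Pi_def)
      then have "emeasure (distr ?M ?M (power_shift z)) (PiE UNIV A)
          = emeasure ?M (PiE UNIV (\<lambda>i. shift (z $ i) -` A i \<inter> space \<rho>))"
        using A by (subst emeasure_distr[OF shift_M]) (auto intro!: sets_PiM_I_finite)
      also have "\<dots> = (\<Prod>i\<in>UNIV. emeasure \<rho> (shift (z $ i) -` A i \<inter> space \<rho>))"
        using A by (intro emeasure_PiM) (auto intro: measurable_sets[OF shift_measurable[OF sets]])
      also have "\<dots> = (\<Prod>i\<in>UNIV. emeasure \<rho> (A i))"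
      proof (rule prod.cong[OF refl])
        fix i :: 'd
        show "emeasure \<rho> (shift (z $ i) -` A i \<inter> space \<rho>) = emeasure \<rho> (A i)"
          using emeasure_distr[OF shift_measurable[OF sets] A[of i], of "z $ i"] by (simp add: shift_preserves[OF haar])
      qed
      finally show "emeasure (distr ?M ?M (power_shift z)) (PiE UNIV A) = (\<Prod>i\<in>UNIV. emeasure \<rho> (A i))" .
    qed simp_all
  next
    let ?G = "{{g \<in> space ?M. grid_index n (power_coord n g) = s} | n s. True}"
    define N where "N = sigma (space ?M) ?G"
    have G: "?G \<subseteq> Pow (space ?M)" by blast
    have space_N: "space N = space ?M" unfolding N_def by (rule space_measure_of[OF G])
    have sets_N: "sets N = sigma_sets (space ?M) ?G" unfolding N_def by (rule sets_measure_of[OF G])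
    have proj: "(\<lambda>g. g i) \<in> measurable N \<rho>" for i :: 'd
    proof (rule measurable_sigma_sets[OF sets_solenoid_cells[OF sets]])
      show "{cell n s | n s. True} \<subseteq> Pow (solenoid_carrier r)" by (auto simp: cell_def)
      show "(\<lambda>g. g i) \<in> space N \<rightarrow> solenoid_carrier r" by (simp add: space_N space_M)
      fix A assume "A \<in> {cell n s | n s. True}"
      then obtain n s where A: "A = cell n s" by blast
      have "(\<lambda>g. g i) -` A \<inter> space N = (\<Union>t\<in>{t. t (i, True) = fst s \<and> t (i, False) = snd s}.
          {g \<in> space ?M. grid_index n (power_coord n g) = t})"
        by (auto simp: A cell_def space_N space_M grid_index_def real_coord_power_coord)
      also have "\<dots> \<in> sets N"
        unfolding sets_N[symmetric]
        by (intro sets.countable_UN' countableI_type image_subsetI) (auto simp: sets_N)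
      finally show "(\<lambda>g. g i) -` A \<inter> space N \<in> sets N" .
    qed
    have "(\<lambda>g i. g i) \<in> measurable N ?M"
      by (rule measurable_PiM_single') (auto simp: proj space_N space_PiM)
    then have id: "(\<lambda>g. g) \<in> measurable N ?M" .
    show "sets ?M \<subseteq> sigma_sets (space ?M) ?G"
    proof
      fix A assume A: "A \<in> sets ?M"
      have "(\<lambda>g. g) -` A \<inter> space N = A" using sets.sets_into_space[OF A] by (auto simp: space_N)
      then show "A \<in> sigma_sets (space ?M) ?G" using measurable_sets[OF id A] by (simp add: sets_N)
    qed
  qed
qed

end

theorem theorem3p4:
  fixes r :: "nat \<Rightarrow> nat"
    and \<rho> :: "(nat \<Rightarrow> complex set) measure"
  assumes "\<And>n. n \<ge> 1 \<Longrightarrow> r n > 0"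
    and "summable (\<lambda>n. 1 / real (r (Suc n)))"
    and "haar_prob_measure (solenoid r) (solenoid_topology r) \<rho>"
  shows "\<exists>F :: ('d::finite \<Rightarrow> nat \<Rightarrow> complex set) \<Rightarrow> complex.
     F \<in> borel_measurable (\<Pi>\<^sub>M i\<in>UNIV. \<rho>) \<and>
     (AE g in (\<Pi>\<^sub>M i\<in>UNIV. \<rho>). coset_function r F g \<in> universal_functions) \<and>
     (\<exists>\<nu>. ae_push_forward (\<Pi>\<^sub>M i\<in>UNIV. \<rho>) entire_topology (coset_function r F) \<nu> \<and>
        ergodic_measure entire_topology translate \<nu> \<and>
        (AE f in \<nu>. f \<in> universal_functions))"
proof -
  interpret solenoid_tower r by unfold_locales (rule assms(1))
  show ?thesis
    unfolding coset_function_eq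
    by (rule torus_tower.universal_entire_function[OF power_torus_tower[OF assms(2,3)]])
qed

end
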